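(* For every integer $n\ge 2$ and every real $p$ with $1<p<\infty$, there are a real number $k>1$ and a function $f\in C^2([0,\pi])$ with $f(0)=1$ such that the function $u:\mathbf{R}^n\to\mathbf{R}$ defined by $$u(x)=|x|^k f(\theta),\qquad \theta=\arccos\frac{x_n}{|x|}\quad (x\neq 0),\qquad u(0)=0,$$ is a $p$-harmonic function belonging to $C^1(\mathbf{R}^n)\cap C^2(\mathbf{R}^n\setminus\{0\})$ whose only critical point is the origin (i.e. $\nabla u(x)=0$ if and only if $x=0$). Moreover, $f'(0)=f'(\pi)=0$ and $f(\pi-\theta)=f(\theta)$ for all $\theta\in[0,\pi]$.
   Context: For $1<p<\infty$, a function $u\in W^{1,p}_{\mathrm{loc}}(\mathbf{R}^n)$ is called $p$-harmonic if it is a weak solution of $\mathrm{div}(|\nabla u|^{p-2}\nabla u)=0$ in $\mathbf{R}^n$, that is, $$\int_{\mathbf{R}^n}\langle |\nabla u|^{p-2}\nabla u,\nabla\varphi\rangle\,dx=0\qquad\text{for every }\varphi\in C_0^\infty(\mathbf{R}^n).$$ Here $x_n$ denotes the last coordinate of $x\in\mathbf{R}^n$ and $|x|$ its Euclidean norm. *)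

theory Defs
  imports "HOL-Analysis.Analysis"
begin

text \<open>
  The Frechet derivative within \<open>S\<close> is unique when \<open>S\<close> is open or a nondegenerate closed interval;
  \<open>C_on\<close> is meant for such \<open>S\<close> only. At the endpoints of \<open>{a..b}\<close> the derivatives are one-sided.
\<close>

primrec C_on :: "nat \<Rightarrow> ('a::euclidean_space \<Rightarrow> real) \<Rightarrow> 'a set \<Rightarrow> bool" where
  "C_on 0 f S \<longleftrightarrow> continuous_on S f"
| "C_on (Suc m) f S \<longleftrightarrow> f differentiable_on S \<and>
     (\<forall>b\<in>Basis. C_on m (\<lambda>x. frechet_derivative f (at x within S) b) S)"

definition grad :: "(real ^ 'n \<Rightarrow> real) \<Rightarrow> real ^ 'n \<Rightarrow> real ^ 'n" where
  "grad u x = (\<chi> i. frechet_derivative u (at x) (axis i 1))"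

definition test_function :: "(real ^ 'n \<Rightarrow> real) \<Rightarrow> bool" where
  "test_function \<phi> \<longleftrightarrow> (\<forall>m. C_on m \<phi> UNIV) \<and> compact (closure {x. \<phi> x \<noteq> 0})"

definition Lp_loc :: "real \<Rightarrow> (real ^ 'n \<Rightarrow> 'b::euclidean_space) \<Rightarrow> bool" where
  "Lp_loc p g \<longleftrightarrow> g \<in> borel_measurable lebesgue \<and>
     (\<forall>K. compact K \<longrightarrow> set_integrable lebesgue K (\<lambda>x. norm (g x) powr p))"

definition weak_gradient :: "(real ^ 'n \<Rightarrow> real) \<Rightarrow> (real ^ 'n \<Rightarrow> real ^ 'n) \<Rightarrow> bool" where
  "weak_gradient u G \<longleftrightarrow> Lp_loc 1 u \<and> Lp_loc 1 G \<and>
     (\<forall>\<phi>. test_function \<phi> \<longrightarrow>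
        (\<forall>i. (LINT x|lebesgue. u x * grad \<phi> x $ i) = - (LINT x|lebesgue. G x $ i * \<phi> x)))"

text \<open>
  The existentially quantified \<open>G\<close> is the weak gradient of \<open>u\<close>, which is unique almost everywhere;
  the first three conjuncts say that \<open>u\<close> lies in the local Sobolev space of order 1 and exponent \<open>p\<close>.
  As \<open>0 powr a = 0\<close>, the flux \<open>norm G powr (p - 2) *\<^sub>R G\<close> vanishes where \<open>G\<close> does, also for \<open>p < 2\<close>.
\<close>

definition p_harmonic :: "real \<Rightarrow> (real ^ 'n \<Rightarrow> real) \<Rightarrow> bool" where
  "p_harmonic p u \<longleftrightarrow> (\<exists>G. weak_gradient u G \<and> Lp_loc p u \<and> Lp_loc p G \<and>
     (\<forall>\<phi>. test_function \<phi> \<longrightarrow>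
        has_bochner_integral lebesgue
          (\<lambda>x. ((norm (G x) powr (p - 2)) *\<^sub>R G x) \<bullet> grad \<phi> x) 0))"

definition last_coord :: "real ^ 'n::{finite,linorder} \<Rightarrow> real" where
  "last_coord x = x $ Max UNIV"

definition quasi_radial :: "real \<Rightarrow> (real \<Rightarrow> real) \<Rightarrow> real ^ 'n::{finite,linorder} \<Rightarrow> real" where
  "quasi_radial k f x =
     (if x = 0 then 0 else norm x powr k * f (arccos (last_coord x / norm x)))"

end

theory Submission
  imports Defs
begin

text \<open>
  In terms of \<open>c = x\<^sub>n / |x|\<close> the function sought is \<open>|x|\<^sup>k g(c)\<close> with \<open>f(\<theta>) = g(cos \<theta>)\<close>.  It is
  \<open>p\<close>-harmonic away from the origin if and only if \<open>g\<close> solves a second-order equation on \<open>(-1, 1)\<close>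
  that is singular at the poles \<open>c = 1\<close> and \<open>c = -1\<close> (locale \<open>profile\<close> below).  The equation is
  homogeneous in \<open>g\<close>, so in polar coordinates \<open>k g = \<rho> cos \<phi>\<close>, \<open>sqrt (1 - c\<^sup>2) g' = \<rho> sin \<phi>\<close> the
  angle \<open>\<phi>\<close> satisfies a first-order equation of its own.  In the time \<open>t\<close> with \<open>c = tanh t\<close> that
  equation, \<open>\<phi>' = H k t \<phi>\<close>, is globally Lipschitz, and the poles are moved to infinity.

  The exponent is found by shooting from the equator with \<open>\<phi>(0) = pi\<close>, which makes \<open>g\<close> even.
  The solution is regular at the pole if it stays in the region \<open>0 \<le> \<phi> \<le> C / cosh t\<close>.
  For large \<open>k\<close> it leaves this region through 0.  For \<open>k = 1\<close> it leaves through the upper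
  barrier, because it stays above the angle \<open>arccos (tanh t)\<close> of the linear function \<open>x\<^sub>n\<close>.
  A solution that has left the region through one side does not come back, so the exponents
  of the two kinds form disjoint open sets; as an interval is connected, some \<open>k > 1\<close> is of
  neither kind (lemma \<open>shooting\<close>).

  For this \<open>k\<close> the function \<open>sin \<phi> cosh t = g' / \<rho>\<close> is a bounded solution of
  \<open>z' = (N - 1) z - \<lambda> + o(1)\<close>.  The equilibrium is unstable, so \<open>z\<close> must converge to it (lemma
  \<open>bounded_unstable_tendsto_0\<close>).  The limit is the value of \<open>g' / \<rho>\<close> which is compatible with the
  singular equation, and it yields \<open>C\<^sup>2\<close> regularity of \<open>f\<close>, and of \<open>u\<close> on the axis.

  The gradient \<open>\<nabla>u\<close> and the flux \<open>|\<nabla>u|\<^sup>p\<^sup>-\<^sup>2 \<nabla>u\<close> are both homogeneous fields of the kind treated in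
  locale \<open>axial_field\<close>: they are of class \<open>C\<^sup>1\<close> away from the origin and continuous there, since
  \<open>k > 1\<close>, and the equation for \<open>g\<close> says that the flux has divergence 0.  The only critical point
  is the origin since \<open>\<rho> > 0\<close>.  The weak formulation across the origin follows by cutting out a
  ball of radius \<open>\<epsilon>\<close>, which costs \<open>O(\<epsilon>\<^sup>n\<^sup>-\<^sup>1)\<close>; here \<open>n \<ge> 2\<close> enters
  (lemma \<open>weakly_divergence_free\<close>).
\<close>

section \<open>Initial value problems with a parameter\<close>

lemma scaled_integral_antiderivative:
  fixes h :: "real \<Rightarrow> real"
  assumes cont: "continuous_on {0..} h" and "0 \<le> t"
  shows "t * integral {0..1} (\<lambda>s. h (s * t)) = integral {0..t} h"
proof -
  have ch: "continuous_on {0..t} h"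
    by (rule continuous_on_subset[OF cont]) auto
  define P where "P = (\<lambda>u. integral {0..u} h)"
  have P: "(P has_real_derivative h u) (at u within {0..t})" if "u \<in> {0..t}" for u
    unfolding P_def using integral_has_real_derivative[OF ch that] .
  have "((\<lambda>s. P (s * t)) has_real_derivative t * h (s * t)) (at s within {0..1})"
    if "s \<in> {0..1}" for s
  proof -
    have sub: "(\<lambda>s. s * t) ` {0..1} \<subseteq> {0..t}"
      using \<open>0 \<le> t\<close> by (auto simp: mult_left_le_one_le)
    have st: "s * t \<in> {0..t}" using that \<open>0 \<le> t\<close> by (auto simp: mult_left_le_one_le)
    have "(P has_real_derivative h (s * t)) (at (s * t) within (\<lambda>s. s * t) ` {0..1})"
      by (rule DERIV_subset[OF P[OF st] sub])
    moreover have "((\<lambda>s. s * t) has_real_derivative t) (at s within {0..1})"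
      by (auto intro!: derivative_eq_intros)
    ultimately show ?thesis
      using DERIV_image_chain[of P "h (s * t)" "\<lambda>s. s * t" s "{0..1}" t]
      by (simp add: o_def mult.commute)
  qed
  hence "((\<lambda>s. t * h (s * t)) has_integral (P (1 * t) - P (0 * t))) {0..1}"
    by (intro fundamental_theorem_of_calculus)
       (auto simp: has_real_derivative_iff_has_vector_derivative[symmetric])
  hence "integral {0..1} (\<lambda>s. t * h (s * t)) = P (1 * t) - P (0 * t)"
    by (rule integral_unique)
  thus ?thesis by (simp add: P_def)
qed

text \<open>Global solutions on a half-line that depend continuously on time and a parameter jointly:
  the contraction principle is applied to functions of \<open>(t, k)\<close>, weighted with \<open>exp (- 2 * L * t)\<close>.\<close>

lemma picard_parameter:
  fixes F :: "real \<Rightarrow> real \<Rightarrow> real \<Rightarrow> real"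
  assumes cont: "continuous_on UNIV (\<lambda>(t, x, k). F t x k)"
    and lip: "\<And>t x y k. \<bar>F t x k - F t y k\<bar> \<le> L * \<bar>x - y\<bar>"
    and bdd: "\<And>t x k. \<bar>F t x k\<bar> \<le> M"
    and "0 < L"
  obtains X where "continuous_on UNIV (\<lambda>(t, k). X t k)" "\<And>k. X 0 k = x0"
    "\<And>t k. 0 \<le> t \<Longrightarrow> ((\<lambda>t. X t k) has_real_derivative F t (X t k) k) (at t within {0..})"
proof -
  have M0: "0 \<le> M" using bdd[of 0 0 0] by linarith
  have contF: "continuous_on S (\<lambda>z. F (a z) (b z) (c z))"
    if "continuous_on S a" "continuous_on S b" "continuous_on S c"
    for S :: "'z::topological_space set" and a b c
  proof -
    have "continuous_on S (\<lambda>z. (\<lambda>(t, x, k). F t x k) (a z, b z, c z))"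
      by (rule continuous_on_compose2[OF cont]) (auto intro!: continuous_intros that)
    thus ?thesis by simp
  qed
  \<comment> \<open>The integral up to time \<open>t\<close> is written over the fixed interval \<open>{0..1}\<close>, so that its
    continuity in \<open>(t, k)\<close> is continuity of a parameter integral.\<close>
  define J where "J = (\<lambda>(\<psi> :: real \<times> real \<Rightarrow> real) t k.
    integral {0..1} (\<lambda>s. F (s * t) (exp (2 * L * (s * t)) * \<psi> (s * t, k)) k))"
  define T where "T = (\<lambda>\<psi> z. exp (- 2 * L * max 0 (fst z)) *
    (x0 + max 0 (fst z) * J \<psi> (max 0 (fst z)) (snd z)))"
  have int: "(\<lambda>s. F (s * t) (exp (2 * L * (s * t)) * apply_bcontfun \<psi> (s * t, k)) k)
      integrable_on {0..1}" for \<psi> t k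
    by (intro integrable_continuous_interval contF continuous_intros
        continuous_on_compose2[OF continuous_on_apply_bcontfun[of UNIV]]) auto
  have Tc: "continuous_on UNIV (T (apply_bcontfun \<psi>))" for \<psi>
  proof -
    have "continuous_on UNIV (\<lambda>z :: real \<times> real. integral (cbox 0 1)
        ((\<lambda>z s. F (s * max 0 (fst z))
          (exp (2 * L * (s * max 0 (fst z))) * apply_bcontfun \<psi> (s * max 0 (fst z), snd z))
          (snd z)) z))"
      by (rule integral_continuous_on_param)
         (auto simp: case_prod_beta intro!: contF continuous_intros
            continuous_on_compose2[OF continuous_on_apply_bcontfun[of UNIV]])
    thus ?thesis
      unfolding T_def J_def by (intro continuous_intros) (simp add: cbox_interval)
  qed
  have Jb: "\<bar>J (apply_bcontfun \<psi>) t k\<bar> \<le> M" for \<psi> t k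
  proof -
    have "continuous_on {0..1} (\<lambda>s. F (s * t) (exp (2 * L * (s * t)) * apply_bcontfun \<psi> (s * t, k)) k)"
      by (intro contF continuous_intros
        continuous_on_compose2[OF continuous_on_apply_bcontfun[of UNIV]]) auto
    thus ?thesis
      using integral_bound[of 0 1 "\<lambda>s. F (s * t) (exp (2 * L * (s * t)) * apply_bcontfun \<psi> (s * t, k)) k" M]
        bdd by (simp add: J_def)
  qed
  have Tb: "bounded (range (T (apply_bcontfun \<psi>)))" for \<psi>
  proof (rule boundedI)
    fix y assume "y \<in> range (T (apply_bcontfun \<psi>))"
    then obtain z where y: "y = T (apply_bcontfun \<psi>) z" by auto
    define t where "t = max 0 (fst z)"
    have t: "0 \<le> t" by (simp add: t_def)
    have "2 * L * t \<le> exp (2 * L * t)"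
      using exp_ge_add_one_self[of "2 * L * t"] by linarith
    hence e: "exp (- 2 * L * t) * t \<le> 1 / (2 * L)"
      using \<open>0 < L\<close> by (simp add: exp_minus field_simps)
    have "\<bar>y\<bar> \<le> exp (- 2 * L * t) * \<bar>x0\<bar> + exp (- 2 * L * t) * (t * \<bar>J (apply_bcontfun \<psi>) t (snd z)\<bar>)"
      unfolding y T_def t_def[symmetric] using t
      by (auto simp: abs_mult distrib_left[symmetric] intro!: order.trans[OF abs_triangle_ineq])
    also have "\<dots> \<le> 1 * \<bar>x0\<bar> + (exp (- 2 * L * t) * t) * M"
      using Jb[of \<psi> t "snd z"] t \<open>0 < L\<close>
      by (intro add_mono mult_right_mono) (auto simp: mult.assoc intro!: mult_left_mono)
    also have "\<dots> \<le> \<bar>x0\<bar> + 1 / (2 * L) * M"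
      using mult_right_mono[OF e M0] by simp
    finally show "norm y \<le> \<bar>x0\<bar> + 1 / (2 * L) * M" by simp
  qed
  define TT where "TT = (\<lambda>\<psi>. Bcontfun (T (apply_bcontfun \<psi>)))"
  have TT: "apply_bcontfun (TT \<psi>) = T (apply_bcontfun \<psi>)" for \<psi>
    unfolding TT_def using Tc Tb by (simp add: Bcontfun_inverse bcontfun_def)
  have "\<exists>!\<psi>. TT \<psi> = \<psi>"
  proof (rule banach_fix_type[of "1/2"])
    show "\<forall>\<psi> \<eta>. dist (TT \<psi>) (TT \<eta>) \<le> 1 / 2 * dist \<psi> \<eta>"
    proof (intro allI dist_bound)
      fix \<psi> \<eta> :: "(real \<times> real) \<Rightarrow>\<^sub>C real" and z :: "real \<times> real"
      define t where "t = max 0 (fst z)"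
      define k where "k = snd z"
      define d where "d = dist \<psi> \<eta>"
      have t: "0 \<le> t" by (simp add: t_def)
      let ?E = "\<lambda>s. t * (L * (exp (2 * L * (s * t)) * d))"
      have E: "(?E has_integral (exp (2 * L * (1 * t)) * d / 2 - exp (2 * L * (0 * t)) * d / 2)) {0..1}"
        by (intro fundamental_theorem_of_calculus)
           (auto simp: has_real_derivative_iff_has_vector_derivative[symmetric]
             intro!: derivative_eq_intros)
      have pt: "\<bar>apply_bcontfun \<psi> w - apply_bcontfun \<eta> w\<bar> \<le> d" for w
        using dist_bounded[of \<psi> w \<eta>] by (simp add: d_def dist_real_def)
      let ?f = "\<lambda>\<psi> s. F (s * t) (exp (2 * L * (s * t)) * apply_bcontfun \<psi> (s * t, k)) k"
      have "norm (integral {0..1} (\<lambda>s. t * (?f \<psi> s - ?f \<eta> s))) \<le> integral {0..1} ?E"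
      proof (rule integral_norm_bound_integral)
        show "(\<lambda>s. t * (?f \<psi> s - ?f \<eta> s)) integrable_on {0..1}"
          by (intro integrable_on_mult_right integrable_diff int)
        show "?E integrable_on {0..1}" using E by blast
        fix s :: real
        have "\<bar>?f \<psi> s - ?f \<eta> s\<bar> \<le> L * \<bar>exp (2 * L * (s * t)) * (apply_bcontfun \<psi> (s * t, k) - apply_bcontfun \<eta> (s * t, k))\<bar>"
          using lip[of "s * t" "exp (2 * L * (s * t)) * apply_bcontfun \<psi> (s * t, k)" k "exp (2 * L * (s * t)) * apply_bcontfun \<eta> (s * t, k)"]
          by (simp add: right_diff_distrib)
        also have "\<dots> \<le> L * (exp (2 * L * (s * t)) * d)"
          unfolding abs_mult using pt \<open>0 < L\<close> by (intro mult_left_mono) auto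
        finally show "norm (t * (?f \<psi> s - ?f \<eta> s)) \<le> ?E s"
          using t by (simp add: abs_mult mult_left_mono)
      qed
      moreover have "integral {0..1} (\<lambda>s. t * (?f \<psi> s - ?f \<eta> s)) = t * (J \<psi> t k - J \<eta> t k)"
        unfolding J_def by (simp only: integral_mult_right integral_diff[OF int int])
      moreover have "integral {0..1} ?E = (exp (2 * L * t) - 1) * d / 2"
        using integral_unique[OF E] by (simp only: mult_1 mult_zero_left mult_zero_right exp_zero
            left_diff_distrib diff_divide_distrib)
      ultimately have "\<bar>t * (J \<psi> t k - J \<eta> t k)\<bar> \<le> (exp (2 * L * t) - 1) * d / 2"
        by (simp only: real_norm_def)
      also have "\<dots> \<le> exp (2 * L * t) * d / 2"
        using zero_le_dist[of \<psi> \<eta>] by (simp add: d_def left_diff_distrib)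
      finally have 1: "\<bar>t * (J \<psi> t k - J \<eta> t k)\<bar> \<le> exp (2 * L * t) * d / 2" .
      have "T \<psi> z - T \<eta> z = exp (- 2 * L * t) * (t * (J \<psi> t k - J \<eta> t k))"
        by (simp add: T_def t_def[symmetric] k_def[symmetric] algebra_simps)
      hence "\<bar>T \<psi> z - T \<eta> z\<bar> = exp (- 2 * L * t) * \<bar>t * (J \<psi> t k - J \<eta> t k)\<bar>"
        by (simp add: abs_mult)
      also have "\<dots> \<le> exp (- 2 * L * t) * (exp (2 * L * t) * d / 2)"
        by (rule mult_left_mono[OF 1]) simp
      also have "\<dots> = d / 2" by (simp add: exp_minus)
      finally show "dist (apply_bcontfun (TT \<psi>) z) (apply_bcontfun (TT \<eta>) z) \<le> 1 / 2 * d"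
        by (simp add: TT dist_real_def)
    qed
  qed auto
  then obtain \<psi> where "TT \<psi> = \<psi>" by auto
  hence \<psi>: "apply_bcontfun \<psi> z = T (apply_bcontfun \<psi>) z" for z
    using TT by metis
  define X where "X = (\<lambda>t k. exp (2 * L * t) * apply_bcontfun \<psi> (t, k))"
  have Xc: "continuous_on UNIV (\<lambda>(t, k). X t k)"
    unfolding X_def case_prod_beta by (intro continuous_intros) auto
  have Xct: "continuous_on S (\<lambda>t. X t k)" for S k
  proof -
    have "continuous_on S (\<lambda>t. (\<lambda>(t, k). X t k) (t, k))"
      by (rule continuous_on_compose2[OF Xc]) (auto intro!: continuous_intros)
    thus ?thesis by simp
  qed
  have Xi: "X t k = x0 + integral {0..t} (\<lambda>s. F s (X s k) k)" if "0 \<le> t" for t k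
  proof -
    have "X t k = x0 + t * J \<psi> t k"
      unfolding X_def using that by (subst \<psi>) (simp add: T_def exp_minus)
    also have "t * J \<psi> t k = t * integral {0..1} (\<lambda>s. (\<lambda>u. F u (X u k) k) (s * t))"
      by (simp add: J_def X_def)
    also have "\<dots> = integral {0..t} (\<lambda>s. F s (X s k) k)"
      by (rule scaled_integral_antiderivative[OF _ that]) (intro contF continuous_intros Xct)
    finally show ?thesis .
  qed
  show ?thesis
  proof (rule that[OF Xc])
    show "X 0 k = x0" for k using Xi[of 0 k] by simp
    fix t k :: real assume t: "0 \<le> t"
    have "((\<lambda>t. x0 + integral {0..t} (\<lambda>s. F s (X s k) k)) has_real_derivative F t (X t k) k)
        (at t within {0..t + 1})"
      using t by (auto intro!: derivative_eq_intros integral_has_real_derivative contF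
          continuous_intros Xct)
    moreover have "at t within {0..t + 1} = at t within {0..}"
      by (rule at_within_nhd[of _ "{..<t + 1}"]) auto
    ultimately have *: "((\<lambda>t. x0 + integral {0..t} (\<lambda>s. F s (X s k) k)) has_real_derivative F t (X t k) k)
        (at t within {0..})" by simp
    show "((\<lambda>t. X t k) has_real_derivative F t (X t k) k) (at t within {0..})"
      unfolding has_field_derivative_def
      by (rule has_derivative_transform[OF _ _ *[unfolded has_field_derivative_def]]) (use t Xi in auto)
  qed
qed

section \<open>The equation for the angle\<close>

text \<open>A barrier principle: a function that is decreasing at each of its zeros cannot leave the
  negative half-line.\<close>

lemma stays_negative:
  fixes h :: "real \<Rightarrow> real"
  assumes "a \<le> b" "h a < 0"
    and der: "\<And>t. t \<in> {a..b} \<Longrightarrow> (h has_real_derivative h' t) (at t within {a..b})"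
    and neg: "\<And>t. t \<in> {a..b} \<Longrightarrow> h t = 0 \<Longrightarrow> h' t < 0"
  shows "h b < 0"
proof (rule ccontr)
  assume "\<not> h b < 0"
  have cont: "continuous_on {a..b} h"
    by (rule DERIV_continuous_on[OF der])
  define Z where "Z = {t \<in> {a..b}. h t = 0}"
  have ivt: "\<exists>t\<in>{a..c}. h t = 0" if "c \<in> {a..b}" "0 \<le> h c" for c
    using IVT'[of h a 0 c] that \<open>h a < 0\<close> continuous_on_subset[OF cont, of "{a..c}"] by force
  have "closed Z"
    unfolding Z_def using continuous_closed_preimage_constant[OF cont, of 0] by simp
  moreover have "Z \<noteq> {}"
    using ivt[of b] \<open>a \<le> b\<close> \<open>\<not> h b < 0\<close> by (auto simp: Z_def)
  moreover have "bdd_below Z" by (auto simp: Z_def intro!: bdd_belowI[of _ a])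
  ultimately have "Inf Z \<in> Z" by (intro closed_contains_Inf)
  define c where "c = Inf Z"
  have c: "c \<in> {a..b}" "h c = 0" using \<open>Inf Z \<in> Z\<close> by (auto simp: Z_def c_def)
  have "a < c" using c \<open>h a < 0\<close> by (cases "a = c") auto
  obtain d where d: "d > 0" "\<And>e. e > 0 \<Longrightarrow> c - e \<in> {a..b} \<Longrightarrow> e < d \<Longrightarrow> h c < h (c - e)"
    using has_real_derivative_neg_dec_left[OF der[OF c(1)] neg[OF c]] by blast
  define e where "e = min (d / 2) (c - a)"
  have e: "0 < e" "e < d" "c - e \<in> {a..b}"
    using d(1) \<open>a < c\<close> c(1) by (auto simp: e_def min_def)
  obtain s where s: "s \<in> {a..c - e}" "h s = 0"
    using ivt[OF e(3)] d(2)[OF e(1,3,2)] c(2) by auto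
  hence "s \<in> Z" using e by (auto simp: Z_def)
  hence "c \<le> s" unfolding c_def by (rule cInf_lower) fact
  thus False using s e by auto
qed

lemma cosh_ge_half: "(1 + t) / 2 \<le> cosh (t :: real)"
  using exp_ge_add_one_self[of t] exp_gt_zero[of "- t"] by (simp add: cosh_def; linarith)

lemma tanh_square_real: "(tanh t)\<^sup>2 = 1 - (1 / cosh t)\<^sup>2" for t :: real
  by (simp add: tanh_def power_divide field_simps) (simp add: cosh_square_eq)

lemma sech_deriv: "((\<lambda>t. 1 / cosh t) has_real_derivative - tanh t / cosh t) (at t within S)" for t :: real
  by (auto intro!: derivative_eq_intros simp: tanh_def power2_eq_square)

text \<open>The equation for the angle \<open>\<phi>\<close>, in dimension \<open>N\<close>.  The quantity \<open>lam k\<close> arises from taking the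
  divergence of a radial field of degree \<open>(k - 1) * (p - 1)\<close>, and \<open>D\<close> from linearising the
  \<open>p\<close>-Laplacian.  The right-hand side \<open>H\<close> is written with the two periodic functions
  \<open>A\<close> and \<open>B\<close>, which makes its Lipschitz bound evident; the symmetric form is \<open>H_eq\<close>.\<close>

locale profile_ode =
  fixes p N :: real
  assumes p: "1 < p" and N: "2 \<le> N"
begin

definition D :: "real \<Rightarrow> real" where "D x = (cos x)\<^sup>2 + (p - 1) * (sin x)\<^sup>2"
definition A :: "real \<Rightarrow> real" where "A x = sin x * cos x / D x"
definition B :: "real \<Rightarrow> real" where "B x = (cos x)\<^sup>2 / D x"
definition lam :: "real \<Rightarrow> real" where "lam k = (k - 1) * (p - 1) + N - 1"
definition H :: "real \<Rightarrow> real \<Rightarrow> real \<Rightarrow> real" where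
  "H k t x = (N - 2) * tanh t * A x - (k + (lam k - k) * B x) / cosh t"

lemma D_bounds: "min 1 (p - 1) \<le> D x" "0 < D x" "D x \<le> p"
proof -
  have 1: "(cos x)\<^sup>2 = 1 - (sin x)\<^sup>2" by (simp add: cos_squared_eq)
  have 2: "0 \<le> (sin x)\<^sup>2" "(sin x)\<^sup>2 \<le> 1" by (auto simp: abs_square_le_1)
  have D: "D x = 1 - (sin x)\<^sup>2 + (p - 1) * (sin x)\<^sup>2" by (simp add: D_def 1)
  have "min 1 (p - 1) * (1 - (sin x)\<^sup>2) + min 1 (p - 1) * (sin x)\<^sup>2
     \<le> 1 * (1 - (sin x)\<^sup>2) + (p - 1) * (sin x)\<^sup>2"
    using 2 by (intro add_mono mult_right_mono) auto
  thus *: "min 1 (p - 1) \<le> D x" by (simp add: D algebra_simps)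
  show "0 < D x" using * p by auto
  have "(p - 1) * (sin x)\<^sup>2 \<le> (p - 1) * 1"
    using p 2 by (intro mult_left_mono) auto
  thus "D x \<le> p" using 2 D by (simp only: mult_1_right)
qed

lemma D_nz [simp]: "D x \<noteq> 0" using D_bounds(2)[of x] by linarith

lemma B_bounds: "0 \<le> B x" "B x \<le> 1"
  using D_bounds(2)[of x] p by (auto simp: B_def divide_simps) (simp add: D_def)

lemma A_bound: "\<bar>A x\<bar> \<le> 1 / min 1 (p - 1)"
proof -
  have "\<bar>A x\<bar> = \<bar>sin x\<bar> * \<bar>cos x\<bar> / D x"
    using D_bounds(2)[of x] by (simp add: A_def abs_mult)
  also have "\<dots> \<le> 1 / min 1 (p - 1)"
    using D_bounds[of x] p by (intro frac_le mult_le_one) auto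
  finally show ?thesis .
qed

lemma H_eq: "H k t x = ((N - 2) * tanh t * sin x * cos x
    - (lam k * (cos x)\<^sup>2 + k * (p - 1) * (sin x)\<^sup>2) / cosh t) / D x"
proof -
  have "k + (lam k - k) * B x = (lam k * (cos x)\<^sup>2 + k * (p - 1) * (sin x)\<^sup>2) / D x"
    by (simp add: B_def field_simps) (simp add: D_def algebra_simps)
  thus ?thesis by (simp add: H_def A_def diff_divide_distrib mult.commute mult.left_commute)
qed

lemma A_lipschitz: "\<bar>A x - A y\<bar> \<le> 4 * p / (min 1 (p - 1))\<^sup>2 * \<bar>x - y\<bar>"
  and B_lipschitz: "\<bar>B x - B y\<bar> \<le> 4 * p / (min 1 (p - 1))\<^sup>2 * \<bar>x - y\<bar>"
proof -
  let ?\<delta> = "min 1 (p - 1)"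
  define D' where "D' = (\<lambda>x. 2 * (p - 2) * (sin x * cos x))"
  define A' where "A' = (\<lambda>x. (((cos x)\<^sup>2 - (sin x)\<^sup>2) * D x - sin x * cos x * D' x) / (D x)\<^sup>2)"
  define B' where "B' = (\<lambda>x. (- 2 * (sin x * cos x) * D x - (cos x)\<^sup>2 * D' x) / (D x)\<^sup>2)"
  have dD: "(D has_real_derivative D' x) (at x within S)" for x S
    unfolding D_def D'_def by (auto intro!: derivative_eq_intros simp: algebra_simps power2_eq_square)
  have dA: "(A has_real_derivative A' x) (at x within UNIV)" for x
    unfolding A_def A'_def
    by (auto intro!: derivative_eq_intros dD simp: power2_eq_square algebra_simps)
  have dB: "(B has_real_derivative B' x) (at x within UNIV)" for x
    unfolding B_def B'_def
    by (auto intro!: derivative_eq_intros dD simp: power2_eq_square algebra_simps)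
  have sc: "\<bar>sin x * cos x\<bar> \<le> 1" "(cos x)\<^sup>2 \<le> 1" "\<bar>(cos x)\<^sup>2 - (sin x)\<^sup>2\<bar> \<le> 1" for x :: real
  proof -
    show "\<bar>sin x * cos x\<bar> \<le> 1" unfolding abs_mult by (intro mult_le_one) auto
    show "(cos x)\<^sup>2 \<le> 1" by (simp add: abs_square_le_1)
    show "\<bar>(cos x)\<^sup>2 - (sin x)\<^sup>2\<bar> \<le> 1" unfolding cos_double[symmetric] by simp
  qed
  have D'b: "\<bar>D' x\<bar> \<le> 2 * p" for x
  proof -
    have "\<bar>D' x\<bar> = 2 * \<bar>p - 2\<bar> * \<bar>sin x * cos x\<bar>" by (simp only: D'_def abs_mult abs_numeral)
    also have "\<dots> \<le> 2 * p * 1" using p sc by (intro mult_mono) auto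
    finally show ?thesis by simp
  qed
  have D2: "?\<delta>\<^sup>2 \<le> (D x)\<^sup>2" "0 < ?\<delta>\<^sup>2" for x
    using D_bounds[of x] p by (auto intro!: power_mono)
  have bd: "\<bar>(u * D x - v * D' x) / (D x)\<^sup>2\<bar> \<le> 4 * p / ?\<delta>\<^sup>2" if "\<bar>u\<bar> \<le> 2" "\<bar>v\<bar> \<le> 1" for u v x
  proof -
    have "\<bar>u * D x - v * D' x\<bar> \<le> \<bar>u\<bar> * \<bar>D x\<bar> + \<bar>v\<bar> * \<bar>D' x\<bar>"
      by (metis abs_mult abs_triangle_ineq4)
    also have "\<dots> \<le> 2 * p + 1 * (2 * p)"
      using that D_bounds[of x] D'b[of x] p by (intro add_mono mult_mono) auto
    finally have "\<bar>u * D x - v * D' x\<bar> \<le> 4 * p" by simp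
    thus ?thesis unfolding abs_divide using D2(1)[of x] D2(2) p by (intro frac_le) auto
  qed
  have "norm (A x - A y) \<le> 4 * p / ?\<delta>\<^sup>2 * norm (x - y)"
  proof (rule field_differentiable_bound[of UNIV _ A'])
    fix z :: real
    have "\<bar>(cos z)\<^sup>2 - (sin z)\<^sup>2\<bar> \<le> 2" "\<bar>sin z * cos z\<bar> \<le> 1"
      using sc(1,3)[of z] by auto
    from bd[OF this] show "norm (A' z) \<le> 4 * p / ?\<delta>\<^sup>2" by (simp add: A'_def)
  qed (use dA in auto)
  thus "\<bar>A x - A y\<bar> \<le> 4 * p / ?\<delta>\<^sup>2 * \<bar>x - y\<bar>" by simp
  have "norm (B x - B y) \<le> 4 * p / ?\<delta>\<^sup>2 * norm (x - y)"
  proof (rule field_differentiable_bound[of UNIV _ B'])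
    fix z :: real
    have "\<bar>- 2 * (sin z * cos z)\<bar> \<le> 2" "\<bar>(cos z)\<^sup>2\<bar> \<le> 1"
      using sc[of z] by (auto simp: abs_mult)
    from bd[OF this] show "norm (B' z) \<le> 4 * p / ?\<delta>\<^sup>2" by (simp add: B'_def)
  qed (use dB in auto)
  thus "\<bar>B x - B y\<bar> \<le> 4 * p / ?\<delta>\<^sup>2 * \<bar>x - y\<bar>" by simp
qed

lemma continuous_D [continuous_intros]: "continuous_on S f \<Longrightarrow> continuous_on S (\<lambda>z. D (f z))"
  for f :: "'z::t2_space \<Rightarrow> real"
  unfolding D_def by (intro continuous_intros)

lemma continuous_A [continuous_intros]: "continuous_on S f \<Longrightarrow> continuous_on S (\<lambda>z. A (f z))"
  for f :: "'z::t2_space \<Rightarrow> real"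
  unfolding A_def by (auto intro!: continuous_intros)

lemma continuous_B [continuous_intros]: "continuous_on S f \<Longrightarrow> continuous_on S (\<lambda>z. B (f z))"
  for f :: "'z::t2_space \<Rightarrow> real"
  unfolding B_def by (auto intro!: continuous_intros)

lemma abs_lam_minus_bound: "1 \<le> k \<Longrightarrow> k \<le> K \<Longrightarrow> \<bar>lam k - k\<bar> \<le> K * p + N"
proof -
  assume k: "1 \<le> k" "k \<le> K"
  have "lam k - k = (k - 1) * (p - 2) + (N - 2)" by (simp add: lam_def algebra_simps)
  hence "\<bar>lam k - k\<bar> \<le> \<bar>(k - 1) * (p - 2)\<bar> + \<bar>N - 2\<bar>" by (metis abs_triangle_ineq)
  also have "\<dots> \<le> K * p + N"
    unfolding abs_mult using k p N by (intro add_mono mult_mono) auto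
  finally show ?thesis .
qed

text \<open>The solutions starting from \<open>pi\<close> at the equator.\<close>

lemma H_flow:
  assumes K: "1 \<le> K"
  shows "\<exists>X. (\<forall>t. continuous_on UNIV (X t)) \<and> (\<forall>k. X 0 k = pi) \<and>
    (\<forall>t k. 0 \<le> t \<longrightarrow> 1 \<le> k \<longrightarrow> k \<le> K \<longrightarrow>
       ((\<lambda>t. X t k) has_real_derivative H k t (X t k)) (at t within {0..}))"
proof -
  \<comment> \<open>The Lipschitz bound is uniform only for \<open>k\<close> in a bounded set, so \<open>k\<close> is clamped to \<open>{1..K}\<close>.\<close>
  define cl where "cl = (\<lambda>k. max 1 (min K k))"
  have cl: "1 \<le> cl k" "cl k \<le> K" for k using K by (auto simp: cl_def)
  define C where "C = 4 * p / (min 1 (p - 1))\<^sup>2"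
  have C: "0 \<le> C" using p by (simp add: C_def)
  have m: "0 \<le> N - 2" using N by simp
  have Kp: "0 \<le> K * p + N" using K p N by simp
  define L where "L = (N - 2) * C + (K * p + N) * C + 1"
  have L: "0 < L" using C m Kp by (auto simp: L_def intro!: add_nonneg_pos)
  have tc: "\<bar>tanh t\<bar> \<le> 1" "1 / cosh t \<le> 1" "0 < 1 / cosh t" for t :: real
    using tanh_real_lt_1[of t] tanh_real_gt_neg1[of t] cosh_real_ge_1[of t] by auto
  obtain X where X: "continuous_on UNIV (\<lambda>(t, k). X t k)" "\<And>k. X 0 k = pi"
    "\<And>t k. 0 \<le> t \<Longrightarrow> ((\<lambda>t. X t k) has_real_derivative H (cl k) t (X t k)) (at t within {0..})"
  proof (rule picard_parameter[of "\<lambda>t x k. H (cl k) t x" L _ pi])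
    show "continuous_on UNIV (\<lambda>(t, x, k). H (cl k) t x)"
      unfolding H_def case_prod_beta lam_def cl_def
      by (intro continuous_intros) auto
  next
    fix t x y k :: real
    have e: "H (cl k) t x - H (cl k) t y = (N - 2) * tanh t * (A x - A y)
        - (lam (cl k) - cl k) * (1 / cosh t) * (B x - B y)"
      by (simp add: H_def algebra_simps diff_divide_distrib add_divide_distrib)
    have "\<bar>H (cl k) t x - H (cl k) t y\<bar> \<le> (N - 2) * \<bar>tanh t\<bar> * \<bar>A x - A y\<bar>
        + \<bar>lam (cl k) - cl k\<bar> * (1 / cosh t) * \<bar>B x - B y\<bar>"
      unfolding e using abs_triangle_ineq4[of "(N - 2) * tanh t * (A x - A y)"
        "(lam (cl k) - cl k) * (1 / cosh t) * (B x - B y)"] m by (simp add: abs_mult)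
    also have "\<dots> \<le> (N - 2) * 1 * (C * \<bar>x - y\<bar>) + (K * p + N) * 1 * (C * \<bar>x - y\<bar>)"
      using A_lipschitz[of x y] B_lipschitz[of x y] tc[of t] m Kp
        abs_lam_minus_bound[OF cl] unfolding C_def[symmetric]
      by (intro add_mono mult_mono) auto
    also have "\<dots> \<le> L * \<bar>x - y\<bar>" by (simp add: L_def algebra_simps)
    finally show "\<bar>H (cl k) t x - H (cl k) t y\<bar> \<le> L * \<bar>x - y\<bar>" .
  next
    fix t x k :: real
    have Hb: "\<bar>H (cl k) t x\<bar> \<le> (N - 2) * \<bar>tanh t\<bar> * \<bar>A x\<bar>
        + \<bar>cl k + (lam (cl k) - cl k) * B x\<bar> * (1 / cosh t)"
      unfolding H_def using abs_triangle_ineq4[of "(N - 2) * tanh t * A x"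
        "(cl k + (lam (cl k) - cl k) * B x) / cosh t"] m by (simp add: abs_mult)
    have "\<bar>lam (cl k) - cl k\<bar> * B x \<le> (K * p + N) * 1"
      using abs_lam_minus_bound[OF cl, of k] B_bounds[of x] Kp by (intro mult_mono) auto
    hence "\<bar>cl k + (lam (cl k) - cl k) * B x\<bar> \<le> K + (K * p + N) * 1"
      using cl[of k] B_bounds[of x]
      by (intro order.trans[OF abs_triangle_ineq] add_mono) (auto simp: abs_mult)
    hence "(N - 2) * \<bar>tanh t\<bar> * \<bar>A x\<bar> + \<bar>cl k + (lam (cl k) - cl k) * B x\<bar> * (1 / cosh t)
      \<le> (N - 2) * 1 * (1 / min 1 (p - 1)) + (K + (K * p + N) * 1) * 1"
      using A_bound[of x] tc[of t] m Kp K by (intro add_mono mult_mono) auto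
    with Hb show "\<bar>H (cl k) t x\<bar> \<le> (N - 2) * 1 * (1 / min 1 (p - 1)) + (K + (K * p + N) * 1) * 1" by linarith
  qed (use L in auto)
  show ?thesis
  proof (intro exI[of _ X] conjI allI impI)
    show "continuous_on UNIV (X t)" for t
    proof -
      have "continuous_on UNIV (\<lambda>k. (\<lambda>(t, k). X t k) (t, k))"
        by (rule continuous_on_compose2[OF X(1)]) (auto intro!: continuous_intros)
      thus ?thesis by simp
    qed
    fix t k :: real assume "0 \<le> t" "1 \<le> k" "k \<le> K"
    moreover from this have "cl k = k" by (simp add: cl_def)
    ultimately show "((\<lambda>t. X t k) has_real_derivative H k t (X t k)) (at t within {0..})"
      using X(3)[of t k] by simp
  qed (rule X(2))
qed


end

section \<open>Shooting for the exponent\<close>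

context profile_ode
begin

lemma lam_mono: "k \<le> K \<Longrightarrow> lam k \<le> lam K"
  using p by (auto simp: lam_def intro!: mult_right_mono)

lemma lam_pos: "1 \<le> k \<Longrightarrow> 1 \<le> lam k"
  using p N by (auto simp: lam_def) (smt (verit) mult_nonneg_nonneg)

lemma flux_bounds:
  assumes "1 \<le> k"
  shows "k + (lam k - k) * B x \<le> k + lam k"
    and "(k - 1) * (p - 1) / D x \<le> k + (lam k - k) * B x"
proof -
  have "(lam k - k) * B x \<le> lam k * B x"
    using assms B_bounds[of x] by (intro mult_right_mono) auto
  also have "\<dots> \<le> lam k" using B_bounds[of x] lam_pos[OF assms] mult_left_mono[of "B x" 1 "lam k"] by simp
  finally show "k + (lam k - k) * B x \<le> k + lam k" by simp
  have "(k - 1) * (p - 1) = (k - 1) * (p - 1) * ((cos x)\<^sup>2 + (sin x)\<^sup>2)" by simp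
  also have "\<dots> \<le> lam k * (cos x)\<^sup>2 + k * (p - 1) * (sin x)\<^sup>2"
    unfolding distrib_left
    using assms p N by (intro add_mono mult_right_mono) (auto simp: lam_def)
  finally have "(k - 1) * (p - 1) / D x \<le> (lam k * (cos x)\<^sup>2 + k * (p - 1) * (sin x)\<^sup>2) / D x"
    using D_bounds(2)[of x] by (intro divide_right_mono) auto
  also have "\<dots> = k + (lam k - k) * B x"
    by (simp add: B_def field_simps) (simp add: D_def algebra_simps)
  finally show "(k - 1) * (p - 1) / D x \<le> k + (lam k - k) * B x" .
qed

text \<open>For \<open>k = 1\<close> the linear function \<open>x\<^sub>n\<close> gives the solution \<open>arccos (tanh t)\<close>.\<close>

lemma H_one:
  "H 1 t x = - 1 / cosh t + (N - 2) * cos x * sin (x - arccos (tanh t)) / D x"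
proof -
  have c: "cos (arccos (tanh t)) = tanh t"
    using tanh_real_lt_1[of t] tanh_real_gt_neg1[of t] by (intro cos_arccos) auto
  have s: "sin (arccos (tanh t)) = 1 / cosh t"
    using tanh_real_lt_1[of t] tanh_real_gt_neg1[of t]
    by (subst sin_arccos) (auto simp: tanh_square_real real_sqrt_divide)
  show ?thesis
    by (simp add: H_def lam_def sin_diff c s A_def B_def power2_eq_square field_simps)
qed

lemma arccos_tanh_deriv:
  "((\<lambda>t. arccos (tanh t)) has_real_derivative - 1 / cosh t) (at t within S)"
proof -
  have *: "- 1 < tanh t" "tanh t < 1" using tanh_real_lt_1[of t] tanh_real_gt_neg1[of t] by auto
  have "sqrt (1 - (tanh t)\<^sup>2) = 1 / cosh t" by (simp add: tanh_square_real real_sqrt_divide)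
  hence "((\<lambda>t. arccos (tanh t)) has_real_derivative inverse (- (1 / cosh t)) * (1 - (tanh t)\<^sup>2)) (at t within S)"
    using * by (auto intro!: derivative_eq_intros DERIV_chain2[OF DERIV_arccos])
  moreover have "inverse (- (1 / cosh t)) * (1 - (tanh t)\<^sup>2) = - 1 / cosh t"
    unfolding tanh_square_real by (simp add: power2_eq_square)
  ultimately show ?thesis by simp
qed

text \<open>For a suitable exponent the angle remains between 0 and a multiple of \<open>1 / cosh t\<close>, the
  sine of the polar angle.\<close>

lemma shooting:
  "\<exists>k \<phi> t0 C. 1 < k \<and> \<phi> 0 = pi \<and>
    (\<forall>t\<ge>0. (\<phi> has_real_derivative H k t (\<phi> t)) (at t within {0..})) \<and>
    (\<forall>t\<ge>0. 0 \<le> \<phi> t) \<and> (\<forall>t\<ge>t0. \<phi> t \<le> C / cosh t)"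
proof -
  \<comment> \<open>Chosen such that \<open>H K t x \<le> - 4\<close> for \<open>0 \<le> t \<le> 1\<close>: then \<open>\<phi>\<close> drops from \<open>pi\<close> below 0.\<close>
  define K where "K = 1 + 2 * (N - 2 + 4 * p) / (p - 1)"
  have K: "1 < K" using p N by (auto simp: K_def intro!: divide_pos_pos)
  have Kp: "(K - 1) * (p - 1) = 2 * (N - 2 + 4 * p)" using p by (simp add: K_def)
  obtain X where XX: "\<forall>t. continuous_on UNIV (X t)" "\<forall>k. X 0 k = pi"
    "\<forall>t k. 0 \<le> t \<longrightarrow> 1 \<le> k \<longrightarrow> k \<le> K \<longrightarrow>
       ((\<lambda>t. X t k) has_real_derivative H k t (X t k)) (at t within {0..})"
    using H_flow[OF less_imp_le[OF K]] by blast
  have Xc: "continuous_on UNIV (X t)" and X0: "X 0 k = pi" for t k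
    using XX by auto
  have X: "((\<lambda>t. X t k) has_real_derivative H k t (X t k)) (at t within {0..})"
      if "0 \<le> t" "1 \<le> k" "k \<le> K" for t k
    using XX that by auto
  have X': "((\<lambda>t. X t k) has_real_derivative H k t (X t k)) (at t within {a..b})"
    if "t \<in> {a..b}" "0 \<le> a" "1 \<le> k" "k \<le> K" for t a b k
    by (rule DERIV_subset[OF X]) (use that in auto)
  \<comment> \<open>For \<open>t \<ge> t0\<close> the curve \<open>C / cosh t\<close> lies below \<open>pi / 2\<close> and falls faster than any solution that
    meets it.\<close>
  define C where "C = 2 * (K + lam K) + 1"
  have C: "0 < C" using K lam_pos[of K] by (simp add: C_def)
  define t0 where "t0 = 2 * C + 3"
  have t0: "0 \<le> t0" using C by (simp add: t0_def)
  have late: "C / cosh t \<le> pi / 2" "1 / 2 \<le> tanh t" if "t0 \<le> t" for t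
  proof -
    have c: "C \<le> cosh t" "2 \<le> cosh t"
      using cosh_ge_half[of t] that C by (auto simp: t0_def)
    have "C / cosh t \<le> 1" using c by simp
    thus "C / cosh t \<le> pi / 2" using pi_gt3 by linarith
    have "1 / cosh t \<le> 1 / 2" using c by (intro frac_le) auto
    hence "(1 / cosh t)\<^sup>2 \<le> (1 / 2)\<^sup>2" by (intro power_mono) auto
    moreover have "(1 / 2 :: real)\<^sup>2 = 1 / 4" by (simp add: power2_eq_square)
    ultimately have "(1 / 2)\<^sup>2 \<le> (tanh t)\<^sup>2" unfolding tanh_square_real by linarith
    moreover have "0 \<le> tanh t" using that t0 by simp
    ultimately show "1 / 2 \<le> tanh t" by (rule power2_le_imp_le)
  qed
  \<comment> \<open>The exponents for which the solution leaves the region through the lower and through the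
    upper barrier.\<close>
  define low where "low = {k. \<exists>t\<ge>0. X t k < 0}"
  define up where "up = {k. \<exists>t\<ge>t0. C / cosh t < X t k}"
  have "low = (\<Union>t\<in>{0..}. {k. X t k < 0})" by (auto simp: low_def)
  hence "open low" using Xc by (auto intro!: open_Collect_less)
  have "up = (\<Union>t\<in>{t0..}. {k. C / cosh t < X t k})" by (auto simp: up_def)
  hence "open up" using Xc by (auto intro!: open_Collect_less)
  have low_stays: "X b k < 0" if "X a k < 0" "0 \<le> a" "a \<le> b" "1 \<le> k" "k \<le> K" for a b k
  proof (rule stays_negative[where h = "\<lambda>t. X t k" and a = a and h' = "\<lambda>t. H k t (X t k)"])
    fix t assume "X t k = 0"
    thus "H k t (X t k) < 0"
      using lam_pos[OF \<open>1 \<le> k\<close>] by (simp add: H_def A_def B_def D_def)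
  qed (use that X' in auto)
  have up_stays: "C / cosh b < X b k"
    if "C / cosh a < X a k" "t0 \<le> a" "a \<le> b" "1 \<le> k" "k \<le> K" for a b k
  proof -
    have "C / cosh b - X b k < 0"
    proof (rule stays_negative[where h = "\<lambda>t. C / cosh t - X t k" and a = a
            and h' = "\<lambda>t. C * (- tanh t / cosh t) - H k t (X t k)"])
      fix t assume t: "t \<in> {a..b}"
      have "((\<lambda>t. C * (1 / cosh t) - X t k) has_real_derivative
          C * (- tanh t / cosh t) - H k t (X t k)) (at t within {a..b})"
        using t that t0 by (intro DERIV_diff DERIV_cmult sech_deriv X') auto
      thus "((\<lambda>t. C / cosh t - X t k) has_real_derivative
          C * (- tanh t / cosh t) - H k t (X t k)) (at t within {a..b})" by simp
      assume "C / cosh t - X t k = 0"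
      hence e: "X t k = C / cosh t" by simp
      have tt: "t0 \<le> t" using t that by simp
      have x: "0 \<le> X t k" "X t k \<le> pi / 2" unfolding e using late[OF tt] C by auto
      have "0 \<le> A (X t k)"
        using x D_bounds(2)[of "X t k"] unfolding A_def
        by (intro divide_nonneg_pos mult_nonneg_nonneg sin_ge_zero cos_ge_zero) auto
      hence "0 \<le> (N - 2) * tanh t * A (X t k)"
        using N late(2)[OF tt] by (intro mult_nonneg_nonneg; linarith)
      moreover have "(k + (lam k - k) * B (X t k)) / cosh t \<le> (K + lam K) / cosh t"
        using flux_bounds(1)[OF \<open>1 \<le> k\<close>, of "X t k"] lam_mono[OF \<open>k \<le> K\<close>] \<open>k \<le> K\<close>
        by (intro divide_right_mono) auto
      ultimately have "- H k t (X t k) \<le> (K + lam K) / cosh t" by (simp add: H_def)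
      moreover have "(K + lam K) / cosh t < C * tanh t / cosh t"
      proof (rule divide_strict_right_mono)
        have "K + lam K < C * (1 / 2)" by (simp add: C_def)
        also have "\<dots> \<le> C * tanh t" using late(2)[OF tt] C by (intro mult_left_mono) auto
        finally show "K + lam K < C * tanh t" .
      qed auto
      ultimately show "C * (- tanh t / cosh t) - H k t (X t k) < 0" by simp
    qed (use that in auto)
    thus ?thesis by simp
  qed
  have disj: "low \<inter> up \<inter> {1..K} = {}"
  proof (rule ccontr)
    assume "low \<inter> up \<inter> {1..K} \<noteq> {}"
    then obtain k a b where k: "1 \<le> k" "k \<le> K" and a: "0 \<le> a" "X a k < 0"
      and b: "t0 \<le> b" "C / cosh b < X b k" by (auto simp: low_def up_def)
    have "X (max a b) k < 0" by (rule low_stays[OF a(2,1)]) (use k in auto)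
    moreover have "C / cosh (max a b) < X (max a b) k" by (rule up_stays[OF b(2,1)]) (use k in auto)
    moreover have "0 < C / cosh (max a b)" using C by simp
    ultimately show False by linarith
  qed
  \<comment> \<open>For \<open>k = 1\<close> the angle lies above the one of the linear solution and stays away from 0.\<close>
  have "1 \<in> up"
  proof (rule ccontr)
    assume "1 \<notin> up"
    hence le: "X t 1 \<le> C / cosh t" if "t0 \<le> t" for t
      using that by (auto simp: up_def not_less)
    define \<Theta> where "\<Theta> = (\<lambda>t :: real. arccos (tanh t))"
    have \<Theta>: "0 \<le> \<Theta> t" for t
      using tanh_real_lt_1[of t] tanh_real_gt_neg1[of t] by (auto simp: \<Theta>_def intro!: arccos_lbound)
    define d where "d = (\<lambda>t. X t 1 - \<Theta> t)"
    define d' where "d' = (\<lambda>t. (N - 2) * cos (X t 1) * sin (d t) / D (X t 1))"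
    have d: "(d has_real_derivative d' t) (at t within {a..b})" if "t \<in> {a..b}" "0 \<le> a" for a b t
    proof -
      have "(d has_real_derivative H 1 t (X t 1) - (- 1 / cosh t)) (at t within {a..b})"
        unfolding d_def \<Theta>_def by (intro DERIV_diff X' arccos_tanh_deriv) (use that K in auto)
      thus ?thesis by (simp add: H_one d'_def d_def \<Theta>_def)
    qed
    define c where "c = (N - 2) / min 1 (p - 1)"
    have c: "0 \<le> c" using p N by (simp add: c_def)
    have d'b: "\<bar>d' t\<bar> \<le> c * \<bar>d t\<bar>" for t
    proof -
      have "\<bar>d' t\<bar> = (N - 2) * (\<bar>cos (X t 1)\<bar> * \<bar>sin (d t)\<bar>) / D (X t 1)"
        using N D_bounds(2)[of "X t 1"] by (simp add: d'_def abs_mult)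
      also have "\<dots> \<le> (N - 2) * (1 * \<bar>d t\<bar>) / min 1 (p - 1)"
        using N p D_bounds[of "X t 1"] abs_sin_x_le_abs_x[of "d t"]
        by (intro frac_le mult_left_mono mult_mono) auto
      finally show ?thesis by (simp add: c_def)
    qed
    \<comment> \<open>By \<open>d'b\<close>, \<open>d\<close> cannot fall below \<open>exp (- (c + 1) * t)\<close>.\<close>
    have dpos: "0 < d t" if "0 \<le> t" for t
    proof -
      have "exp (- (c + 1) * t) - d t < 0"
      proof (rule stays_negative[where h = "\<lambda>t. exp (- (c + 1) * t) - d t" and a = 0
            and h' = "\<lambda>t. - (c + 1) * exp (- (c + 1) * t) - d' t"])
        show "exp (- (c + 1) * 0) - d 0 < 0" using pi_gt3 by (simp add: d_def \<Theta>_def X0)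
        fix s assume s: "s \<in> {0..t}"
        show "((\<lambda>t. exp (- (c + 1) * t) - d t) has_real_derivative
            - (c + 1) * exp (- (c + 1) * s) - d' s) (at s within {0..t})"
          by (rule derivative_eq_intros d refl | use s in simp)+
        assume "exp (- (c + 1) * s) - d s = 0"
        hence e: "d s = exp (- (c + 1) * s)" by simp
        hence "0 < d s" by simp
        moreover from this have "- d' s \<le> c * d s" using d'b[of s] by simp
        ultimately show "- (c + 1) * exp (- (c + 1) * s) - d' s < 0"
          unfolding e[symmetric] by (simp add: algebra_simps)
      qed (use that in auto)
      thus ?thesis using exp_gt_zero[of "- (c + 1) * t"] by linarith
    qed
    have mono: "d t0 \<le> d t" if "t0 \<le> t" for t
    proof (rule DERIV_nonneg_imp_increasing_open[OF that])
      fix s assume s: "t0 < s" "s < t"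
      have "at s within {t0..t} = at s" using s by (intro at_within_interior) auto
      hence "(d has_real_derivative d' s) (at s)" using d[of s t0 t] s t0 by simp
      moreover have "0 \<le> d' s"
      proof -
        have "0 < d s" using dpos s t0 by simp
        moreover have "X s 1 \<le> pi / 2" using le[of s] late(1)[of s] s by linarith
        moreover have "d s \<le> X s 1" using \<Theta> by (simp add: d_def)
        ultimately show ?thesis
          unfolding d'_def using N D_bounds(2)[of "X s 1"]
          by (intro divide_nonneg_pos mult_nonneg_nonneg cos_ge_zero sin_ge_zero) auto
      qed
      ultimately show "\<exists>y. (d has_real_derivative y) (at s) \<and> 0 \<le> y" by blast
    next
      show "continuous_on {t0..t} d"
        by (rule DERIV_continuous_on[OF d]) (use t0 in auto)
    qed
    have d0: "0 < d t0" using dpos t0 by simp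
    define a where "a = C / d t0"
    define t where "t = max t0 (2 * a)"
    have "2 * a \<le> t" by (simp add: t_def)
    hence "a < (1 + t) / 2" by simp
    also have "\<dots> \<le> cosh t" by (rule cosh_ge_half)
    finally have "C / cosh t < d t0" using d0 by (simp add: a_def field_simps)
    also have "\<dots> \<le> d t" by (rule mono) (simp add: t_def)
    also have "\<dots> \<le> X t 1" using \<Theta> by (simp add: d_def)
    finally show False using le[of t] by (simp add: t_def)
  qed
  moreover have "K \<in> low"
  proof -
    have "X 1 K + 4 * 1 \<le> X 0 K + 4 * 0"
    proof (rule DERIV_nonpos_imp_decreasing_open[of 0 1 "\<lambda>t. X t K + 4 * t"])
      fix t :: real assume t: "0 < t" "t < 1"
      have "at t within {0..1} = at t" using t by (intro at_within_interior) auto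
      hence "((\<lambda>t. X t K + 4 * t) has_real_derivative H K t (X t K) + 4 * 1) (at t)"
        using X'[of t 0 1 K] t K by (auto intro!: derivative_eq_intros)
      moreover have "H K t (X t K) \<le> - 4"
      proof -
        let ?x = "X t K"
        have "cosh t \<le> cosh 1" using t by (simp add: cosh_real_nonneg_le_iff)
        also have "cosh 1 \<le> (2 :: real)"
          using exp_le by (simp add: cosh_def exp_minus)
            (smt (verit) exp_ge_add_one_self inverse_le_1_iff)
        finally have h: "1 / 2 \<le> 1 / cosh t" by (simp add: field_simps)
        have "tanh t * (sin ?x * cos ?x) \<le> \<bar>tanh t\<bar> * (\<bar>sin ?x\<bar> * \<bar>cos ?x\<bar>)"
          unfolding abs_mult[symmetric] by simp
        also have "\<dots> \<le> 1"
          using tanh_real_lt_1[of t] tanh_real_gt_neg1[of t] by (intro mult_le_one) auto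
        finally have "(N - 2) * (tanh t * (sin ?x * cos ?x)) \<le> (N - 2) * 1"
          using N by (intro mult_left_mono) auto
        hence "(N - 2) * (tanh t * (sin ?x * cos ?x)) / D ?x \<le> (N - 2) / D ?x"
          using D_bounds(2)[of ?x] by (intro divide_right_mono) auto
        hence 1: "(N - 2) * tanh t * A ?x \<le> (N - 2) / D ?x" by (simp add: A_def mult.assoc)
        have 2: "(K - 1) * (p - 1) / D ?x * (1 / 2) \<le> (K + (lam K - K) * B ?x) * (1 / cosh t)"
        proof (rule mult_mono[OF _ h])
          show "(K - 1) * (p - 1) / D ?x \<le> K + (lam K - K) * B ?x"
            using flux_bounds(2) K by simp
          thus "0 \<le> K + (lam K - K) * B ?x"
            using K p D_bounds(2)[of ?x] by (smt (verit) divide_nonneg_pos mult_nonneg_nonneg)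
        qed simp
        have 3: "(K - 1) * (p - 1) / D ?x * (1 / 2) = (N - 2 + 4 * p) / D ?x"
          unfolding Kp by (simp add: field_simps)
        have "H K t ?x \<le> (N - 2) / D ?x - (N - 2 + 4 * p) / D ?x"
          unfolding H_def using 1 2 3 by (simp only: times_divide_eq_right mult_1_right)
        also have "\<dots> = - (4 * (p / D ?x))" by (simp add: diff_divide_distrib add_divide_distrib)
        also have "\<dots> \<le> - 4"
        proof -
          have "1 \<le> p / D ?x" using D_bounds[of ?x] by (simp add: le_divide_eq)
          thus ?thesis by linarith
        qed
        finally show ?thesis .
      qed
      ultimately show "\<exists>y. ((\<lambda>t. X t K + 4 * t) has_real_derivative y) (at t) \<and> y \<le> 0"
        by (intro exI[of _ "H K t (X t K) + 4 * 1"]) auto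
    next
      show "continuous_on {0..1} (\<lambda>t. X t K + 4 * t)"
        using K by (intro continuous_intros DERIV_continuous_on[OF X']) auto
    qed simp
    hence "X 1 K < 0" using pi_less_4 by (simp add: X0)
    thus ?thesis by (auto simp: low_def intro!: exI[of _ 1])
  qed
  moreover have "1 \<in> {1..K}" "K \<in> {1..K}" using K by auto
  ultimately have "\<not> {1..K} \<subseteq> low \<union> up"
    using connectedD[OF connected_Icc \<open>open low\<close> \<open>open up\<close> disj] by blast
  then obtain k where "k \<in> {1..K}" "k \<notin> low \<union> up" by blast
  hence k: "1 \<le> k" "k \<le> K" "k \<notin> low" "k \<notin> up" by auto
  have "1 < k" using k \<open>1 \<in> up\<close> by (cases "k = 1") auto
  moreover have "\<forall>t\<ge>0. 0 \<le> X t k" "\<forall>t\<ge>t0. X t k \<le> C / cosh t"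
    using k by (auto simp: low_def up_def not_less)
  moreover have "\<forall>t\<ge>0. ((\<lambda>t. X t k) has_real_derivative H k t (X t k)) (at t within {0..})"
    using X k by blast
  ultimately show ?thesis using X0[of k]
    by (intro exI[of _ k] exI[of _ "\<lambda>t. X t k"] exI[of _ t0] exI[of _ C]) auto
qed

end

section \<open>Behaviour of the angle at the poles\<close>

text \<open>A bounded solution of \<open>w' = a w + o(1)\<close> with \<open>a > 0\<close> tends to 0: otherwise it would grow
  without bound.\<close>

lemma bounded_unstable_le:
  fixes w e :: "real \<Rightarrow> real"
  assumes "0 < a"
    and der: "\<And>t. t0 \<le> t \<Longrightarrow> (w has_real_derivative a * w t + e t) (at t)"
    and e: "(e \<longlongrightarrow> 0) at_top"
    and bdd: "\<And>t. t0 \<le> t \<Longrightarrow> w t \<le> M"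
    and "0 < \<epsilon>"
  shows "\<forall>\<^sub>F t in at_top. w t \<le> \<epsilon>"
proof -
  define \<eta> where "\<eta> = a * \<epsilon> / 2"
  have \<eta>: "0 < \<eta>" using \<open>0 < a\<close> \<open>0 < \<epsilon>\<close> by (simp add: \<eta>_def)
  obtain T where T: "\<And>t. T \<le> t \<Longrightarrow> \<bar>e t\<bar> < \<eta>"
    using tendstoD[OF e \<eta>] by (auto simp: eventually_at_top_linorder)
  have "w s \<le> \<epsilon>" if s: "T \<le> s" "t0 \<le> s" for s
  proof (rule ccontr)
    assume "\<not> w s \<le> \<epsilon>"
    have up: "\<epsilon> < w t" if "s \<le> t" for t
    proof -
      have "\<epsilon> - w t < 0"
      proof (rule stays_negative[where h = "\<lambda>t. \<epsilon> - w t" and a = s and h' = "\<lambda>t. - (a * w t + e t)"])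
        fix u assume u: "u \<in> {s..t}"
        show "((\<lambda>t. \<epsilon> - w t) has_real_derivative - (a * w u + e u)) (at u within {s..t})"
          using DERIV_diff[OF DERIV_const DERIV_subset[OF der[of u] subset_UNIV]] u s by simp
        assume "\<epsilon> - w u = 0"
        hence "a * w u = 2 * \<eta>" by (simp add: \<eta>_def)
        moreover have "\<bar>e u\<bar> < \<eta>" by (rule T) (use u s in simp)
        ultimately show "- (a * w u + e u) < 0" using \<eta> by linarith
      qed (use that \<open>\<not> w s \<le> \<epsilon>\<close> in auto)
      thus ?thesis by simp
    qed
    define t where "t = s + max 0 (M / \<eta>)"
    have "s \<le> t" by (simp add: t_def)
    have "w s - \<eta> * s \<le> w t - \<eta> * t"
    proof (rule DERIV_nonneg_imp_nondecreasing[OF \<open>s \<le> t\<close>])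
      fix u assume u: "s \<le> u" "u \<le> t"
      have "a * \<epsilon> \<le> a * w u" using up[OF u(1)] \<open>0 < a\<close> by (intro mult_left_mono) auto
      hence "2 * \<eta> \<le> a * w u" by (simp add: \<eta>_def)
      moreover have "\<bar>e u\<bar> < \<eta>" by (rule T) (use u s in simp)
      ultimately have "0 \<le> a * w u + e u - \<eta>" by linarith
      thus "\<exists>y. ((\<lambda>t. w t - \<eta> * t) has_real_derivative y) (at u) \<and> 0 \<le> y"
        using DERIV_diff[OF der DERIV_cmult_Id, of u \<eta>] u s by (intro exI conjI) auto
    qed
    moreover have "M \<le> \<eta> * (t - s)"
      using \<eta> mult_left_mono[of "M / \<eta>" "t - s" \<eta>] by (simp add: t_def)
    ultimately have "M < w t" using \<open>\<not> w s \<le> \<epsilon>\<close> \<open>0 < \<epsilon>\<close> by (simp add: algebra_simps)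
    thus False using bdd[of t] \<open>s \<le> t\<close> s by simp
  qed
  thus ?thesis unfolding eventually_at_top_linorder by (intro exI[of _ "max T t0"]) simp
qed

lemma bounded_unstable_tendsto_0:
  fixes w e :: "real \<Rightarrow> real"
  assumes "0 < a"
    and der: "\<And>t. t0 \<le> t \<Longrightarrow> (w has_real_derivative a * w t + e t) (at t)"
    and e: "(e \<longlongrightarrow> 0) at_top"
    and bdd: "\<And>t. t0 \<le> t \<Longrightarrow> \<bar>w t\<bar> \<le> M"
  shows "(w \<longlongrightarrow> 0) at_top"
proof (rule tendstoI)
  fix \<epsilon> :: real assume "0 < \<epsilon>"
  hence \<epsilon>: "0 < \<epsilon> / 2" by simp
  have "\<forall>\<^sub>F t in at_top. w t \<le> \<epsilon> / 2"
    by (rule bounded_unstable_le[OF assms(1) der e _ \<epsilon>, of t0 M]) (use bdd in \<open>force+\<close>)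
  moreover have "\<forall>\<^sub>F t in at_top. - w t \<le> \<epsilon> / 2"
  proof (rule bounded_unstable_le[OF assms(1) _ _ _ \<epsilon>, of t0 _ "\<lambda>t. - e t" M])
    show "((\<lambda>t. - w t) has_real_derivative a * - w t + - e t) (at t)" if "t0 \<le> t" for t
      using der[OF that] by (auto intro!: derivative_eq_intros)
    show "((\<lambda>t. - e t) \<longlongrightarrow> 0) at_top" using tendsto_minus[OF e] by simp
    show "- w t \<le> M" if "t0 \<le> t" for t using bdd[OF that] by simp
  qed
  ultimately show "\<forall>\<^sub>F t in at_top. dist (w t) 0 < \<epsilon>"
    by eventually_elim (use \<open>0 < \<epsilon>\<close> in auto)
qed

lemma deriv_extends_to_endpoints:
  fixes f f' :: "real \<Rightarrow> real"
  assumes f: "continuous_on {a..b} f" and f': "continuous_on {a..b} f'"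
    and der: "\<And>x. x \<in> {a<..<b} \<Longrightarrow> (f has_real_derivative f' x) (at x)"
    and x: "x \<in> {a..b}"
  shows "(f has_real_derivative f' x) (at x within {a..b})"
proof -
  have eq: "f y = f a + integral {a..y} f'" if "y \<in> {a..b}" for y
  proof -
    have "(f' has_integral (f y - f a)) {a..y}"
    proof (rule fundamental_theorem_of_calculus_interior)
      show "continuous_on {a..y} f" by (rule continuous_on_subset[OF f]) (use that in auto)
      show "(f has_vector_derivative f' x) (at x)" if "x \<in> {a<..<y}" for x
        using der[of x] that \<open>y \<in> {a..b}\<close>
        by (simp add: has_real_derivative_iff_has_vector_derivative[symmetric])
    qed (use that in auto)
    thus ?thesis by (simp add: integral_unique)
  qed
  have "((\<lambda>y. f a + integral {a..y} f') has_real_derivative f' x) (at x within {a..b})"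
    using DERIV_add[OF DERIV_const integral_has_real_derivative[OF f' x]] by simp
  from this[unfolded has_field_derivative_def] show ?thesis
    unfolding has_field_derivative_def
    by (rule has_derivative_transform[OF x, rotated]) (rule eq)
qed

lemma tanh_artanh_real: "\<bar>c\<bar> < 1 \<Longrightarrow> tanh (artanh c) = c" for c :: real
proof -
  assume c: "\<bar>c\<bar> < 1"
  have "exp (- 2 * artanh c) = (1 - c) / (1 + c)"
    using c by (simp add: artanh_def exp_minus)
  thus ?thesis using c by (simp only: tanh_real_altdef) (simp add: field_simps)
qed

lemma cosh_artanh_square: "\<bar>c\<bar> < 1 \<Longrightarrow> (1 - c\<^sup>2) * (cosh (artanh c))\<^sup>2 = 1" for c :: real
  using tanh_square_real[of "artanh c"] by (simp add: tanh_artanh_real field_simps power_divide)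

context profile_ode
begin

lemma A_reflect: "A (2 * pi - x) = - A x" and B_reflect: "B (2 * pi - x) = B x"
  by (simp_all add: A_def B_def D_def sin_diff cos_diff)

lemma H_reflect: "H k (- t) (2 * pi - x) = H k t x"
  by (simp add: H_def A_reflect B_reflect)

text \<open>The angle is continued to negative times by \<open>\<phi> (- t) = 2 * pi - \<phi> t\<close>, which corresponds
  to the reflection in the hyperplane orthogonal to the axis.  The last limit is that of
  \<open>g' / \<rho>\<close> at the pole.\<close>

lemma symmetric_angle:
  obtains k \<phi> where "1 < k" "\<And>t. \<phi> (- t) = 2 * pi - \<phi> t"
    "\<And>t. (\<phi> has_real_derivative H k t (\<phi> t)) (at t)"
    "((\<lambda>t. cos (\<phi> t)) \<longlongrightarrow> 1) at_top"
    "((\<lambda>t. sin (\<phi> t) * cosh t) \<longlongrightarrow> lam k / (N - 1)) at_top"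
proof -
  obtain k \<phi> t0 C where k: "1 < k" and \<phi>0: "\<phi> 0 = pi"
    and \<phi>_all: "\<forall>t\<ge>0. (\<phi> has_real_derivative H k t (\<phi> t)) (at t within {0..})"
    and pos_all: "\<forall>t\<ge>0. 0 \<le> \<phi> t" and le_all: "\<forall>t\<ge>t0. \<phi> t \<le> C / cosh t"
    using shooting by blast
  have \<phi>: "(\<phi> has_real_derivative H k t (\<phi> t)) (at t within {0..})" "0 \<le> \<phi> t" if "0 \<le> t" for t
    using \<phi>_all pos_all that by auto
  note pos = \<phi>(2)
  have le: "\<phi> t \<le> C / cosh t" if "t0 \<le> t" for t using le_all that by auto
  define \<psi> where "\<psi> = (\<lambda>t. if 0 \<le> t then \<phi> t else 2 * pi - \<phi> (- t))"
  have odd: "\<psi> (- t) = 2 * pi - \<psi> t" for t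
    using \<phi>0 by (cases "t = 0") (auto simp: \<psi>_def)
  have right: "(\<psi> has_real_derivative H k t (\<psi> t)) (at t within {0..})" if "0 \<le> t" for t
    using \<phi>(1)[OF that] that unfolding has_field_derivative_def
    by (auto simp: \<psi>_def elim!: has_derivative_transform[rotated 2])
  have left: "(\<psi> has_real_derivative H k t (\<psi> t)) (at t within {..0})" if "t \<le> 0" for t
  proof -
    have "(\<psi> has_real_derivative H k (- t) (\<psi> (- t))) (at (- t) within uminus ` {..0})"
      by (rule DERIV_subset[OF right]) (use that in auto)
    hence "(\<psi> \<circ> uminus has_real_derivative H k (- t) (\<psi> (- t)) * - 1) (at t within {..0})"
      by (rule DERIV_image_chain) (auto intro!: derivative_eq_intros)
    hence "((\<lambda>t. 2 * pi - (\<psi> \<circ> uminus) t) has_real_derivative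
        0 - H k (- t) (\<psi> (- t)) * - 1) (at t within {..0})"
      by (intro DERIV_diff DERIV_const)
    moreover have "(\<lambda>t. 2 * pi - (\<psi> \<circ> uminus) t) = \<psi>" by (auto simp: odd)
    ultimately show ?thesis by (simp add: odd H_reflect)
  qed
  have der: "(\<psi> has_real_derivative H k t (\<psi> t)) (at t)" for t
  proof (cases t "0 :: real" rule: linorder_cases)
    case less
    hence "at t within {..0} = at t" by (intro at_within_interior) auto
    thus ?thesis using left[of t] less by simp
  next
    case greater
    hence "at t within {0..} = at t" by (intro at_within_interior) auto
    thus ?thesis using right[of t] greater by simp
  next
    case equal
    have "(\<psi> has_real_derivative H k 0 (\<psi> 0)) (at_left 0)"
      by (rule DERIV_subset[OF left]) auto
    moreover have "(\<psi> has_real_derivative H k 0 (\<psi> 0)) (at_right 0)"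
      by (rule DERIV_subset[OF right]) auto
    ultimately show ?thesis
      unfolding has_field_derivative_iff equal by (rule filterlim_split_at)
  qed
  have \<psi>_lim: "(\<psi> \<longlongrightarrow> 0) at_top"
  proof (rule tendsto_sandwich)
    show "\<forall>\<^sub>F t in at_top. 0 \<le> \<psi> t"
      using eventually_ge_at_top[of 0] by eventually_elim (use pos in \<open>auto simp: \<psi>_def\<close>)
    show "\<forall>\<^sub>F t in at_top. \<psi> t \<le> C / cosh t"
      using eventually_ge_at_top[of "max 0 t0"] by eventually_elim (use le in \<open>auto simp: \<psi>_def\<close>)
    show "((\<lambda>t. C / cosh t) \<longlongrightarrow> 0) at_top"
      by (intro real_tendsto_divide_at_top[OF tendsto_const]
          filterlim_at_top_imp_at_infinity cosh_real_at_top)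
  qed auto
  have cos_lim: "((\<lambda>t. cos (\<psi> t)) \<longlongrightarrow> 1) at_top"
    using tendsto_cos[OF \<psi>_lim] by simp
  have sin_lim: "((\<lambda>t. sin (\<psi> t)) \<longlongrightarrow> 0) at_top"
    using tendsto_sin[OF \<psi>_lim] by simp
  have D_lim: "((\<lambda>t. D (\<psi> t)) \<longlongrightarrow> 1) at_top"
    unfolding D_def by (rule cos_lim sin_lim tendsto_eq_intros refl | simp)+
  have B_lim: "((\<lambda>t. B (\<psi> t)) \<longlongrightarrow> 1) at_top"
    unfolding B_def by (rule cos_lim D_lim tendsto_eq_intros refl | simp)+
  define z where "z = (\<lambda>t. sin (\<psi> t) * cosh t)"
  define e1 where "e1 = (\<lambda>t. (N - 2) * (tanh t * (cos (\<psi> t))\<^sup>2 / D (\<psi> t) - 1) + (tanh t - 1))"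
  define e2 where "e2 = (\<lambda>t. lam k - cos (\<psi> t) * (k + (lam k - k) * B (\<psi> t)))"
  have z_bound: "\<bar>z t\<bar> \<le> C" if "max 0 t0 \<le> t" for t
  proof -
    have "\<bar>z t\<bar> \<le> \<bar>\<psi> t\<bar> * cosh t"
      unfolding z_def abs_mult using abs_sin_x_le_abs_x[of "\<psi> t"] by (simp add: mult_right_mono)
    also have "\<bar>\<psi> t\<bar> * cosh t \<le> C / cosh t * cosh t"
      using pos[of t] le[of t] that by (intro mult_right_mono) (auto simp: \<psi>_def)
    finally show ?thesis by simp
  qed
  have z_der: "(z has_real_derivative (N - 1) * z t - lam k + (z t * e1 t + e2 t)) (at t)" for t
  proof -
    have "(z has_real_derivative cos (\<psi> t) * H k t (\<psi> t) * cosh t + sin (\<psi> t) * sinh t) (at t)"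
      unfolding z_def by (rule derivative_eq_intros der refl | simp)+
    moreover have "cos (\<psi> t) * H k t (\<psi> t) * cosh t + sin (\<psi> t) * sinh t
        = (N - 1) * z t - lam k + (z t * e1 t + e2 t)"
    proof -
      have h: "H k t (\<psi> t) * cosh t = (N - 2) * tanh t * A (\<psi> t) * cosh t - (k + (lam k - k) * B (\<psi> t))"
        by (simp add: H_def left_diff_distrib)
      have s: "sinh t = tanh t * cosh t" by (simp add: tanh_def)
      show ?thesis
        unfolding mult.assoc[of "cos (\<psi> t)"] h s z_def e1_def e2_def A_def
        by (simp add: field_simps power2_eq_square)
    qed
    ultimately show ?thesis by simp
  qed
  have e1_lim: "(e1 \<longlongrightarrow> 0) at_top"
    unfolding e1_def by (rule cos_lim D_lim tanh_real_at_top tendsto_eq_intros refl | simp)+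
  have e2_lim: "(e2 \<longlongrightarrow> 0) at_top"
    unfolding e2_def by (rule cos_lim B_lim tendsto_eq_intros refl | simp)+
  have "((\<lambda>t. z t * e1 t) \<longlongrightarrow> 0) at_top"
  proof (rule Lim_null_comparison)
    show "\<forall>\<^sub>F t in at_top. norm (z t * e1 t) \<le> C * \<bar>e1 t\<bar>"
      using eventually_ge_at_top[of "max 0 t0"]
      by eventually_elim (use z_bound in \<open>auto simp: abs_mult intro!: mult_right_mono\<close>)
    show "((\<lambda>t. C * \<bar>e1 t\<bar>) \<longlongrightarrow> 0) at_top"
      using tendsto_mult_left[OF tendsto_rabs_zero[OF e1_lim], of C] by simp
  qed
  hence e_lim: "((\<lambda>t. z t * e1 t + e2 t) \<longlongrightarrow> 0) at_top"
    using tendsto_add[OF _ e2_lim, of "\<lambda>t. z t * e1 t" 0] by simp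
  have "((\<lambda>t. z t - lam k / (N - 1)) \<longlongrightarrow> 0) at_top"
  proof (rule bounded_unstable_tendsto_0[OF _ _ e_lim])
    show "0 < N - 1" using N by simp
    show "((\<lambda>t. z t - lam k / (N - 1)) has_real_derivative
        (N - 1) * (z t - lam k / (N - 1)) + (z t * e1 t + e2 t)) (at t)" for t
    proof -
      have "(N - 1) * (lam k / (N - 1)) = lam k" using N by simp
      thus ?thesis using DERIV_diff[OF z_der DERIV_const] by (simp add: right_diff_distrib)
    qed
    show "\<bar>z t - lam k / (N - 1)\<bar> \<le> C + \<bar>lam k / (N - 1)\<bar>" if "max 0 t0 \<le> t" for t
      using z_bound[OF that] by linarith
  qed
  hence "(z \<longlongrightarrow> lam k / (N - 1)) at_top" by (rule LIM_zero_cancel)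
  from this[unfolded z_def] show ?thesis by (rule that[OF k odd der cos_lim])
qed

end

section \<open>The angular profile\<close>

text \<open>The angular profile \<open>g\<close> as a function of the cosine, with first and second derivatives \<open>g1\<close>
  and \<open>g2\<close>.  The second derivative need not extend to the poles; it is only required that
  \<open>(1 - c\<^sup>2) * g2 c\<close> tends to 0 there, which is expressed by continuity, as this product takes the
  value 0 at the poles.  The quantity in \<open>speed_pos\<close> is the squared norm of the gradient of
  \<open>|x|\<^sup>k g(c)\<close> on the unit sphere, and \<open>ode\<close> is the \<open>p\<close>-harmonic equation in
  non-divergence form.  Outside \<open>{-1..1}\<close>, \<open>g\<close> is
  restricted only by \<open>g_even\<close>.\<close>

locale profile =
  fixes p N k :: real and g g1 g2 :: "real \<Rightarrow> real"
  assumes p: "1 < p" and k: "1 < k"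
    and g_deriv: "c \<in> {-1..1} \<Longrightarrow> (g has_real_derivative g1 c) (at c within {-1..1})"
    and g1_cont: "continuous_on {-1..1} g1"
    and g1_deriv: "c \<in> {-1<..<1} \<Longrightarrow> (g1 has_real_derivative g2 c) (at c)"
    and g2_cont: "continuous_on {-1..1} (\<lambda>c. (1 - c\<^sup>2) * g2 c)"
    and speed_pos: "c \<in> {-1..1} \<Longrightarrow> 0 < k\<^sup>2 * (g c)\<^sup>2 + (1 - c\<^sup>2) * (g1 c)\<^sup>2"
    and ode: "c \<in> {-1..1} \<Longrightarrow>
      (1 - c\<^sup>2) * g2 c * (k\<^sup>2 * (g c)\<^sup>2 + (p - 1) * ((1 - c\<^sup>2) * (g1 c)\<^sup>2))
      + (p - 2) * ((1 - c\<^sup>2) * (g1 c)\<^sup>2) * (k\<^sup>2 * g c - c * g1 c)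
      + (k\<^sup>2 * (g c)\<^sup>2 + (1 - c\<^sup>2) * (g1 c)\<^sup>2)
        * (k * ((k - 1) * (p - 1) + N - 1) * g c - (N - 1) * c * g1 c) = 0"
    and g_one: "g 1 = 1" and g_even: "g (- c) = g c"

lemma continuous_on_symmetric_Icc:
  fixes f :: "real \<Rightarrow> real"
  assumes "\<And>c. c \<in> {-1<..<1} \<Longrightarrow> isCont f c" "(f \<longlongrightarrow> f 1) (at_left 1)"
    and "\<And>c. f (- c) = s * f c" "\<bar>s\<bar> = 1"
  shows "continuous_on {-1..1} f"
proof (rule continuous_on_IccI)
  have "((\<lambda>c. s * f c) \<longlongrightarrow> s * f 1) (at_left 1)"
    using assms(2) by (intro tendsto_mult_left)
  hence "((\<lambda>c. f (- c)) \<longlongrightarrow> f (- 1)) (at_left 1)" using assms(3) by simp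
  thus "(f \<longlongrightarrow> f (- 1)) (at_right (- 1))" by (simp add: filterlim_at_left_to_right)
  show "(f \<longlongrightarrow> f 1) (at_left 1)" by fact
  show "(f \<longlongrightarrow> f x) (at x)" if "- 1 < x" "x < 1" for x
    using assms(1)[of x] that by (simp add: isCont_def)
qed auto

context profile_ode
begin

lemma profile_exists: "\<exists>k g g1 g2. profile p N k g g1 g2"
proof -
  obtain k \<phi> where k: "1 < k" and mirror: "\<And>t. \<phi> (- t) = 2 * pi - \<phi> t"
    and der: "\<And>t. (\<phi> has_real_derivative H k t (\<phi> t)) (at t)"
    and cos_lim: "((\<lambda>t. cos (\<phi> t)) \<longlongrightarrow> 1) at_top"
    and sin_lim: "((\<lambda>t. sin (\<phi> t) * cosh t) \<longlongrightarrow> lam k / (N - 1)) at_top"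
    using symmetric_angle by blast
  \<comment> \<open>As functions of \<open>c\<close>: \<open>Y\<close> is \<open>cos \<phi>\<close>, \<open>Z\<close> is \<open>sin \<phi> / sqrt (1 - c\<^sup>2)\<close> with its limits at the poles,
    \<open>s\<close> is \<open>(sin \<phi>)\<^sup>2\<close>, \<open>- Z * Q\<close> and \<open>Z'\<close> are the derivatives of \<open>Y\<close> and \<open>Z\<close>, and \<open>r\<close> is the logarithmic
    derivative of \<open>\<rho>\<close>.\<close>
  define \<Lambda> where "\<Lambda> = lam k / (N - 1)"
  have \<Lambda>: "(N - 1) * \<Lambda> = lam k" using N by (simp add: \<Lambda>_def)
  define x where "x = (\<lambda>c. \<phi> (artanh c))"
  define Y where "Y = (\<lambda>c. if \<bar>c\<bar> < 1 then cos (x c) else 1)"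
  define Z where "Z = (\<lambda>c. if \<bar>c\<bar> < 1 then sin (x c) * cosh (artanh c) else \<Lambda> * sgn c)"
  define s where "s = (\<lambda>c. (1 - c\<^sup>2) * (Z c)\<^sup>2)"
  define R where "R = (\<lambda>c. (Y c)\<^sup>2 + (p - 1) * s c)"
  define Q where "Q = (\<lambda>c. ((N - 2) * c * Z c * Y c - lam k * (Y c)\<^sup>2 - k * (p - 1) * s c) / R c)"
  define r where "r = (\<lambda>c. Z c * ((N - 2) * c * Z c - (lam k - k) * Y c) / R c)"
  define Z' where "Z' = (\<lambda>c. (Y c * Q c + c * Z c) / (1 - c\<^sup>2))"
  have x_odd: "x (- c) = 2 * pi - x c" if "\<bar>c\<bar> < 1" for c
    using that mirror[of "artanh c"] by (simp add: x_def artanh_minus_real)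
  have Y_even: "Y (- c) = Y c" for c
    using x_odd[of c] by (simp add: Y_def cos_diff)
  have Z_odd: "Z (- c) = - Z c" for c
    using x_odd[of c] artanh_minus_real[of c] by (simp add: Z_def sin_diff sgn_minus)
  have s_eq: "s c = (sin (x c))\<^sup>2" if "\<bar>c\<bar> < 1" for c
  proof -
    have "s c = (sin (x c))\<^sup>2 * ((1 - c\<^sup>2) * (cosh (artanh c))\<^sup>2)"
      using that by (simp add: s_def Z_def power_mult_distrib)
    thus ?thesis by (simp only: cosh_artanh_square[OF that] mult_1_right)
  qed
  have sY: "s c + (Y c)\<^sup>2 = 1" if "c \<in> {-1..1}" for c
  proof (cases "\<bar>c\<bar> < 1")
    case True
    thus ?thesis by (simp add: s_eq) (simp add: Y_def)
  next
    case False
    hence "c = 1 \<or> c = - 1" using that by auto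
    thus ?thesis by (auto simp: s_def Y_def)
  qed
  have s_nonneg: "0 \<le> s c" if "c \<in> {-1..1}" for c
    using that by (auto simp: s_def abs_square_le_1 abs_le_iff)
  have R_pos: "0 < R c" if "c \<in> {-1..1}" for c
  proof -
    have "R c = 1 + (p - 2) * s c" using sY[OF that] by (simp add: R_def algebra_simps)
    moreover have "s c \<le> 1" using sY[OF that] by (smt (verit) zero_le_power2)
    hence "- 1 * s c \<ge> - 1 \<and> (p - 2) * s c > - 1 * s c \<or> s c = 0"
      using s_nonneg[OF that] p by (cases "s c = 0") (auto intro!: mult_strict_right_mono simp: algebra_simps)
    ultimately show ?thesis by auto
  qed
  have R_eq: "R c = D (x c)" if "\<bar>c\<bar> < 1" for c
    using that by (simp add: R_def D_def s_eq) (simp add: Y_def)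
  have H_eq': "H k (artanh c) (x c) * cosh (artanh c) = Q c" if "\<bar>c\<bar> < 1" for c
    unfolding H_eq Q_def R_eq[OF that] s_eq[OF that] using that
    by (simp add: Y_def Z_def tanh_artanh_real field_simps)
  have inv: "1 / (1 - c\<^sup>2) = (cosh (artanh c))\<^sup>2" if "\<bar>c\<bar> < 1" for c :: real
    using cosh_artanh_square[OF that] by (metis mult.commute nonzero_eq_divide_eq zero_neq_one mult_zero_right)
  have x_der: "(x has_real_derivative H k (artanh c) (x c) * (cosh (artanh c))\<^sup>2) (at c)"
    if "\<bar>c\<bar> < 1" for c
    unfolding x_def inv[OF that, symmetric]
    by (rule DERIV_chain2[OF der artanh_real_has_field_derivative[OF that]])
  have op: "open {-1<..<1 :: real}" by simp
  have Y_der: "(Y has_real_derivative - (Z c * Q c)) (at c)" if c: "c \<in> {-1<..<1}" for c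
  proof -
    have c': "\<bar>c\<bar> < 1" using c by auto
    have "((\<lambda>c. cos (x c)) has_real_derivative
        - sin (x c) * (H k (artanh c) (x c) * (cosh (artanh c))\<^sup>2)) (at c)"
      by (rule DERIV_chain2[OF DERIV_cos x_der[OF c']])
    moreover have "- sin (x c) * (H k (artanh c) (x c) * (cosh (artanh c))\<^sup>2) = - (Z c * Q c)"
      unfolding H_eq'[OF c', symmetric] using c' by (simp add: Z_def power2_eq_square)
    ultimately have *: "((\<lambda>c. cos (x c)) has_real_derivative - (Z c * Q c)) (at c)"
      by (simp only:)
    show ?thesis
      by (rule has_field_derivative_transform_within_open[OF * op c]) (auto simp: Y_def)
  qed
  have Z_der: "(Z has_real_derivative Z' c) (at c)" if c: "c \<in> {-1<..<1}" for c
  proof -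
    have c': "\<bar>c\<bar> < 1" using c by auto
    have "((\<lambda>c. sin (x c) * cosh (artanh c)) has_real_derivative
       cos (x c) * (H k (artanh c) (x c) * (cosh (artanh c))\<^sup>2) * cosh (artanh c)
       + sinh (artanh c) * (1 / (1 - c\<^sup>2)) * sin (x c)) (at c)"
      by (rule DERIV_mult DERIV_chain2[OF DERIV_sin x_der[OF c']]
            has_field_derivative_cosh[OF artanh_real_has_field_derivative[OF c']])+
    moreover have "sinh (artanh c) = c * cosh (artanh c)"
      using tanh_artanh_real[OF c'] by (simp add: tanh_def field_simps)
    hence "cos (x c) * (H k (artanh c) (x c) * (cosh (artanh c))\<^sup>2) * cosh (artanh c)
       + sinh (artanh c) * (1 / (1 - c\<^sup>2)) * sin (x c) = (Y c * Q c + c * Z c) * (1 / (1 - c\<^sup>2))"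
      unfolding H_eq'[OF c', symmetric] inv[OF c'] using c'
      by (simp add: Y_def Z_def power2_eq_square algebra_simps)
    ultimately have *: "((\<lambda>c. sin (x c) * cosh (artanh c)) has_real_derivative Z' c) (at c)"
      by (simp only: Z'_def times_divide_eq_right mult_1_right)
    show ?thesis
      by (rule has_field_derivative_transform_within_open[OF * op c]) (auto simp: Z_def)
  qed
  have ev: "\<forall>\<^sub>F c in at_left 1. \<bar>c\<bar> < (1 :: real)"
    by (rule eventually_mono[OF eventually_at_left_real[of 0 1]]) auto
  have Y_cont: "continuous_on {-1..1} Y"
  proof (rule continuous_on_symmetric_Icc[where s = 1])
    have "((\<lambda>c. cos (\<phi> (artanh c))) \<longlongrightarrow> Y 1) (at_left 1)"
      using filterlim_compose[OF cos_lim artanh_real_at_left_1] by (simp add: Y_def)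
    thus "(Y \<longlongrightarrow> Y 1) (at_left 1)"
      by (rule Lim_transform_eventually)
         (rule eventually_mono[OF ev], simp add: Y_def x_def)
  qed (use Y_even DERIV_isCont[OF Y_der] in auto)
  have Z_cont: "continuous_on {-1..1} Z"
  proof (rule continuous_on_symmetric_Icc[where s = "- 1"])
    have "((\<lambda>c. sin (\<phi> (artanh c)) * cosh (artanh c)) \<longlongrightarrow> Z 1) (at_left 1)"
      using filterlim_compose[OF sin_lim artanh_real_at_left_1] by (simp add: Z_def \<Lambda>_def)
    thus "(Z \<longlongrightarrow> Z 1) (at_left 1)"
      by (rule Lim_transform_eventually)
         (rule eventually_mono[OF ev], simp add: Z_def x_def)
  qed (use Z_odd DERIV_isCont[OF Z_der] in auto)
  have s_cont: "continuous_on {-1..1} s"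
    unfolding s_def by (intro continuous_intros Z_cont)
  have R_cont: "continuous_on {-1..1} R"
    unfolding R_def by (intro continuous_intros Y_cont s_cont)
  have R_nz: "\<forall>c\<in>{-1..1}. R c \<noteq> 0" using R_pos by force
  have Q_cont: "continuous_on {-1..1} Q"
    unfolding Q_def by (intro continuous_intros Y_cont Z_cont s_cont R_cont R_nz)
  have r_cont: "continuous_on {-1..1} r"
    unfolding r_def by (intro continuous_intros Y_cont Z_cont R_cont R_nz)
  \<comment> \<open>Thus \<open>\<rho> = k * exp I\<close>; the lower limit of integration gives \<open>g (- 1) = 1\<close>.\<close>
  define I where "I = (\<lambda>c. integral {-1..c} r)"
  have I_der: "(I has_real_derivative r c) (at c within {-1..1})" if "c \<in> {-1..1}" for c
    unfolding I_def by (rule integral_has_real_derivative[OF r_cont that])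
  have I_cont: "continuous_on {-1..1} I"
    by (rule DERIV_continuous_on[OF I_der])
  have inner: "at c within {-1..1} = at c" if "c \<in> {-1<..<1}" for c :: real
    using that by (intro at_within_interior) auto
  have I_der': "(I has_real_derivative r c) (at c)" if "c \<in> {-1<..<1}" for c
    using I_der[of c] inner[OF that] that by auto
  have I_even: "I (- c) = I c" if "c \<in> {-1..1}" for c
  proof -
    have "\<exists>a. \<forall>c\<in>{-1..1}. I c - I (- c) = a"
    proof (rule has_field_derivative_zero_constant)
      fix c :: real assume c: "c \<in> {-1..1}"
      have "(I has_real_derivative r (- c)) (at (- c) within uminus ` {-1..1})"
        using I_der[of "- c"] c by simp
      hence "(I \<circ> uminus has_real_derivative r (- c) * - 1) (at c within {-1..1})"
        by (rule DERIV_image_chain) (rule DERIV_minus[OF DERIV_ident])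
      from DERIV_diff[OF I_der[OF c] this]
      show "((\<lambda>c. I c - I (- c)) has_real_derivative 0) (at c within {-1..1})"
        by (simp add: o_def r_def R_def s_def Y_even Z_odd)
    qed auto
    then obtain a where a: "\<And>c. c \<in> {-1..1} \<Longrightarrow> I c - I (- c) = a" by blast
    from a[of 0] have "a = 0" by simp
    thus ?thesis using a[OF that] by simp
  qed
  \<comment> \<open>Outside \<open>{-1..1}\<close> the values are irrelevant; they are chosen even.\<close>
  define g where "g = (\<lambda>c. if \<bar>c\<bar> \<le> 1 then exp (I c) * Y c else 1)"
  define g1 where "g1 = (\<lambda>c. k * exp (I c) * Z c)"
  define g2 where "g2 = (\<lambda>c. k * exp (I c) * (r c * Z c + Z' c))"
  have g_eq: "g c = exp (I c) * Y c" if "c \<in> {-1..1}" for c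
    using that by (auto simp: g_def)
  have g1_cont: "continuous_on {-1..1} g1"
    unfolding g1_def by (intro continuous_intros I_cont Z_cont)
  have g_der: "(g has_real_derivative g1 c) (at c within {-1..1})" if "c \<in> {-1..1}" for c
  proof (rule deriv_extends_to_endpoints[OF _ g1_cont _ that])
    have "continuous_on {-1..1} (\<lambda>c. exp (I c) * Y c)"
      by (intro continuous_intros I_cont Y_cont)
    thus "continuous_on {-1..1} g"
      by (subst continuous_on_cong[OF refl g_eq])
    fix c :: real assume c: "c \<in> {-1<..<1}"
    hence c': "c \<in> {-1..1}" by auto
    have "((\<lambda>c. exp (I c) * Y c) has_real_derivative
        exp (I c) * r c * Y c + - (Z c * Q c) * exp (I c)) (at c)"
      by (rule DERIV_mult Y_der[OF c] DERIV_chain2[OF DERIV_exp I_der'[OF c]])+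
    moreover have "exp (I c) * r c * Y c + - (Z c * Q c) * exp (I c) = g1 c"
    proof -
      have "r c * Y c - Z c * Q c = k * Z c * (((Y c)\<^sup>2 + (p - 1) * s c) / R c)"
        unfolding r_def Q_def using R_pos[OF c'] by (simp add: field_simps power2_eq_square)
      also have "\<dots> = k * Z c" using R_pos[OF c'] by (simp add: R_def)
      finally have rY: "r c * Y c - Z c * Q c = k * Z c" .
      have "exp (I c) * r c * Y c + - (Z c * Q c) * exp (I c) = exp (I c) * (r c * Y c - Z c * Q c)"
        by (simp add: algebra_simps)
      thus ?thesis by (simp add: rY g1_def)
    qed
    ultimately have *: "((\<lambda>c. exp (I c) * Y c) has_real_derivative g1 c) (at c)"
      by (simp only:)
    show "(g has_real_derivative g1 c) (at c)"
      by (rule has_field_derivative_transform_within_open[OF * op c]) (auto simp: g_def)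
  qed
  have g1_der: "(g1 has_real_derivative g2 c) (at c)" if c: "c \<in> {-1<..<1}" for c
  proof -
    have "(g1 has_real_derivative k * (exp (I c) * r c) * Z c + Z' c * (k * exp (I c))) (at c)"
      unfolding g1_def
      by (rule DERIV_mult DERIV_cmult Z_der[OF c] DERIV_chain2[OF DERIV_exp I_der'[OF c]])+
    thus ?thesis by (simp add: g2_def algebra_simps)
  qed
  \<comment> \<open>At the poles both sides vanish: \<open>\<Lambda>\<close> is exactly the value for which the numerator of
    \<open>Z'\<close> is zero there.\<close>
  have Z'_eq: "(1 - c\<^sup>2) * Z' c = Y c * Q c + c * Z c" if "c \<in> {-1..1}" for c
  proof (cases "\<bar>c\<bar> < 1")
    case True
    hence "c\<^sup>2 < 1" by (simp add: abs_square_less_1)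
    thus ?thesis by (simp add: Z'_def)
  next
    case False
    hence "c = 1 \<or> c = - 1" using that by auto
    thus ?thesis using \<Lambda> by (auto simp: Z'_def Q_def R_def s_def Y_def Z_def algebra_simps)
  qed
  have g2_eq: "(1 - c\<^sup>2) * g2 c = k * exp (I c) * ((1 - c\<^sup>2) * r c * Z c + Y c * Q c + c * Z c)"
    if "c \<in> {-1..1}" for c
  proof -
    have "(1 - c\<^sup>2) * g2 c = k * exp (I c) * ((1 - c\<^sup>2) * r c * Z c + (1 - c\<^sup>2) * Z' c)"
      by (simp add: g2_def algebra_simps)
    thus ?thesis by (simp add: Z'_eq[OF that] add.assoc)
  qed
  have "profile p N k g g1 g2"
  proof
    show "1 < p" by (rule p)
    show "1 < k" by (rule k)
    show "continuous_on {-1..1} g1" by fact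
    show "continuous_on {-1..1} (\<lambda>c. (1 - c\<^sup>2) * g2 c)"
      by (subst continuous_on_cong[OF refl g2_eq])
         (auto intro!: continuous_intros I_cont r_cont Y_cont Z_cont Q_cont)
    show "g (- c) = g c" for c
    proof (cases "c \<in> {-1..1}")
      case True
      thus ?thesis using I_even[of c] g_eq[of c] g_eq[of "- c"] by (simp add: Y_even)
    next
      case False
      hence "\<not> \<bar>c\<bar> \<le> 1" by auto
      thus ?thesis by (simp only: g_def abs_minus_cancel if_False)
    qed
    have "I 1 = I (- 1)" using I_even[of 1] by simp
    also have "I (- 1) = 0" by (simp add: I_def)
    finally show "g 1 = 1" by (simp add: g_def Y_def)
    fix c :: real
    show "(g1 has_real_derivative g2 c) (at c)" if "c \<in> {-1<..<1}" by (rule g1_der[OF that])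
    assume c: "c \<in> {-1..1}"
    show "(g has_real_derivative g1 c) (at c within {-1..1})" by (rule g_der[OF c])
    have sp: "k\<^sup>2 * (g c)\<^sup>2 + (1 - c\<^sup>2) * (g1 c)\<^sup>2 = (k * exp (I c))\<^sup>2 * (s c + (Y c)\<^sup>2)"
      by (simp add: g_eq[OF c] g1_def s_def algebra_simps power_mult_distrib)
    show "0 < k\<^sup>2 * (g c)\<^sup>2 + (1 - c\<^sup>2) * (g1 c)\<^sup>2"
      unfolding sp sY[OF c] using k by simp
    have den: "k\<^sup>2 * (g c)\<^sup>2 + (p - 1) * ((1 - c\<^sup>2) * (g1 c)\<^sup>2) = (k * exp (I c))\<^sup>2 * R c"
      by (simp add: g_eq[OF c] g1_def s_def R_def algebra_simps power_mult_distrib)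
    have s1: "(1 - c\<^sup>2) * (g1 c)\<^sup>2 = (k * exp (I c))\<^sup>2 * s c"
      by (simp add: g1_def s_def algebra_simps power_mult_distrib)
    define E where "E = k * exp (I c)"
    have Rr: "R c * r c = Z c * ((N - 2) * c * Z c - (lam k - k) * Y c)"
      and RQ: "R c * Q c = (N - 2) * c * Z c * Y c - lam k * (Y c)\<^sup>2 - k * (p - 1) * s c"
      using R_pos[OF c] by (simp_all add: r_def Q_def)
    have "((1 - c\<^sup>2) * r c * Z c + Y c * Q c + c * Z c) * R c
        + (p - 2) * s c * (k * Y c - c * Z c) + (lam k * Y c - (N - 1) * c * Z c)
      = (1 - c\<^sup>2) * Z c * (R c * r c) + Y c * (R c * Q c) + c * Z c * R c
        + (p - 2) * s c * (k * Y c - c * Z c) + (lam k * Y c - (N - 1) * c * Z c)"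
      by (simp add: algebra_simps)
    also have "\<dots> = s c * ((N - 2) * c * Z c - (lam k - k) * Y c)
        + Y c * ((N - 2) * c * Z c * Y c - lam k * (Y c)\<^sup>2 - k * (p - 1) * s c) + c * Z c * R c
        + (p - 2) * s c * (k * Y c - c * Z c) + (lam k * Y c - (N - 1) * c * Z c)"
      unfolding Rr RQ s_def by (simp add: algebra_simps power2_eq_square)
    also have "\<dots> = 0"
    proof -
      have Y2: "(Y c)\<^sup>2 = 1 - s c" using sY[OF c] by simp
      have "Y c * ((N - 2) * c * Z c * Y c - lam k * (Y c)\<^sup>2 - k * (p - 1) * s c)
        = (N - 2) * c * Z c * (Y c)\<^sup>2 - lam k * Y c * (Y c)\<^sup>2 - k * (p - 1) * s c * Y c"
        by (simp add: algebra_simps power2_eq_square)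
      thus ?thesis unfolding R_def Y2 by (simp add: algebra_simps)
    qed
    finally have key: "((1 - c\<^sup>2) * r c * Z c + Y c * Q c + c * Z c) * R c
        + (p - 2) * s c * (k * Y c - c * Z c) + (lam k * Y c - (N - 1) * c * Z c) = 0" .
    show "(1 - c\<^sup>2) * g2 c * (k\<^sup>2 * (g c)\<^sup>2 + (p - 1) * ((1 - c\<^sup>2) * (g1 c)\<^sup>2))
      + (p - 2) * ((1 - c\<^sup>2) * (g1 c)\<^sup>2) * (k\<^sup>2 * g c - c * g1 c)
      + (k\<^sup>2 * (g c)\<^sup>2 + (1 - c\<^sup>2) * (g1 c)\<^sup>2)
        * (k * ((k - 1) * (p - 1) + N - 1) * g c - (N - 1) * c * g1 c) = 0" (is "?lhs = 0")
    proof -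
      have "?lhs = E * ((1 - c\<^sup>2) * r c * Z c + Y c * Q c + c * Z c) * (E\<^sup>2 * R c)
        + (p - 2) * (E\<^sup>2 * s c) * (k * (E * Y c) - c * (E * Z c))
        + E\<^sup>2 * (lam k * (E * Y c) - (N - 1) * c * (E * Z c))"
        unfolding g2_eq[OF c] den sp sY[OF c] unfolding s1 unfolding g_eq[OF c] g1_def lam_def[symmetric]
        by (simp add: E_def lam_def power2_eq_square algebra_simps)
      also have "\<dots> = E ^ 3 * (((1 - c\<^sup>2) * r c * Z c + Y c * Q c + c * Z c) * R c
        + (p - 2) * s c * (k * Y c - c * Z c) + (lam k * Y c - (N - 1) * c * Z c))"
        by (simp add: algebra_simps power3_eq_cube power2_eq_square)
      also have "\<dots> = 0" unfolding key by simp
      finally show ?thesis .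
    qed
  qed
  thus ?thesis by blast
qed

end

section \<open>Homogeneous axially symmetric vector fields\<close>

text \<open>At a zero of \<open>T\<close> a product \<open>s *\<^sub>R T\<close> is differentiable even if \<open>s\<close> is merely
  continuous.\<close>

lemma has_derivative_scaleR_at_zero:
  fixes T :: "'a::real_normed_vector \<Rightarrow> 'b::real_normed_vector"
  assumes T: "(T has_derivative T') (at x within S)" "T x = 0"
    and s: "continuous (at x within S) s"
  shows "((\<lambda>y. s y *\<^sub>R T y) has_derivative (\<lambda>h. s x *\<^sub>R T' h)) (at x within S)"
proof -
  obtain B where B: "\<And>h. norm (T' h) \<le> norm h * B" "0 < B"
    using bounded_linear.pos_bounded[OF has_derivative_bounded_linear[OF T(1)]] by blast
  have "((\<lambda>y. (s y - s x) *\<^sub>R T y) has_derivative (\<lambda>h. 0)) (at x within S)"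
    unfolding has_derivative_within_alt2
  proof (intro conjI allI impI bounded_linear_zero)
    fix \<epsilon> :: real assume \<epsilon>: "0 < \<epsilon>"
    have "\<forall>\<^sub>F y in at x within S. norm (T y - T x - T' (y - x)) \<le> 1 * norm (y - x)"
      using T(1) zero_less_one unfolding has_derivative_within_alt2 by blast
    moreover have "\<forall>\<^sub>F y in at x within S. dist (s y) (s x) < \<epsilon> / (1 + B)"
      using s \<epsilon> B(2) by (intro tendstoD) (auto simp: continuous_within)
    ultimately show "\<forall>\<^sub>F y in at x within S.
        norm ((s y - s x) *\<^sub>R T y - (s x - s x) *\<^sub>R T x - 0) \<le> \<epsilon> * norm (y - x)"
    proof eventually_elim
      case (elim y)
      have "norm (T y) \<le> norm (T y - T x - T' (y - x)) + norm (T' (y - x))"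
        using norm_triangle_ineq[of "T y - T x - T' (y - x)" "T' (y - x)"] T(2) by simp
      also have "\<dots> \<le> norm (y - x) * (1 + B)"
        using elim(1) B(1)[of "y - x"] by (simp add: algebra_simps)
      finally have "norm (T y) \<le> norm (y - x) * (1 + B)" .
      hence "\<bar>s y - s x\<bar> * norm (T y) \<le> \<epsilon> / (1 + B) * (norm (y - x) * (1 + B))"
        using elim(2) B(2) \<epsilon> by (intro mult_mono) (auto simp: dist_real_def)
      thus ?case using B(2) by simp
    qed
  qed
  moreover have "((\<lambda>y. s x *\<^sub>R T y) has_derivative (\<lambda>h. s x *\<^sub>R T' h)) (at x within S)"
    by (rule has_derivative_scaleR_right[OF T(1)])
  ultimately have "((\<lambda>y. (s y - s x) *\<^sub>R T y + s x *\<^sub>R T y) has_derivative (\<lambda>h. 0 + s x *\<^sub>R T' h)) (at x within S)"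
    by (rule has_derivative_add)
  thus ?thesis by (simp add: scaleR_diff_left)
qed

text \<open>The trace of a linear map, which turns a derivative into a divergence.\<close>

definition tr :: "('a::euclidean_space \<Rightarrow> 'a) \<Rightarrow> real" where
  "tr f = (\<Sum>b\<in>Basis. f b \<bullet> b)"

lemma tr_add: "tr (\<lambda>b. f b + g b) = tr f + tr g"
  and tr_diff: "tr (\<lambda>b. f b - g b) = tr f - tr g"
  and tr_scaleR: "tr (\<lambda>b. c *\<^sub>R f b) = c * tr f"
  and tr_rank1: "tr (\<lambda>b. (v \<bullet> b) *\<^sub>R w) = v \<bullet> w"
  and tr_id: "tr (\<lambda>b :: 'a. b) = real DIM('a::euclidean_space)"
  by (simp_all add: tr_def inner_add_left inner_diff_left sum.distrib sum_subtractf sum_distrib_left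
      euclidean_inner[of v w] inner_same_Basis)

text \<open>Relative to a unit vector \<open>e\<close>, \<open>cs x\<close> is the cosine of the polar angle of \<open>x\<close> (0 at the origin).
  For \<open>x \<noteq> 0\<close>, \<open>\<tau> x\<close> is the gradient of \<open>cs\<close> times \<open>|x|\<close>, which is the component of \<open>e\<close> orthogonal to
  \<open>x\<close>, and \<open>\<tau>' x\<close> is the derivative of \<open>\<tau>\<close> at \<open>x\<close>.\<close>

locale axis_direction =
  fixes e :: "'a::euclidean_space"
  assumes norm_e: "norm e = 1"
begin

definition cs :: "'a \<Rightarrow> real" where "cs x = (x \<bullet> e) / norm x"
definition \<tau> :: "'a \<Rightarrow> 'a" where "\<tau> x = e - (cs x / norm x) *\<^sub>R x"
definition \<tau>' :: "'a \<Rightarrow> 'a \<Rightarrow> 'a" where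
  "\<tau>' x h = - ((\<tau> x \<bullet> h / norm x / norm x) *\<^sub>R x)
     - (cs x / norm x) *\<^sub>R (h - (x \<bullet> h / norm x / norm x) *\<^sub>R x)"

lemma cs_bounds: "cs x \<in> {-1..1}"
proof -
  have "\<bar>x \<bullet> e\<bar> \<le> norm x" using Cauchy_Schwarz_ineq2[of x e] norm_e by simp
  hence "\<bar>cs x\<bar> \<le> 1" by (cases "x = 0") (auto simp: cs_def divide_le_eq)
  thus ?thesis by auto
qed

lemma cs_mult_norm: "cs x * norm x = x \<bullet> e"
  by (simp add: cs_def)

lemma inner_\<tau>: "x \<noteq> 0 \<Longrightarrow> x \<bullet> \<tau> x = 0" "x \<noteq> 0 \<Longrightarrow> \<tau> x \<bullet> \<tau> x = 1 - (cs x)\<^sup>2"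
proof -
  assume x: "x \<noteq> 0"
  have xx: "x \<bullet> x = norm x * norm x" by (simp add: dot_square_norm power2_eq_square)
  show *: "x \<bullet> \<tau> x = 0"
    using x by (simp add: \<tau>_def inner_diff_right xx cs_mult_norm)
  have "\<tau> x \<bullet> \<tau> x = e \<bullet> \<tau> x - cs x / norm x * (x \<bullet> \<tau> x)"
    by (simp add: \<tau>_def[of x] inner_diff_left)
  also have "\<dots> = e \<bullet> e - cs x / norm x * (x \<bullet> e)"
    unfolding * by (simp add: \<tau>_def inner_diff_right inner_commute)
  also have "\<dots> = 1 - (cs x)\<^sup>2"
    using x norm_e by (simp add: dot_square_norm cs_mult_norm[symmetric] power2_eq_square)
  finally show "\<tau> x \<bullet> \<tau> x = 1 - (cs x)\<^sup>2" .
qed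

lemma norm_deriv: "x \<noteq> 0 \<Longrightarrow> (norm has_derivative (\<lambda>h. x \<bullet> h / norm x)) (at (x :: 'a))"
  by (rule has_derivative_eq_rhs[OF has_derivative_norm])
     (auto simp: sgn_div_norm inner_commute divide_inverse)

lemma powr_norm_deriv:
  assumes "x \<noteq> 0"
  shows "((\<lambda>x :: 'a. norm x powr \<beta>) has_derivative (\<lambda>h. \<beta> * norm x powr (\<beta> - 1) * (x \<bullet> h / norm x))) (at x)"
proof -
  have "((\<lambda>z. z powr \<beta>) has_derivative (\<lambda>h. \<beta> * norm x powr (\<beta> - 1) * h)) (at (norm x))"
    using has_real_derivative_powr[of "norm x" \<beta>] assms by (simp add: has_field_derivative_def)
  from has_derivative_compose[OF norm_deriv[OF assms] this] show ?thesis by simp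
qed

lemma cs_deriv:
  assumes "x \<noteq> 0"
  shows "(cs has_derivative (\<lambda>h. \<tau> x \<bullet> h / norm x)) (at x)"
proof -
  have "((\<lambda>x. x \<bullet> e) has_derivative (\<lambda>h. h \<bullet> e)) (at x)"
    by (rule bounded_linear.has_derivative[OF bounded_linear_inner_left has_derivative_ident])
  from has_derivative_divide'[OF this norm_deriv[OF assms]] assms
  have "(cs has_derivative (\<lambda>h. ((h \<bullet> e) * norm x - (x \<bullet> e) * (x \<bullet> h / norm x)) / (norm x * norm x))) (at x)"
    by (simp add: cs_def[abs_def])
  thus ?thesis
    by (rule has_derivative_eq_rhs)
       (use assms in \<open>auto simp: \<tau>_def inner_diff_left inner_diff_right cs_def field_simps inner_commute\<close>)
qed

lemma \<tau>_deriv: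
  assumes "x \<noteq> 0"
  shows "(\<tau> has_derivative \<tau>' x) (at x)"
proof -
  have "((\<lambda>x. cs x / norm x) has_derivative
      (\<lambda>h. ((\<tau> x \<bullet> h / norm x) * norm x - cs x * (x \<bullet> h / norm x)) / (norm x * norm x))) (at x)"
    using assms by (intro has_derivative_divide' cs_deriv norm_deriv) auto
  from has_derivative_diff[OF has_derivative_const[of e] has_derivative_scaleR[OF this has_derivative_ident]]
  have "(\<tau> has_derivative (\<lambda>h. 0 - ((cs x / norm x) *\<^sub>R h
      + (((\<tau> x \<bullet> h / norm x) * norm x - cs x * (x \<bullet> h / norm x)) / (norm x * norm x)) *\<^sub>R x))) (at x)"
    by (simp add: \<tau>_def[abs_def])
  thus ?thesis
  proof (rule has_derivative_eq_rhs)
    have "((\<tau> x \<bullet> h / norm x) * norm x - cs x * (x \<bullet> h / norm x)) / (norm x * norm x)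
        = \<tau> x \<bullet> h / norm x / norm x - cs x / norm x * (x \<bullet> h / norm x / norm x)" for h
      using assms by (simp add: field_simps)
    thus "(\<lambda>h. 0 - ((cs x / norm x) *\<^sub>R h
      + (((\<tau> x \<bullet> h / norm x) * norm x - cs x * (x \<bullet> h / norm x)) / (norm x * norm x)) *\<^sub>R x)) = \<tau>' x"
      by (auto simp: \<tau>'_def scaleR_diff_left scaleR_diff_right)
  qed
qed

lemma tr_\<tau>':
  assumes "x \<noteq> 0"
  shows "tr (\<tau>' x) = - ((real DIM('a) - 1) * cs x / norm x)"
proof -
  have "\<tau>' x = (\<lambda>h. (- 1 / norm x / norm x) *\<^sub>R ((\<tau> x \<bullet> h) *\<^sub>R x)
      - (cs x / norm x) *\<^sub>R (h - (1 / norm x / norm x) *\<^sub>R ((x \<bullet> h) *\<^sub>R x)))"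
    by (auto simp: \<tau>'_def)
  hence "tr (\<tau>' x) = - 1 / norm x / norm x * (\<tau> x \<bullet> x)
      - cs x / norm x * (real DIM('a) - 1 / norm x / norm x * (x \<bullet> x))"
    by (simp only: tr_diff tr_scaleR tr_rank1 tr_id)
  also have "\<dots> = - cs x / norm x * (real DIM('a) - 1)"
    using assms inner_\<tau>(1)[OF assms] by (simp add: inner_commute dot_square_norm power2_eq_square)
  finally show ?thesis by simp
qed

lemma continuous_cs [continuous_intros]: "continuous_on (- {0}) cs"
  unfolding cs_def[abs_def] by (intro continuous_intros) auto

lemma continuous_\<tau> [continuous_intros]: "continuous_on (- {0}) \<tau>"
  unfolding \<tau>_def[abs_def] by (intro continuous_intros) auto

lemma continuous_\<tau>' [continuous_intros]: "continuous_on (- {0}) (\<lambda>x. \<tau>' x h)"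
  unfolding \<tau>'_def by (intro continuous_intros) auto

lemma continuous_on_cs:
  assumes "continuous_on {-1..1} f"
  shows "continuous_on (- {0}) (\<lambda>x. f (cs x))"
  by (rule continuous_on_compose2[OF assms continuous_cs]) (use cs_bounds in auto)

lemma deriv_comp_cs:
  fixes f :: "real \<Rightarrow> real"
  assumes x: "x \<noteq> 0" and f: "\<And>c. c \<in> {-1..1} \<Longrightarrow> (f has_real_derivative f1 c) (at c within {-1..1})"
  shows "((\<lambda>x. f (cs x)) has_derivative (\<lambda>h. f1 (cs x) * (\<tau> x \<bullet> h / norm x))) (at x)"
proof (rule has_derivative_in_compose[OF cs_deriv[OF x]])
  have "(f has_real_derivative f1 (cs x)) (at (cs x) within range cs)"
    by (rule DERIV_subset[OF f]) (use cs_bounds in auto)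
  thus "(f has_derivative (*) (f1 (cs x))) (at (cs x) within range cs)"
    by (simp add: has_field_derivative_def)
qed

end

text \<open>A vector field that is homogeneous of degree \<open>\<beta>\<close>, with a radial part given by \<open>a\<close> and a
  part along the meridians given by \<open>b\<close>.  The second coefficient need not be differentiable at
  the poles, because \<open>\<tau>\<close> vanishes on the axis.  The derivative of the field is \<open>fld'\<close>.\<close>

locale axial_field = axis_direction e for e :: "'a::euclidean_space" +
  fixes \<beta> :: real and a a1 b b2 :: "real \<Rightarrow> real"
  assumes a: "c \<in> {-1..1} \<Longrightarrow> (a has_real_derivative a1 c) (at c within {-1..1})"
    and a1: "continuous_on {-1..1} a1"
    and b_cont: "continuous_on {-1..1} b"
    and b: "c \<in> {-1<..<1} \<Longrightarrow> (b has_real_derivative b2 c) (at c)"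
    and b2: "continuous_on {-1..1} (\<lambda>c. (1 - c\<^sup>2) * b2 c)"
begin

definition fld :: "'a \<Rightarrow> 'a" where
  "fld x = (norm x powr (\<beta> - 1) * a (cs x)) *\<^sub>R x + norm x powr \<beta> *\<^sub>R (b (cs x) *\<^sub>R \<tau> x)"

definition fld' :: "'a \<Rightarrow> 'a \<Rightarrow> 'a" where
  "fld' x h =
     (norm x powr (\<beta> - 1) * a (cs x)) *\<^sub>R h
     + (((\<beta> - 1) * norm x powr (\<beta> - 2) * (x \<bullet> h / norm x)) * a (cs x)
        + norm x powr (\<beta> - 1) * (a1 (cs x) * (\<tau> x \<bullet> h / norm x))) *\<^sub>R x
     + (norm x powr \<beta> *\<^sub>R ((b2 (cs x) * (\<tau> x \<bullet> h) / norm x) *\<^sub>R \<tau> x + b (cs x) *\<^sub>R \<tau>' x h)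
        + (\<beta> * norm x powr (\<beta> - 1) * (x \<bullet> h / norm x)) *\<^sub>R (b (cs x) *\<^sub>R \<tau> x))"

text \<open>On the axis \<open>b2 (cs x)\<close> is meaningless, but its factor \<open>\<tau> x\<close> is 0 there.\<close>

lemma b_\<tau>_deriv:
  assumes x: "x \<noteq> 0"
  shows "((\<lambda>x. b (cs x) *\<^sub>R \<tau> x) has_derivative
    (\<lambda>h. (b2 (cs x) * (\<tau> x \<bullet> h) / norm x) *\<^sub>R \<tau> x + b (cs x) *\<^sub>R \<tau>' x h)) (at x)"
proof (cases "cs x \<in> {-1<..<1}")
  case True
  have "((\<lambda>x. b (cs x)) has_derivative (\<lambda>h. b2 (cs x) * (\<tau> x \<bullet> h / norm x))) (at x)"
    using has_derivative_compose[OF cs_deriv[OF x] b[OF True, unfolded has_field_derivative_def]] .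
  from has_derivative_scaleR[OF this \<tau>_deriv[OF x]] show ?thesis
    by (rule has_derivative_eq_rhs) auto
next
  case False
  hence "(cs x)\<^sup>2 = 1" using cs_bounds[of x] by (auto simp: power2_eq_1_iff)
  hence z: "\<tau> x = 0" using inner_\<tau>(2)[OF x] by simp
  have "continuous (at x) (\<lambda>x. b (cs x))"
    using continuous_on_cs[OF b_cont] x by (simp add: continuous_on_eq_continuous_at open_Compl)
  from has_derivative_scaleR_at_zero[OF \<tau>_deriv[OF x] z this] show ?thesis by (simp add: z)
qed

lemma fld_deriv:
  assumes x: "x \<noteq> 0"
  shows "(fld has_derivative fld' x) (at x)"
proof -
  have "((\<lambda>x. (norm x powr (\<beta> - 1) * a (cs x)) *\<^sub>R x + norm x powr \<beta> *\<^sub>R (b (cs x) *\<^sub>R \<tau> x)) has_derivative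
     (\<lambda>h. ((norm x powr (\<beta> - 1) * a (cs x)) *\<^sub>R h
     + (norm x powr (\<beta> - 1) * (a1 (cs x) * (\<tau> x \<bullet> h / norm x))
        + ((\<beta> - 1) * norm x powr (\<beta> - 1 - 1) * (x \<bullet> h / norm x)) * a (cs x)) *\<^sub>R x)
     + (norm x powr \<beta> *\<^sub>R ((b2 (cs x) * (\<tau> x \<bullet> h) / norm x) *\<^sub>R \<tau> x + b (cs x) *\<^sub>R \<tau>' x h)
        + (\<beta> * norm x powr (\<beta> - 1) * (x \<bullet> h / norm x)) *\<^sub>R (b (cs x) *\<^sub>R \<tau> x)))) (at x)"
    by (intro has_derivative_add has_derivative_scaleR has_derivative_mult has_derivative_ident
        powr_norm_deriv deriv_comp_cs[OF x a] b_\<tau>_deriv x)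
  thus ?thesis unfolding fld_def[abs_def] fld'_def[abs_def] by (simp add: add.commute)
qed

text \<open>Near the axis this term is controlled by \<open>(1 - c\<^sup>2) * b2 c\<close>, since \<open>|\<tau> x|\<^sup>2 = 1 - (cs x)\<^sup>2\<close>.\<close>

lemma continuous_b2_term:
  "continuous_on (- {0}) (\<lambda>x. (b2 (cs x) * (\<tau> x \<bullet> h)) *\<^sub>R \<tau> x)"
  unfolding continuous_on_eq_continuous_at[OF open_Compl[OF closed_singleton]]
proof
  fix x :: 'a assume "x \<in> - {0}"
  hence x: "x \<noteq> 0" by simp
  have cs: "isCont cs x" and t: "isCont \<tau> x"
    using continuous_cs continuous_\<tau> x by (auto simp: continuous_on_eq_continuous_at open_Compl)
  have E: "isCont (\<lambda>x. (1 - (cs x)\<^sup>2) * b2 (cs x)) x"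
    using continuous_on_cs[OF b2] x by (simp add: continuous_on_eq_continuous_at open_Compl)
  show "isCont (\<lambda>x. (b2 (cs x) * (\<tau> x \<bullet> h)) *\<^sub>R \<tau> x) x"
  proof (cases "cs x \<in> {-1<..<1}")
    case True
    hence nz: "1 - (cs x)\<^sup>2 \<noteq> 0" by (auto simp: power2_eq_1_iff)
    have "isCont (\<lambda>x. ((1 - (cs x)\<^sup>2) * b2 (cs x) / (1 - (cs x)\<^sup>2) * (\<tau> x \<bullet> h)) *\<^sub>R \<tau> x) x"
      by (intro continuous_intros cs t E nz)
    moreover have "\<forall>\<^sub>F y in nhds x. 1 - (cs y)\<^sup>2 \<noteq> 0"
    proof -
      have "isCont (\<lambda>y. 1 - (cs y)\<^sup>2) x" by (intro continuous_intros cs)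
      hence "((\<lambda>y. 1 - (cs y)\<^sup>2) \<longlongrightarrow> 1 - (cs x)\<^sup>2) (nhds x)" by (simp add: tendsto_nhds_iff isCont_def)
      thus ?thesis using nz by (rule tendsto_imp_eventually_ne)
    qed
    hence "\<forall>\<^sub>F y in nhds x. ((1 - (cs y)\<^sup>2) * b2 (cs y) / (1 - (cs y)\<^sup>2) * (\<tau> y \<bullet> h)) *\<^sub>R \<tau> y
        = (b2 (cs y) * (\<tau> y \<bullet> h)) *\<^sub>R \<tau> y"
      by eventually_elim simp
    from isCont_cong[OF this] calculation show ?thesis by blast
  next
    case False
    hence one: "(cs x)\<^sup>2 = 1" using cs_bounds[of x] by (auto simp: power2_eq_1_iff)
    hence z: "\<tau> x = 0" using inner_\<tau>(2)[OF x] by simp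
    have "((\<lambda>y. (b2 (cs y) * (\<tau> y \<bullet> h)) *\<^sub>R \<tau> y) \<longlongrightarrow> 0) (at x)"
    proof (rule Lim_null_comparison)
      have "\<forall>\<^sub>F y in at x. y \<noteq> 0"
        using eventually_at_in_open'[of "- {0}" x] x by (simp add: open_Compl)
      thus "\<forall>\<^sub>F y in at x. norm ((b2 (cs y) * (\<tau> y \<bullet> h)) *\<^sub>R \<tau> y)
          \<le> \<bar>(1 - (cs y)\<^sup>2) * b2 (cs y)\<bar> * norm h"
      proof eventually_elim
        case (elim y)
        have "norm ((b2 (cs y) * (\<tau> y \<bullet> h)) *\<^sub>R \<tau> y) \<le> \<bar>b2 (cs y)\<bar> * (norm (\<tau> y) * norm h) * norm (\<tau> y)"
          using Cauchy_Schwarz_ineq2[of "\<tau> y" h] by (auto simp: abs_mult intro!: mult_right_mono mult_left_mono)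
        also have "\<dots> = \<bar>b2 (cs y)\<bar> * (\<tau> y \<bullet> \<tau> y) * norm h"
          by (simp add: dot_square_norm power2_eq_square)
        also have "\<dots> = \<bar>(1 - (cs y)\<^sup>2) * b2 (cs y)\<bar> * norm h"
          using cs_bounds[of y] by (simp add: inner_\<tau>(2)[OF elim] abs_mult abs_square_le_1 abs_le_iff)
        finally show ?case .
      qed
      have "((\<lambda>y. (1 - (cs y)\<^sup>2) * b2 (cs y)) \<longlongrightarrow> 0) (at x)"
        using E one by (simp add: isCont_def)
      thus "((\<lambda>y. \<bar>(1 - (cs y)\<^sup>2) * b2 (cs y)\<bar> * norm h) \<longlongrightarrow> 0) (at x)"
        by (intro tendsto_mult_left_zero tendsto_rabs_zero)
    qed
    thus ?thesis by (simp add: isCont_def z)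
  qed
qed

lemma continuous_fld': "continuous_on (- {0}) (\<lambda>x. fld' x h)"
proof -
  have a_cont: "continuous_on {-1..1} a" by (rule DERIV_continuous_on[OF a])
  have eq: "(b2 (cs x) * (\<tau> x \<bullet> h) / norm x) *\<^sub>R \<tau> x = (1 / norm x) *\<^sub>R ((b2 (cs x) * (\<tau> x \<bullet> h)) *\<^sub>R \<tau> x)"
    for x :: 'a by simp
  have pw: "continuous_on (- {0}) (\<lambda>x :: 'a. norm x powr \<gamma>)" for \<gamma>
    by (intro continuous_on_powr continuous_on_norm continuous_on_id continuous_on_const) auto
  have dir: "continuous_on (- {0}) (\<lambda>x. x \<bullet> h / norm x)"
    by (intro continuous_intros) auto
  have dir': "continuous_on (- {0}) (\<lambda>x. \<tau> x \<bullet> h / norm x)"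
    by (intro continuous_intros) auto
  have inv: "continuous_on (- {0}) (\<lambda>x :: 'a. 1 / norm x)"
    by (intro continuous_intros) auto
  show ?thesis
    unfolding fld'_def eq
    by (intro continuous_on_add continuous_on_scaleR continuous_on_mult continuous_on_const
        continuous_on_id pw dir dir' inv continuous_\<tau> continuous_\<tau>' continuous_b2_term
        continuous_on_cs[OF a1] continuous_on_cs[OF a_cont] continuous_on_cs[OF b_cont])
qed

text \<open>The divergence of the field.\<close>

lemma tr_fld':
  assumes x: "x \<noteq> 0"
  shows "tr (fld' x) = norm x powr (\<beta> - 1) *
    ((\<beta> + real DIM('a) - 1) * a (cs x) + (1 - (cs x)\<^sup>2) * b2 (cs x) - (real DIM('a) - 1) * cs x * b (cs x))"
proof -
  have r: "norm x > 0" using x by simp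
  have p1: "norm x powr (\<beta> - 2) * norm x = norm x powr (\<beta> - 1)"
    using r powr_add[of "norm x" "\<beta> - 2" 1] by simp
  have p2: "norm x powr \<beta> / norm x = norm x powr (\<beta> - 1)"
    using r powr_diff[of "norm x" \<beta> 1] by simp
  define A1 where "A1 = norm x powr (\<beta> - 1) * a (cs x)"
  define A2 where "A2 = (\<beta> - 1) * norm x powr (\<beta> - 2) * a (cs x) / norm x"
  define A3 where "A3 = norm x powr (\<beta> - 1) * a1 (cs x) / norm x"
  define A4 where "A4 = norm x powr \<beta> * b2 (cs x) / norm x"
  define A5 where "A5 = norm x powr \<beta> * b (cs x)"
  define A6 where "A6 = \<beta> * norm x powr (\<beta> - 1) * b (cs x) / norm x"
  have "fld' x = (\<lambda>h. A1 *\<^sub>R h + (A2 *\<^sub>R ((x \<bullet> h) *\<^sub>R x) + A3 *\<^sub>R ((\<tau> x \<bullet> h) *\<^sub>R x))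
      + ((A4 *\<^sub>R ((\<tau> x \<bullet> h) *\<^sub>R \<tau> x) + A5 *\<^sub>R \<tau>' x h) + A6 *\<^sub>R ((x \<bullet> h) *\<^sub>R \<tau> x)))"
    by (auto simp: fld'_def A1_def A2_def A3_def A4_def A5_def A6_def scaleR_add_left scaleR_add_right
        ac_simps)
  hence "tr (fld' x) = A1 * real DIM('a) + (A2 * (x \<bullet> x) + A3 * (\<tau> x \<bullet> x))
      + ((A4 * (\<tau> x \<bullet> \<tau> x) + A5 * tr (\<tau>' x)) + A6 * (x \<bullet> \<tau> x))"
    by (simp only: tr_add tr_scaleR tr_rank1 tr_id)
  also have "\<dots> = A1 * real DIM('a) + A2 * (norm x * norm x) + A4 * (1 - (cs x)\<^sup>2)
      - A5 / norm x * ((real DIM('a) - 1) * cs x)"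
    using inner_\<tau>[OF x] by (simp add: inner_commute[of "\<tau> x" x] tr_\<tau>'[OF x] dot_square_norm power2_eq_square)
  also have "A2 * (norm x * norm x) = (\<beta> - 1) * norm x powr (\<beta> - 1) * a (cs x)"
    unfolding A2_def p1[symmetric] using r by simp
  also have "A4 = norm x powr (\<beta> - 1) * b2 (cs x)"
    unfolding A4_def p2[symmetric] by simp
  also have "A5 / norm x = norm x powr (\<beta> - 1) * b (cs x)"
    unfolding A5_def p2[symmetric] by simp
  finally show ?thesis by (simp add: A1_def algebra_simps)
qed

lemma norm_fld:
  assumes x: "x \<noteq> 0"
  shows "(norm (fld x))\<^sup>2 = (norm x powr \<beta>)\<^sup>2 * ((a (cs x))\<^sup>2 + (1 - (cs x)\<^sup>2) * (b (cs x))\<^sup>2)"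
proof -
  have r: "norm x > 0" using x by simp
  have p: "norm x powr (\<beta> - 1) * norm x = norm x powr \<beta>"
    using r powr_add[of "norm x" "\<beta> - 1" 1] by simp
  define A where "A = norm x powr (\<beta> - 1) * a (cs x)"
  define B where "B = norm x powr \<beta> * b (cs x)"
  have "fld x = A *\<^sub>R x + B *\<^sub>R \<tau> x" by (simp add: fld_def A_def B_def)
  hence "(norm (fld x))\<^sup>2 = (A *\<^sub>R x + B *\<^sub>R \<tau> x) \<bullet> (A *\<^sub>R x + B *\<^sub>R \<tau> x)"
    by (simp only: power2_norm_eq_inner)
  also have "\<dots> = A\<^sup>2 * (x \<bullet> x) + B\<^sup>2 * (\<tau> x \<bullet> \<tau> x)"
    using inner_\<tau>(1)[OF x]
    by (simp add: inner_add_left inner_add_right inner_commute[of "\<tau> x" x] power2_eq_square)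
  also have "\<dots> = ((norm x powr (\<beta> - 1) * norm x) * a (cs x))\<^sup>2
      + (norm x powr \<beta> * b (cs x))\<^sup>2 * (1 - (cs x)\<^sup>2)"
    unfolding inner_\<tau>(2)[OF x] by (simp add: A_def B_def dot_square_norm power_mult_distrib)
  finally show ?thesis unfolding p by (simp add: power_mult_distrib algebra_simps)
qed

lemma continuous_fld:
  assumes "0 < \<beta>"
  shows "continuous_on UNIV fld"
proof -
  have a_cont: "continuous_on {-1..1} a" by (rule DERIV_continuous_on[OF a])
  have "continuous_on {-1..1} (\<lambda>c. (a c)\<^sup>2 + (1 - c\<^sup>2) * (b c)\<^sup>2)"
    by (intro continuous_intros a_cont b_cont)
  hence "bounded ((\<lambda>c. (a c)\<^sup>2 + (1 - c\<^sup>2) * (b c)\<^sup>2) ` {-1..1})"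
    by (intro compact_imp_bounded compact_continuous_image compact_Icc)
  then obtain M where M: "\<forall>c\<in>{-1..1}. \<bar>(a c)\<^sup>2 + (1 - c\<^sup>2) * (b c)\<^sup>2\<bar> \<le> M"
    by (auto simp: bounded_iff)
  have bound: "norm (fld x) \<le> norm x powr \<beta> * sqrt M" for x
  proof (cases "x = 0")
    case False
    have m: "(a (cs x))\<^sup>2 + (1 - (cs x)\<^sup>2) * (b (cs x))\<^sup>2 \<le> M"
      using M cs_bounds[of x] by fastforce
    have "norm (fld x) = sqrt ((norm (fld x))\<^sup>2)" by simp
    also have "\<dots> \<le> sqrt ((norm x powr \<beta>)\<^sup>2 * M)"
      unfolding norm_fld[OF False] by (intro real_sqrt_le_mono mult_left_mono m) simp
    also have "\<dots> = norm x powr \<beta> * sqrt M" by (simp add: real_sqrt_mult)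
    finally show ?thesis .
  qed (simp add: fld_def)
  have "isCont fld x" for x
  proof (cases "x = 0")
    case False
    thus ?thesis using has_derivative_continuous[OF fld_deriv] by blast
  next
    case True
    have "(fld \<longlongrightarrow> 0) (at 0)"
    proof (rule Lim_null_comparison)
      show "\<forall>\<^sub>F x in at (0 :: 'a). norm (fld x) \<le> norm x powr \<beta> * sqrt M"
        using bound by simp
      have "((\<lambda>x :: 'a. norm x powr \<beta>) \<longlongrightarrow> 0) (at 0)"
        by (rule tendsto_zero_powrI[OF _ tendsto_const _ assms]) (auto intro!: tendsto_eq_intros)
      from tendsto_mult_right[OF this, of "sqrt M"]
      show "((\<lambda>x :: 'a. norm x powr \<beta> * sqrt M) \<longlongrightarrow> 0) (at 0)" by simp
    qed
    thus ?thesis using True by (simp add: isCont_def fld_def)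
  qed
  thus ?thesis by (simp add: continuous_on_eq_continuous_at)
qed

end

section \<open>The homogeneous function and its flux\<close>

context profile
begin

lemma g_cont: "continuous_on {-1..1} g"
  by (rule DERIV_continuous_on[OF g_deriv])

text \<open>On the unit sphere, \<open>w\<close> is the squared norm of the gradient and \<open>q\<close> is its norm to the power
  \<open>p - 2\<close>; \<open>w1\<close> and \<open>q1\<close> are the derivatives.\<close>

definition w :: "real \<Rightarrow> real" where
  "w c = k\<^sup>2 * (g c)\<^sup>2 + (1 - c\<^sup>2) * (g1 c)\<^sup>2"

definition w1 :: "real \<Rightarrow> real" where
  "w1 c = 2 * k\<^sup>2 * g c * g1 c - 2 * c * (g1 c)\<^sup>2 + 2 * g1 c * ((1 - c\<^sup>2) * g2 c)"

definition q :: "real \<Rightarrow> real" where "q c = w c powr ((p - 2) / 2)"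

definition q1 :: "real \<Rightarrow> real" where "q1 c = (p - 2) / 2 * w c powr ((p - 2) / 2 - 1) * w1 c"

lemma w_pos: "c \<in> {-1..1} \<Longrightarrow> 0 < w c"
  unfolding w_def by (rule speed_pos)

lemma w_cont: "continuous_on {-1..1} w"
  unfolding w_def[abs_def] by (intro continuous_intros g_cont g1_cont)

lemma w1_cont: "continuous_on {-1..1} w1"
  unfolding w1_def[abs_def] by (intro continuous_on_add continuous_on_diff continuous_on_mult
    continuous_on_power continuous_on_const continuous_on_id g_cont g1_cont g2_cont)

text \<open>This holds at the poles too, where \<open>g1\<close> need not be differentiable.\<close>

lemma transversal_square_deriv:
  assumes c: "c \<in> {-1..1}"
  shows "((\<lambda>c. (1 - c\<^sup>2) * (g1 c)\<^sup>2) has_real_derivative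
    - 2 * c * (g1 c)\<^sup>2 + 2 * g1 c * ((1 - c\<^sup>2) * g2 c)) (at c within {-1..1})"
proof (cases "c \<in> {-1<..<1}")
  case True
  have "((\<lambda>c. (1 - c\<^sup>2) * (g1 c)\<^sup>2) has_real_derivative
    - 2 * c * (g1 c)\<^sup>2 + 2 * g1 c * ((1 - c\<^sup>2) * g2 c)) (at c)"
    by (rule derivative_eq_intros g1_deriv[OF True] refl | simp add: algebra_simps)+
  thus ?thesis by (rule has_field_derivative_at_within)
next
  case False
  hence z: "1 - c\<^sup>2 = 0" using c by (auto simp: power2_eq_1_iff)
  have T: "((\<lambda>c :: real. 1 - c\<^sup>2) has_derivative (\<lambda>h. - 2 * c * h)) (at c within {-1..1})"
    by (auto intro!: derivative_eq_intros)
  have "continuous (at c within {-1..1}) (\<lambda>c. (g1 c)\<^sup>2)"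
    using g1_cont c by (intro continuous_intros) (simp add: continuous_on_eq_continuous_within)
  from has_derivative_scaleR_at_zero[OF T z this]
  have "((\<lambda>c. (1 - c\<^sup>2) * (g1 c)\<^sup>2) has_derivative (\<lambda>h. (g1 c)\<^sup>2 * (- 2 * c * h))) (at c within {-1..1})"
    by (simp add: mult.commute)
  thus ?thesis unfolding z has_field_derivative_def
    by (rule has_derivative_eq_rhs) (auto simp: fun_eq_iff)
qed

lemma w_deriv:
  assumes c: "c \<in> {-1..1}"
  shows "(w has_real_derivative w1 c) (at c within {-1..1})"
proof -
  have "((\<lambda>c. k\<^sup>2 * (g c)\<^sup>2) has_real_derivative k\<^sup>2 * (2 * g1 c * g c)) (at c within {-1..1})"
    using DERIV_cmult[OF DERIV_power[OF g_deriv[OF c], of 2], of "k\<^sup>2"] by (simp add: mult.assoc)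
  from DERIV_add[OF this transversal_square_deriv[OF c]]
  show ?thesis unfolding w_def[abs_def] w1_def by (simp add: algebra_simps)
qed

lemma q_deriv:
  assumes c: "c \<in> {-1..1}"
  shows "(q has_real_derivative q1 c) (at c within {-1..1})"
  unfolding q_def[abs_def] q1_def
  by (rule DERIV_chain2[OF has_real_derivative_powr[OF w_pos[OF c]] w_deriv[OF c]])

lemma q_cont: "continuous_on {-1..1} q"
  by (rule DERIV_continuous_on[OF q_deriv])

lemma q1_cont: "continuous_on {-1..1} q1"
  unfolding q1_def[abs_def]
  by (intro continuous_on_mult continuous_on_powr w_cont w1_cont continuous_on_const) (use w_pos in force)

text \<open>The equation in divergence form, which is the vanishing of the divergence of \<open>V.fld\<close> below.\<close>

lemma ode_divergence_form:
  assumes c: "c \<in> {-1..1}"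
  shows "((k - 1) * (p - 1) + N - 1) * (q c * (k * g c)) + (1 - c\<^sup>2) * (q1 c * g1 c + q c * g2 c)
    - (N - 1) * c * (q c * g1 c) = 0"
proof -
  define E where "E = (1 - c\<^sup>2) * g2 c"
  define T where "T = (1 - c\<^sup>2) * (g1 c)\<^sup>2"
  define l where "l = (k - 1) * (p - 1) + N - 1"
  have wc: "0 < w c" by (rule w_pos[OF c])
  have q1: "w c * q1 c = q c * ((p - 2) / 2 * w1 c)"
    using wc powr_diff[of "w c" "(p - 2) / 2" 1] by (simp add: q1_def q_def)
  have "w c * (l * (q c * (k * g c)) + (1 - c\<^sup>2) * (q1 c * g1 c + q c * g2 c)
      - (N - 1) * c * (q c * g1 c))
    = l * w c * (q c * (k * g c)) + (1 - c\<^sup>2) * g1 c * (w c * q1 c) + q c * w c * E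
      - (N - 1) * c * w c * (q c * g1 c)"
    by (simp add: E_def algebra_simps)
  also have "\<dots> = q c * (E * (k\<^sup>2 * (g c)\<^sup>2 + (p - 1) * T) + (p - 2) * T * (k\<^sup>2 * g c - c * g1 c)
      + (k\<^sup>2 * (g c)\<^sup>2 + T) * (k * l * g c - (N - 1) * c * g1 c))"
    unfolding q1 unfolding w1_def w_def E_def[symmetric] T_def
    by (simp add: field_simps power2_eq_square)
  also have "\<dots> = 0" using ode[OF c] by (simp add: E_def T_def l_def)
  finally show ?thesis using wc by (simp add: l_def)
qed

end

text \<open>The homogeneous function \<open>u\<close> on a Euclidean space of dimension \<open>N\<close>; its gradient is \<open>G.fld\<close>, and
  the flux of its \<open>p\<close>-Laplacian is \<open>V.fld\<close>.\<close>

locale axial_solution = profile p N k g g1 g2 + axis_direction e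
  for p N k g g1 g2 and e :: "'a::euclidean_space" +
  assumes dim: "N = real DIM('a)"
begin

sublocale G: axial_field e "k - 1" "\<lambda>c. k * g c" "\<lambda>c. k * g1 c" g1 g2
proof
  show "((\<lambda>c. k * g c) has_real_derivative k * g1 c) (at c within {-1..1})" if "c \<in> {-1..1}" for c
    by (rule DERIV_cmult[OF g_deriv[OF that]])
  show "continuous_on {-1..1} (\<lambda>c. k * g1 c)" by (intro continuous_intros g1_cont)
  show "continuous_on {-1..1} g1" by (rule g1_cont)
  show "(g1 has_real_derivative g2 c) (at c)" if "c \<in> {-1<..<1}" for c by (rule g1_deriv[OF that])
  show "continuous_on {-1..1} (\<lambda>c. (1 - c\<^sup>2) * g2 c)" by (rule g2_cont)
qed

sublocale V: axial_field e "(k - 1) * (p - 1)" "\<lambda>c. q c * (k * g c)"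
  "\<lambda>c. q1 c * (k * g c) + k * g1 c * q c" "\<lambda>c. q c * g1 c" "\<lambda>c. q1 c * g1 c + q c * g2 c"
proof
  show "((\<lambda>c. q c * (k * g c)) has_real_derivative q1 c * (k * g c) + k * g1 c * q c) (at c within {-1..1})"
    if "c \<in> {-1..1}" for c
    by (rule DERIV_mult[OF q_deriv[OF that] DERIV_cmult[OF g_deriv[OF that]]])
  show "continuous_on {-1..1} (\<lambda>c. q1 c * (k * g c) + k * g1 c * q c)"
    by (intro continuous_intros q1_cont g_cont g1_cont q_cont)
  show "continuous_on {-1..1} (\<lambda>c. q c * g1 c)"
    by (intro continuous_intros g1_cont q_cont)
  show "((\<lambda>c. q c * g1 c) has_real_derivative q1 c * g1 c + q c * g2 c) (at c)" if "c \<in> {-1<..<1}" for c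
  proof -
    have "at c within {-1..1} = at c" using that by (intro at_within_interior) auto
    hence "(q has_real_derivative q1 c) (at c)" using q_deriv[of c] that by auto
    from DERIV_mult[OF this g1_deriv[OF that]] show ?thesis by (simp add: mult.commute)
  qed
  have "continuous_on {-1..1} (\<lambda>c. (1 - c\<^sup>2) * (q1 c * g1 c) + q c * ((1 - c\<^sup>2) * g2 c))"
    by (intro continuous_on_add continuous_on_mult continuous_on_diff continuous_on_const
        continuous_on_power continuous_on_id q1_cont g1_cont q_cont g2_cont)
  moreover have "(1 - c\<^sup>2) * (q1 c * g1 c) + q c * ((1 - c\<^sup>2) * g2 c)
      = (1 - c\<^sup>2) * (q1 c * g1 c + q c * g2 c)" for c
    by (simp only: distrib_left mult.left_commute)
  ultimately show "continuous_on {-1..1} (\<lambda>c. (1 - c\<^sup>2) * (q1 c * g1 c + q c * g2 c))"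
    by (simp only:)
qed

definition u :: "'a \<Rightarrow> real" where "u x = norm x powr k * g (cs x)"

lemma u_deriv: "(u has_derivative (\<lambda>h. G.fld x \<bullet> h)) (at x)"
proof (cases "x = 0")
  case False
  have r: "norm x > 0" using False by simp
  have p1: "norm x powr (k - 1) / norm x = norm x powr (k - 1 - 1)"
    using r powr_diff[of "norm x" "k - 1" 1] by simp
  have p2: "norm x powr k / norm x = norm x powr (k - 1)"
    using r powr_diff[of "norm x" k 1] by simp
  have "(u has_derivative (\<lambda>h. norm x powr k * (g1 (cs x) * (\<tau> x \<bullet> h / norm x))
      + (k * norm x powr (k - 1) * (x \<bullet> h / norm x)) * g (cs x))) (at x)"
    unfolding u_def[abs_def]
    by (rule has_derivative_mult[OF powr_norm_deriv[OF False] deriv_comp_cs[OF False g_deriv]])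
  thus ?thesis
  proof (rule has_derivative_eq_rhs)
    show "(\<lambda>h. norm x powr k * (g1 (cs x) * (\<tau> x \<bullet> h / norm x))
      + (k * norm x powr (k - 1) * (x \<bullet> h / norm x)) * g (cs x)) = (\<lambda>h. G.fld x \<bullet> h)"
      unfolding G.fld_def p1[symmetric] p2[symmetric] by (auto simp: inner_add_left algebra_simps)
  qed
next
  case True
  have "bounded (g ` {-1..1})"
    by (intro compact_imp_bounded compact_continuous_image g_cont compact_Icc)
  then obtain M where M: "\<forall>c\<in>{-1..1}. \<bar>g c\<bar> \<le> M" by (auto simp: bounded_iff)
  have lim: "((\<lambda>y :: 'a. M * norm y powr (k - 1)) \<longlongrightarrow> 0) (at 0)"
  proof -
    have "((\<lambda>x :: 'a. norm x powr (k - 1)) \<longlongrightarrow> 0) (at 0)"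
      by (rule tendsto_zero_powrI[OF _ tendsto_const]) (use k in \<open>auto intro!: tendsto_eq_intros\<close>)
    from tendsto_mult_left[OF this, of M] show ?thesis by simp
  qed
  have "(u has_derivative (\<lambda>h. 0)) (at 0)"
    unfolding has_derivative_within_alt2
  proof (intro conjI allI impI bounded_linear_zero)
    fix \<epsilon> :: real assume "0 < \<epsilon>"
    with lim have "\<forall>\<^sub>F y in at (0 :: 'a). M * norm y powr (k - 1) < \<epsilon>"
      by (rule order_tendstoD(2))
    thus "\<forall>\<^sub>F y in at 0. norm (u y - u 0 - 0) \<le> \<epsilon> * norm (y - 0)"
    proof eventually_elim
      case (elim y)
      have "norm (u y) \<le> norm y powr k * M"
      proof -
        have "\<bar>g (cs y)\<bar> \<le> M" by (rule bspec[OF M cs_bounds])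
        thus ?thesis by (simp add: u_def abs_mult mult_left_mono)
      qed
      also have "norm y powr k = norm y powr (k - 1) * norm y"
      proof (cases "y = 0")
        case False
        thus ?thesis using powr_add[of "norm y" "k - 1" 1] by simp
      qed simp
      also have "norm y powr (k - 1) * norm y * M = M * norm y powr (k - 1) * norm y" by simp
      also have "\<dots> \<le> \<epsilon> * norm y" using elim by (intro mult_right_mono) auto
      finally show ?case by (simp add: u_def)
    qed
  qed
  thus ?thesis using True by (simp add: G.fld_def)
qed

lemma norm_G: "x \<noteq> 0 \<Longrightarrow> norm (G.fld x) = norm x powr (k - 1) * sqrt (w (cs x))"
proof -
  assume x: "x \<noteq> 0"
  have "norm (G.fld x) = sqrt ((norm (G.fld x))\<^sup>2)" by simp
  thus ?thesis
    unfolding G.norm_fld[OF x] by (simp add: w_def real_sqrt_mult power_mult_distrib)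
qed

lemma G_eq_0_iff: "G.fld x = 0 \<longleftrightarrow> x = 0"
proof
  assume 0: "G.fld x = 0"
  show "x = 0"
  proof (rule ccontr)
    assume "x \<noteq> 0"
    from norm_G[OF this] 0 w_pos[OF cs_bounds, of x] \<open>x \<noteq> 0\<close> show False by simp
  qed
qed (simp add: G.fld_def)

lemma flux_eq: "norm (G.fld x) powr (p - 2) *\<^sub>R G.fld x = V.fld x"
proof (cases "x = 0")
  case True
  thus ?thesis by (simp add: G.fld_def V.fld_def)
next
  case False
  have r: "norm x > 0" using False by simp
  have wc: "0 < w (cs x)" by (rule w_pos[OF cs_bounds])
  have "norm (G.fld x) powr (p - 2) = norm x powr ((k - 1) * (p - 2)) * q (cs x)"
    using wc r by (simp add: norm_G[OF False] powr_mult powr_powr powr_half_sqrt[symmetric] q_def)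
  moreover have "norm x powr ((k - 1) * (p - 2)) * norm x powr (k - 1 - 1) = norm x powr ((k - 1) * (p - 1) - 1)"
    unfolding powr_add[symmetric] by (simp add: algebra_simps)
  moreover have "norm x powr ((k - 1) * (p - 2)) * norm x powr (k - 1) = norm x powr ((k - 1) * (p - 1))"
    unfolding powr_add[symmetric] by (simp add: algebra_simps)
  ultimately have e: "norm (G.fld x) powr (p - 2) * (norm x powr (k - 1 - 1) * (k * g (cs x)))
      = norm x powr ((k - 1) * (p - 1) - 1) * (q (cs x) * (k * g (cs x)))"
    "norm (G.fld x) powr (p - 2) * (norm x powr (k - 1) * g1 (cs x))
      = norm x powr ((k - 1) * (p - 1)) * (q (cs x) * g1 (cs x))"
    by (simp_all add: mult.assoc mult.left_commute) (simp_all add: mult.commute)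
  have "norm (G.fld x) powr (p - 2) *\<^sub>R G.fld x
      = (norm (G.fld x) powr (p - 2) * (norm x powr (k - 1 - 1) * (k * g (cs x)))) *\<^sub>R x
      + (norm (G.fld x) powr (p - 2) * (norm x powr (k - 1) * g1 (cs x))) *\<^sub>R \<tau> x"
    unfolding G.fld_def[of x] by (simp only: scaleR_add_right scaleR_scaleR mult.assoc)
  thus ?thesis unfolding e by (simp add: V.fld_def)
qed

lemma tr_V: "x \<noteq> 0 \<Longrightarrow> tr (V.fld' x) = 0"
  using ode_divergence_form[OF cs_bounds, of x] unfolding dim by (simp add: V.tr_fld')

lemma exponent_pos: "0 < (k - 1) * (p - 1)"
  using k p by simp

end

section \<open>Functions of class \<open>C\<^sup>m\<close>\<close>

lemma C_on_cong: "(\<And>x. x \<in> S \<Longrightarrow> f x = g x) \<Longrightarrow> C_on m f S \<longleftrightarrow> C_on m g S"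
proof (induction m arbitrary: f g)
  case 0
  thus ?case using continuous_on_cong[OF refl, of S f g] by simp
next
  case (Suc m)
  have eq: "(f has_derivative f') (at x within S) \<longleftrightarrow> (g has_derivative f') (at x within S)"
    if "x \<in> S" for x f'
  proof
    assume "(f has_derivative f') (at x within S)"
    thus "(g has_derivative f') (at x within S)"
      by (rule has_derivative_transform[OF that, rotated]) (rule Suc.prems[symmetric])
  next
    assume "(g has_derivative f') (at x within S)"
    thus "(f has_derivative f') (at x within S)"
      by (rule has_derivative_transform[OF that, rotated]) (rule Suc.prems)
  qed
  have "f differentiable_on S \<longleftrightarrow> g differentiable_on S"
    unfolding differentiable_on_def differentiable_def by (simp only: eq cong: ball_cong)
  moreover have "frechet_derivative f (at x within S) = frechet_derivative g (at x within S)"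
    if "x \<in> S" for x
    using eq[OF that] by (simp add: frechet_derivative_def)
  hence "C_on m (\<lambda>x. frechet_derivative f (at x within S) b) S
      \<longleftrightarrow> C_on m (\<lambda>x. frechet_derivative g (at x within S) b) S" for b
    by (intro Suc.IH) simp
  ultimately show ?case by simp
qed

text \<open>On sets where derivatives are unique, any derivative may be used to establish \<open>C_on\<close>.\<close>

lemma C_on_SucI:
  assumes der: "\<And>x. x \<in> S \<Longrightarrow> (f has_derivative f' x) (at x within S)"
    and uniq: "\<And>x D. x \<in> S \<Longrightarrow> (f has_derivative D) (at x within S) \<Longrightarrow> D = f' x"
    and comp: "\<And>b. b \<in> Basis \<Longrightarrow> C_on m (\<lambda>x. f' x b) S"
  shows "C_on (Suc m) f S"
proof -
  have "frechet_derivative f (at x within S) = f' x" if "x \<in> S" for x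
  proof (rule uniq[OF that])
    have "f differentiable (at x within S)" using der[OF that] by (rule differentiableI)
    thus "(f has_derivative frechet_derivative f (at x within S)) (at x within S)"
      by (simp only: frechet_derivative_works)
  qed
  hence "C_on m (\<lambda>x. frechet_derivative f (at x within S) b) S \<longleftrightarrow> C_on m (\<lambda>x. f' x b) S" for b
    by (intro C_on_cong) simp
  moreover have "f differentiable_on S"
    using der by (auto simp: differentiable_on_def differentiable_def)
  ultimately show ?thesis using comp by simp
qed

lemma C_on_Suc_open:
  assumes "open S" and der: "\<And>x. x \<in> S \<Longrightarrow> (f has_derivative f' x) (at x)"
    and comp: "\<And>b. b \<in> Basis \<Longrightarrow> C_on m (\<lambda>x. f' x b) S"
  shows "C_on (Suc m) f S"
proof (rule C_on_SucI[OF _ _ comp])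
  fix x assume x: "x \<in> S"
  show "(f has_derivative f' x) (at x within S)" using der[OF x] by (rule has_derivative_at_withinI)
  fix D assume "(f has_derivative D) (at x within S)"
  hence "(f has_derivative D) (at x)" by (simp only: at_within_open[OF x \<open>open S\<close>])
  thus "D = f' x" by (rule has_derivative_unique[OF _ der[OF x]])
qed

lemma C_on_Suc_Icc:
  fixes f :: "real \<Rightarrow> real"
  assumes "a < b" and der: "\<And>x. x \<in> {a..b} \<Longrightarrow> (f has_real_derivative f' x) (at x within {a..b})"
    and comp: "C_on m f' {a..b}"
  shows "C_on (Suc m) f {a..b}"
proof (rule C_on_SucI[where f' = "\<lambda>x. (*) (f' x)"])
  fix x assume x: "x \<in> {a..b}"
  show *: "(f has_derivative (*) (f' x)) (at x within {a..b})"
    using der[OF x] by (simp add: has_field_derivative_def)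
  fix D assume "(f has_derivative D) (at x within {a..b})"
  hence D: "(f has_derivative D) (at x within cbox a b)" by (simp only: cbox_interval)
  from * have E: "(f has_derivative (*) (f' x)) (at x within cbox a b)" by (simp only: cbox_interval)
  show "D = (*) (f' x)"
    by (rule frechet_derivative_unique_within_closed_interval[OF _ _ D E]) (use x \<open>a < b\<close> in auto)
next
  fix b' :: real assume "b' \<in> Basis"
  thus "C_on m (\<lambda>x. f' x * b') {a..b}" using comp by simp
qed

context profile
begin

text \<open>The first two derivatives of \<open>g (cos t)\<close>.\<close>

definition f1 :: "real \<Rightarrow> real" where "f1 t = - sin t * g1 (cos t)"

definition f2 :: "real \<Rightarrow> real" where "f2 t = (1 - (cos t)\<^sup>2) * g2 (cos t) - cos t * g1 (cos t)"

lemma cos_in: "cos t \<in> {-1..1}" for t :: real by simp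

lemma angular_deriv: "((\<lambda>t. g (cos t)) has_real_derivative f1 t) (at t within S)"
proof -
  have "(g has_real_derivative g1 (cos t)) (at (cos t) within cos ` S)"
    by (rule DERIV_subset[OF g_deriv[OF cos_in]]) auto
  from DERIV_image_chain[OF this DERIV_subset[OF DERIV_cos subset_UNIV]]
  show ?thesis by (simp add: o_def f1_def mult.commute)
qed

lemma continuous_g1_cos: "continuous_on S (\<lambda>t. g1 (cos t))"
  by (rule continuous_on_compose2[OF g1_cont]) (auto intro!: continuous_intros)

lemma angular_deriv2:
  assumes t: "t \<in> {0..pi}"
  shows "(f1 has_real_derivative f2 t) (at t within {0..pi})"
proof (cases "cos t \<in> {-1<..<1}")
  case True
  have "((\<lambda>t. g1 (cos t)) has_real_derivative g2 (cos t) * - sin t) (at t within {0..pi})"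
    by (rule DERIV_chain2[where f = g1 and g = cos, OF g1_deriv[OF True]]) (rule DERIV_subset[OF DERIV_cos subset_UNIV])
  from DERIV_mult[OF DERIV_minus[OF DERIV_subset[OF DERIV_sin subset_UNIV]] this]
  have "(f1 has_real_derivative - cos t * g1 (cos t) + g2 (cos t) * - sin t * - sin t) (at t within {0..pi})"
    unfolding f1_def[abs_def] .
  moreover have "(sin t)\<^sup>2 = 1 - (cos t)\<^sup>2" by (simp add: sin_squared_eq)
  hence "- cos t * g1 (cos t) + g2 (cos t) * - sin t * - sin t = f2 t"
    by (simp add: f2_def power2_eq_square mult.commute)
  ultimately show ?thesis by simp
next
  case False
  hence "cos t = 1 \<or> cos t = - 1"
    using cos_ge_minus_one[of t] cos_le_one[of t] by (simp only: greaterThanLessThan_iff) linarith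
  hence "(cos t)\<^sup>2 = 1" by auto
  hence one: "1 - (cos t)\<^sup>2 = 0" "- sin t = 0" by (simp_all add: cos_squared_eq)
  have T: "((\<lambda>t. - sin t) has_derivative (\<lambda>h. - cos t * h)) (at t within {0..pi})"
    using DERIV_minus[OF DERIV_subset[OF DERIV_sin subset_UNIV], of t "{0..pi}"]
    unfolding has_field_derivative_def .
  have "continuous (at t within {0..pi}) (\<lambda>t. g1 (cos t))"
    using continuous_g1_cos[of "{0..pi}"] t by (simp add: continuous_on_eq_continuous_within)
  from has_derivative_scaleR_at_zero[OF T one(2) this]
  have "(f1 has_derivative (\<lambda>h. g1 (cos t) * (- cos t * h))) (at t within {0..pi})"
    unfolding f1_def[abs_def] by (simp add: mult.commute)
  thus ?thesis unfolding has_field_derivative_def f2_def one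
    by (rule has_derivative_eq_rhs) (auto simp: fun_eq_iff)
qed

lemma angular_C2: "C_on 2 (\<lambda>t. g (cos t)) {0..pi}"
proof -
  have "continuous_on {0..pi} (\<lambda>t. (\<lambda>c. (1 - c\<^sup>2) * g2 c) (cos t))"
    by (rule continuous_on_compose2[OF g2_cont]) (auto intro!: continuous_intros)
  hence "continuous_on {0..pi} f2"
    unfolding f2_def[abs_def]
    by (rule continuous_on_diff[OF _ continuous_on_mult[OF continuous_on_cos[OF continuous_on_id] continuous_g1_cos]])
  hence "C_on (Suc (Suc 0)) (\<lambda>t. g (cos t)) {0..pi}"
    by (intro C_on_Suc_Icc[where f' = f1] C_on_Suc_Icc[where f' = f2] angular_deriv angular_deriv2) auto
  thus ?thesis by (simp only: numeral_2_eq_2)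
qed

end

section \<open>Integration by parts\<close>

lemma integrable_compact_support:
  fixes f :: "'a::euclidean_space \<Rightarrow> real"
  assumes "continuous_on UNIV f" "compact K" "\<And>x. x \<notin> K \<Longrightarrow> f x = 0"
  shows "integrable lborel f"
proof -
  have "integrable lborel (\<lambda>x. indicator K x *\<^sub>R f x)"
    by (rule borel_integrable_compact[OF assms(2) continuous_on_subset[OF assms(1)]]) simp
  moreover have "(\<lambda>x. indicator K x *\<^sub>R f x) = f"
  proof
    show "indicator K x *\<^sub>R f x = f x" for x using assms(3)[of x] by (cases "x \<in> K") auto
  qed
  ultimately show ?thesis by simp
qed

lemma has_bochner_integral_lebesgue_iff:
  fixes f :: "'a::euclidean_space \<Rightarrow> real"
  assumes "f \<in> borel_measurable borel"
  shows "has_bochner_integral lebesgue f c \<longleftrightarrow> has_bochner_integral lborel f c"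
  using assms by (simp add: has_bochner_integral_iff integrable_completion integral_completion)

lemma integral_translate_lborel:
  fixes f :: "'a::euclidean_space \<Rightarrow> real"
  assumes "f \<in> borel_measurable borel"
  shows "integral\<^sup>L lborel (\<lambda>x. f (a + x)) = integral\<^sup>L lborel f"
proof -
  have "integral\<^sup>L (distr lborel borel ((+) a)) f = integral\<^sup>L lborel (\<lambda>x. f (a + x))"
    by (rule integral_distr) (use assms in auto)
  thus ?thesis by (simp add: lborel_distr_plus)
qed

lemma integrable_translate_lborel:
  fixes f :: "'a::euclidean_space \<Rightarrow> real"
  assumes "integrable lborel f"
  shows "integrable lborel (\<lambda>x. f (a + x))"
proof -
  have "integrable (distr lborel borel ((+) a)) f" using assms by (simp add: lborel_distr_plus)
  thus ?thesis using assms by (subst (asm) integrable_distr_eq) auto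
qed

text \<open>The difference quotients have integral 0 by translation invariance, and they converge
  dominatedly.\<close>

lemma integral_derivative_compact_support:
  fixes h :: "'a::euclidean_space \<Rightarrow> real"
  assumes der: "\<And>x. (h has_derivative h' x) (at x)"
    and cont: "continuous_on UNIV (\<lambda>x. h' x v)"
    and K: "compact K" "\<And>x. x \<notin> K \<Longrightarrow> h x = 0"
  shows "has_bochner_integral lborel (\<lambda>x. h' x v) 0"
proof -
  have h_cont: "continuous_on UNIV h"
    using der by (intro has_derivative_continuous_on) auto
  have h'_zero: "h' x v = 0" if "x \<notin> K" for x
  proof -
    have "open (- K)" using K(1) by (simp add: compact_imp_closed open_Compl)
    hence "(h has_derivative (\<lambda>_. 0)) (at x)"
      by (rule has_derivative_transform_within_open[OF has_derivative_const[of 0]]) (use K(2) that in auto)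
    from has_derivative_unique[OF der this] show ?thesis by simp
  qed
  have "bounded ((\<lambda>x. h' x v) ` K)"
    by (intro compact_imp_bounded compact_continuous_image continuous_on_subset[OF cont] K) auto
  then obtain M0 where M0: "\<And>x. x \<in> K \<Longrightarrow> norm (h' x v) \<le> M0"
    by (auto simp: bounded_iff)
  define M where "M = max 0 M0"
  have M: "\<bar>h' x v\<bar> \<le> M" "0 \<le> M" for x
  proof -
    show "\<bar>h' x v\<bar> \<le> M"
      using M0[of x] h'_zero[of x] by (cases "x \<in> K") (auto simp: M_def)
  qed (simp add: M_def)
  have line: "((\<lambda>s. h (x + s *\<^sub>R v)) has_real_derivative h' (x + s *\<^sub>R v) v) (at s within S)" for x s S
  proof -
    have "((\<lambda>s. h (x + s *\<^sub>R v)) has_derivative (\<lambda>s'. h' (x + s *\<^sub>R v) (s' *\<^sub>R v))) (at s within S)"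
      by (rule has_derivative_compose[OF _ der]) (auto intro!: derivative_eq_intros)
    moreover have "h' (x + s *\<^sub>R v) (s' *\<^sub>R v) = h' (x + s *\<^sub>R v) v * s'" for s'
      using linear_cmul[OF has_derivative_linear[OF der]] by (simp add: mult.commute)
    ultimately show ?thesis by (simp add: has_field_derivative_def)
  qed
  define q where "q = (\<lambda>n x. (h ((1 / real (Suc n)) *\<^sub>R v + x) - h x) * real (Suc n))"
  define K' where "K' = (\<lambda>(x, s). x - s *\<^sub>R v) ` (K \<times> {0..1 :: real})"
  have "compact K'"
    unfolding K'_def case_prod_beta
    by (intro compact_continuous_image compact_Times K continuous_intros) auto
  have q_bound: "norm (q n x) \<le> M * indicator K' x" for n x
  proof (cases "x \<in> K'")
    case False
    have "x \<notin> K"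
    proof
      assume "x \<in> K"
      hence "(\<lambda>(x, s). x - s *\<^sub>R v) (x, 0) \<in> K'" unfolding K'_def by (intro imageI) auto
      thus False using False by simp
    qed
    moreover have "(1 / real (Suc n)) *\<^sub>R v + x \<notin> K"
    proof
      assume *: "(1 / real (Suc n)) *\<^sub>R v + x \<in> K"
      have "(\<lambda>(x, s). x - s *\<^sub>R v) ((1 / real (Suc n)) *\<^sub>R v + x, 1 / real (Suc n)) \<in> K'"
        unfolding K'_def using * by (intro imageI) auto
      thus False using False by simp
    qed
    ultimately show ?thesis using K(2) False by (simp add: q_def)
  next
    case True
    have "norm (h (x + (1 / real (Suc n)) *\<^sub>R v) - h (x + 0 *\<^sub>R v)) \<le> M * norm (1 / real (Suc n) - 0)"
      by (rule field_differentiable_bound[of UNIV "\<lambda>s. h (x + s *\<^sub>R v)" "\<lambda>s. h' (x + s *\<^sub>R v) v"])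
         (use line M in auto)
    hence "norm (h (x + (1 / real (Suc n)) *\<^sub>R v) - h x) * real (Suc n) \<le> M * (1 / real (Suc n)) * real (Suc n)"
      by (intro mult_right_mono) auto
    hence "norm (q n x) \<le> M" by (simp add: q_def abs_mult add.commute)
    thus ?thesis using True by simp
  qed
  have q_lim: "(\<lambda>n. q n x) \<longlonglongrightarrow> h' x v" for x
  proof -
    have "((\<lambda>s. (h (x + s *\<^sub>R v) - h x) / s) \<longlongrightarrow> h' x v) (at 0)"
      using line[of x 0 UNIV] by (simp add: has_field_derivative_iff)
    moreover have "filterlim (\<lambda>n. 1 / real (Suc n)) (at 0) sequentially"
      using lim_1_over_n[THEN LIMSEQ_Suc] by (auto simp: filterlim_at)
    ultimately have "(\<lambda>n. (h (x + (1 / real (Suc n)) *\<^sub>R v) - h x) / (1 / real (Suc n))) \<longlonglongrightarrow> h' x v"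
      by (rule filterlim_compose)
    thus ?thesis by (simp add: q_def add.commute)
  qed
  have h_int: "integrable lborel h" by (rule integrable_compact_support[OF h_cont K])
  have h_meas: "h \<in> borel_measurable borel" by (rule borel_measurable_continuous_onI[OF h_cont])
  have q_int: "integral\<^sup>L lborel (q n) = 0" for n
    unfolding q_def using integrable_translate_lborel[OF h_int] h_int integral_translate_lborel[OF h_meas]
    by simp
  have h'_meas: "(\<lambda>x. h' x v) \<in> borel_measurable lborel"
    using borel_measurable_continuous_onI[OF cont] by simp
  have "(\<lambda>n. integral\<^sup>L lborel (q n)) \<longlonglongrightarrow> integral\<^sup>L lborel (\<lambda>x. h' x v)"
  proof (rule integral_dominated_convergence[where w = "\<lambda>x. M * indicator K' x"])
    show "q n \<in> borel_measurable lborel" for n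
      unfolding q_def using h_meas by measurable
    show "integrable lborel (\<lambda>x. M * indicator K' x)"
      using borel_integrable_compact[OF \<open>compact K'\<close> continuous_on_const[of K' M]]
      by (simp add: mult.commute)
  qed (use q_bound q_lim h'_meas in auto)
  hence "integral\<^sup>L lborel (\<lambda>x. h' x v) = 0"
    unfolding q_int by (simp add: LIMSEQ_const_iff)
  moreover have "integrable lborel (\<lambda>x. h' x v)"
    by (rule integrable_compact_support[OF cont K(1) h'_zero])
  ultimately show ?thesis by (simp add: has_bochner_integral_iff)
qed

text \<open>A cut-off function of class \<open>C\<^sup>1\<close>: it is 0 on \<open>{..1}\<close> and 1 on \<open>{2..}\<close>.\<close>

definition cutoff :: "real \<Rightarrow> real" where
  "cutoff t = 1 - (max 0 (1 - (max 0 (t - 1))\<^sup>2))\<^sup>2"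

text \<open>The derivative of \<open>cutoff\<close>.\<close>

definition cutoff' :: "real \<Rightarrow> real" where
  "cutoff' t = 4 * max 0 (1 - (max 0 (t - 1))\<^sup>2) * max 0 (t - 1)"

lemma max_square_deriv: "((\<lambda>y. (max 0 y)\<^sup>2) has_real_derivative 2 * max 0 y) (at y)"
proof (cases y "0 :: real" rule: linorder_cases)
  case less
  have "((\<lambda>y. 0 :: real) has_real_derivative 2 * max 0 y) (at y)" using less by simp
  thus ?thesis
    by (rule has_field_derivative_transform_within_open[OF _ open_lessThan[of 0]]) (use less in auto)
next
  case equal
  have "((\<lambda>h :: real. max 0 h) \<longlongrightarrow> max 0 0) (at 0)" by (intro tendsto_intros)
  hence "((\<lambda>h :: real. max 0 h) \<longlongrightarrow> 0) (at 0)" by simp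
  moreover have "max 0 h = ((max 0 (0 + h))\<^sup>2 - (max 0 0)\<^sup>2) / h" if "h \<noteq> 0" for h :: real
    using that by (cases "0 \<le> h") (simp_all add: power2_eq_square)
  hence "\<forall>\<^sub>F h in at 0. max 0 h = ((max 0 (0 + h))\<^sup>2 - (max 0 0)\<^sup>2) / (h :: real)"
    by (simp add: eventually_at_filter)
  ultimately show ?thesis
    unfolding DERIV_def equal by (simp add: Lim_transform_eventually)
next
  case greater
  have "((\<lambda>y :: real. y\<^sup>2) has_real_derivative 2 * max 0 y) (at y)"
    using greater by (auto intro!: derivative_eq_intros)
  thus ?thesis
    by (rule has_field_derivative_transform_within_open[OF _ open_greaterThan[of 0]]) (use greater in auto)
qed

lemma cutoff_deriv: "(cutoff has_real_derivative cutoff' t) (at t)"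
proof -
  have "((\<lambda>t. (max 0 (t - 1))\<^sup>2) has_real_derivative 2 * max 0 (t - 1) * 1) (at t)"
    by (rule DERIV_chain2[OF max_square_deriv]) (auto intro!: derivative_eq_intros)
  hence "((\<lambda>t. 1 - (max 0 (t - 1))\<^sup>2) has_real_derivative 0 - 2 * max 0 (t - 1) * 1) (at t)"
    by (intro DERIV_diff DERIV_const)
  from DERIV_diff[OF DERIV_const DERIV_chain2[OF max_square_deriv this], of 1]
  show ?thesis unfolding cutoff_def[abs_def] cutoff'_def by (simp add: algebra_simps)
qed

lemma cutoff_eq_0: "t \<le> 1 \<Longrightarrow> cutoff t = 0" "t \<le> 1 \<Longrightarrow> cutoff' t = 0"
  by (simp_all add: cutoff_def cutoff'_def)

lemma cutoff_eq_1: "2 \<le> t \<Longrightarrow> cutoff t = 1" "2 \<le> t \<Longrightarrow> cutoff' t = 0"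
proof -
  assume t: "2 \<le> t"
  have "1 \<le> (t - 1)\<^sup>2" using t by (intro one_le_power) auto
  moreover have "max 0 (t - 1) = t - 1" using t by simp
  ultimately have "max 0 (1 - (max 0 (t - 1))\<^sup>2) = 0" by simp
  thus "cutoff t = 1" "cutoff' t = 0" by (simp_all add: cutoff_def cutoff'_def)
qed

lemma cutoff_bounds: "0 \<le> cutoff t" "cutoff t \<le> 1" "\<bar>cutoff' t\<bar> \<le> 4"
proof -
  have "max 0 (1 - (max 0 (t - 1))\<^sup>2) \<le> 1" by simp
  hence "(max 0 (1 - (max 0 (t - 1))\<^sup>2))\<^sup>2 \<le> 1" by (intro power_le_one) auto
  thus "0 \<le> cutoff t" "cutoff t \<le> 1" unfolding cutoff_def by simp_all
  show "\<bar>cutoff' t\<bar> \<le> 4"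
  proof (cases "t \<le> 2")
    case True
    have "max 0 (1 - (max 0 (t - 1))\<^sup>2) * max 0 (t - 1) \<le> 1 * 1"
      using True by (intro mult_mono) auto
    thus ?thesis by (simp add: cutoff'_def abs_mult)
  next
    case False
    thus ?thesis using cutoff_eq_1(2)[of t] by simp
  qed
qed

lemma continuous_cutoff [continuous_intros]:
  "continuous_on S f \<Longrightarrow> continuous_on S (\<lambda>x. cutoff (f x))"
  "continuous_on S f \<Longrightarrow> continuous_on S (\<lambda>x. cutoff' (f x))"
  unfolding cutoff_def cutoff'_def by (intro continuous_intros; assumption)+

text \<open>A continuous field which is of class \<open>C\<^sup>1\<close> with divergence 0 off the origin is weakly divergence
  free.  The test function is multiplied with \<open>\<eta> j\<close>, which vanishes near 0 and is 1 outside a ball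
  of radius \<open>2 / a j\<close>; the error term \<open>E j\<close> is of order \<open>a j\<close> on that ball and 0 elsewhere.\<close>

lemma weakly_divergence_free:
  fixes V :: "real ^ 'n \<Rightarrow> real ^ 'n" and \<phi> :: "real ^ 'n \<Rightarrow> real"
  assumes n: "2 \<le> CARD('n)"
    and V: "continuous_on UNIV V"
    and V_der: "\<And>x. x \<noteq> 0 \<Longrightarrow> (V has_derivative V' x) (at x)"
    and V'_cont: "\<And>v. continuous_on (- {0}) (\<lambda>x. V' x v)"
    and div: "\<And>x. x \<noteq> 0 \<Longrightarrow> (\<Sum>i\<in>UNIV. V' x (axis i 1) $ i) = 0"
    and \<phi>_der: "\<And>x. (\<phi> has_derivative \<phi>' x) (at x)"
    and \<phi>'_cont: "\<And>i. continuous_on UNIV (\<lambda>x. \<phi>' x (axis i 1))"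
    and K: "compact K" "\<And>x. x \<notin> K \<Longrightarrow> \<phi> x = 0"
  shows "has_bochner_integral lborel (\<lambda>x. \<Sum>i\<in>UNIV. V x $ i * \<phi>' x (axis i 1)) 0"
proof -
  have \<phi>_cont: "continuous_on UNIV \<phi>"
    using \<phi>_der by (intro has_derivative_continuous_on) auto
  have \<phi>'_zero: "\<phi>' x v = 0" if "x \<notin> K" for x v
  proof -
    have "open (- K)" using K(1) by (simp add: compact_imp_closed open_Compl)
    hence "(\<phi> has_derivative (\<lambda>_. 0)) (at x)"
      by (rule has_derivative_transform_within_open[OF has_derivative_const[of 0]]) (use K(2) that in auto)
    from has_derivative_unique[OF \<phi>_der this] show ?thesis by simp
  qed
  define F where "F = (\<lambda>x. \<Sum>i\<in>UNIV. V x $ i * \<phi>' x (axis i 1))"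
  have F_cont: "continuous_on UNIV F"
    unfolding F_def by (intro continuous_intros V \<phi>'_cont)
  have F_int: "integrable lborel F"
    by (rule integrable_compact_support[OF F_cont K(1)]) (simp add: F_def \<phi>'_zero)
  define a where "a = (\<lambda>j. real (Suc j))"
  have a: "1 \<le> a j" for j by (simp add: a_def)
  define \<eta> where "\<eta> = (\<lambda>j (x :: real ^ 'n). cutoff ((a j)\<^sup>2 * (x \<bullet> x)))"
  define \<eta>' where "\<eta>' = (\<lambda>j (x :: real ^ 'n) v. cutoff' ((a j)\<^sup>2 * (x \<bullet> x)) * ((a j)\<^sup>2 * (2 * (x \<bullet> v))))"
  have \<eta>_der: "(\<eta> j has_derivative \<eta>' j x) (at x)" for j x
  proof -
    have "((\<lambda>x :: real ^ 'n. (a j)\<^sup>2 * (x \<bullet> x)) has_derivative (\<lambda>v. (a j)\<^sup>2 * (2 * (x \<bullet> v)))) (at x)"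
      by (auto intro!: derivative_eq_intros simp: inner_commute)
    from has_derivative_compose[OF this cutoff_deriv[unfolded has_field_derivative_def]]
    show ?thesis by (simp add: \<eta>_def \<eta>'_def)
  qed
  have \<eta>_cont: "continuous_on S (\<eta> j)" "continuous_on S (\<lambda>x. \<eta>' j x v)" for S j v
    unfolding \<eta>_def \<eta>'_def by (intro continuous_intros)+
  define E where "E = (\<lambda>j x. cutoff' ((a j)\<^sup>2 * (x \<bullet> x)) * ((a j)\<^sup>2 * (2 * (x \<bullet> V x))) * \<phi> x)"
  have E_cont: "continuous_on UNIV (E j)" for j
    unfolding E_def by (intro continuous_intros V \<phi>_cont)
  have E_int: "integrable lborel (E j)" for j
    by (rule integrable_compact_support[OF E_cont K(1)]) (simp add: E_def K(2))
  have sum_0: "integral\<^sup>L lborel (\<lambda>x. E j x + \<eta> j x * F x) = 0" for j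
  proof -
    define W' where "W' = (\<lambda>i x v. (\<eta>' j x v * \<phi> x + \<eta> j x * \<phi>' x v) * V x $ i + \<eta> j x * \<phi> x * V' x v $ i)"
    define U where "U = {x :: real ^ 'n. (a j)\<^sup>2 * (x \<bullet> x) < 1}"
    have U: "open U" unfolding U_def by (intro open_Collect_less continuous_intros)
    have U0: "\<eta> j x = 0" "\<eta>' j x v = 0" if "x \<in> U" for x v
      using that by (simp_all add: U_def \<eta>_def \<eta>'_def cutoff_eq_0)
    have "0 \<in> U" by (simp add: U_def)
    have "has_bochner_integral lborel (\<lambda>x. W' i x (axis i 1)) 0" for i
    proof (rule integral_derivative_compact_support[where h = "\<lambda>x. \<eta> j x * \<phi> x * V x $ i" and K = K])
      fix x
      show "((\<lambda>x. \<eta> j x * \<phi> x * V x $ i) has_derivative W' i x) (at x)"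
      proof (cases "x = 0")
        case False
        have "((\<lambda>x. V x $ i) has_derivative (\<lambda>v. V' x v $ i)) (at x)"
          by (rule bounded_linear.has_derivative[OF bounded_linear_vec_nth V_der[OF False]])
        from has_derivative_mult[OF has_derivative_mult[OF \<eta>_der \<phi>_der] this]
        show ?thesis by (rule has_derivative_eq_rhs) (auto simp: W'_def algebra_simps)
      next
        case True
        have "((\<lambda>x. \<eta> j x * \<phi> x * V x $ i) has_derivative (\<lambda>_. 0)) (at x)"
          by (rule has_derivative_transform_within_open[OF has_derivative_const[of 0] U])
             (use True \<open>0 \<in> U\<close> U0 in auto)
        moreover have "W' i x = (\<lambda>_. 0)" using True U0[OF \<open>0 \<in> U\<close>] by (auto simp: W'_def)
        ultimately show ?thesis by simp
      qed
    next
      have "continuous_on (- {0}) (\<lambda>x. W' i x (axis i 1))"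
        unfolding W'_def
        by (intro continuous_intros \<eta>_cont V'_cont continuous_on_subset[OF V]
            continuous_on_subset[OF \<phi>_cont] continuous_on_subset[OF \<phi>'_cont]) auto
      moreover have "continuous_on U (\<lambda>x. W' i x (axis i 1))"
      proof -
        have "W' i x (axis i 1) = 0" if "x \<in> U" for x using U0[OF that] by (simp add: W'_def)
        hence "continuous_on U (\<lambda>x. W' i x (axis i 1)) = continuous_on U (\<lambda>x. 0 :: real)"
          by (intro continuous_on_cong refl)
        thus ?thesis by simp
      qed
      ultimately have "continuous_on (- {0} \<union> U) (\<lambda>x. W' i x (axis i 1))"
        using U by (intro continuous_on_open_Un) auto
      moreover have "- {0} \<union> U = UNIV" using \<open>0 \<in> U\<close> by auto
      ultimately show "continuous_on UNIV (\<lambda>x. W' i x (axis i 1))" by simp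
    qed (use K in auto)
    hence "has_bochner_integral lborel (\<lambda>x. \<Sum>i\<in>UNIV. W' i x (axis i 1)) (\<Sum>i\<in>(UNIV :: 'n set). 0)"
      by (intro has_bochner_integral_sum)
    moreover have "(\<Sum>i\<in>UNIV. W' i x (axis i 1)) = E j x + \<eta> j x * F x" for x
    proof -
      have "(\<Sum>i\<in>UNIV. \<eta>' j x (axis i 1) * V x $ i)
        = cutoff' ((a j)\<^sup>2 * (x \<bullet> x)) * ((a j)\<^sup>2 * (2 * (x \<bullet> V x)))"
      proof -
        have "x \<bullet> V x = (\<Sum>i\<in>UNIV. x $ i * V x $ i)" by (simp add: inner_vec_def)
        moreover have "\<eta>' j x (axis i 1) = cutoff' ((a j)\<^sup>2 * (x \<bullet> x)) * ((a j)\<^sup>2 * (2 * x $ i))" for i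
          by (simp add: \<eta>'_def inner_axis)
        ultimately show ?thesis by (simp only: sum_distrib_left mult.assoc)
      qed
      moreover have "\<eta> j x * \<phi> x * (\<Sum>i\<in>UNIV. V' x (axis i 1) $ i) = 0"
        using div[of x] U0(1)[OF \<open>0 \<in> U\<close>] by (cases "x = 0") auto
      moreover have "(\<Sum>i\<in>UNIV. W' i x (axis i 1)) = (\<Sum>i\<in>UNIV. \<eta>' j x (axis i 1) * V x $ i) * \<phi> x
          + \<eta> j x * F x + \<eta> j x * \<phi> x * (\<Sum>i\<in>UNIV. V' x (axis i 1) $ i)"
        by (simp add: W'_def F_def sum.distrib sum_distrib_left sum_distrib_right algebra_simps)
      ultimately show ?thesis by (simp add: E_def)
    qed
    ultimately show ?thesis by (simp add: has_bochner_integral_iff)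
  qed
  have \<eta>F_int: "integrable lborel (\<lambda>x. \<eta> j x * F x)" for j
    by (rule integrable_compact_support[OF _ K(1)])
       (auto simp: F_def \<phi>'_zero intro!: continuous_intros \<eta>_cont V \<phi>'_cont)
  have "compact (cball 0 2 :: (real ^ 'n) set)" by simp
  hence "bounded ((\<lambda>x. norm (V x) * \<bar>\<phi> x\<bar>) ` cball 0 2)"
    by (intro compact_imp_bounded compact_continuous_image continuous_intros
        continuous_on_subset[OF V] continuous_on_subset[OF \<phi>_cont]) auto
  then obtain S where S': "\<forall>x\<in>cball 0 2. norm (V x) * \<bar>\<phi> x\<bar> \<le> S"
    by (auto simp: bounded_iff)
  have S: "norm (V x) * \<bar>\<phi> x\<bar> \<le> S" if "x \<in> cball 0 2" for x using S' that by blast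
  have "0 \<le> norm (V 0) * \<bar>\<phi> 0\<bar>" by simp
  also have "\<dots> \<le> S" by (rule S) simp
  finally have S0: "0 \<le> S" .
  have E_bound: "norm (E j x) \<le> 16 * a j * S * indicator (cball 0 (2 / a j)) x" for j x
  proof (cases "x \<in> cball 0 (2 / a j)")
    case False
    hence "2 / a j \<le> norm x" by simp
    hence "2 \<le> a j * norm x" using a[of j] by (simp add: field_simps)
    hence "2\<^sup>2 \<le> (a j * norm x)\<^sup>2" by (intro power_mono) auto
    hence "2 \<le> (a j)\<^sup>2 * (x \<bullet> x)" by (simp add: power_mult_distrib power2_norm_eq_inner)
    thus ?thesis using False by (simp add: E_def cutoff_eq_1)
  next
    case True
    have nx: "a j * norm x \<le> 2" using True a[of j] by (simp add: field_simps)
    have "2 / a j \<le> 2" using a[of j] by (simp add: field_simps)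
    hence Sx: "norm (V x) * \<bar>\<phi> x\<bar> \<le> S" using True by (intro S) auto
    have "norm (E j x) = \<bar>cutoff' ((a j)\<^sup>2 * (x \<bullet> x))\<bar> * ((a j)\<^sup>2 * (2 * \<bar>x \<bullet> V x\<bar>)) * \<bar>\<phi> x\<bar>"
      by (simp add: E_def abs_mult)
    also have "\<dots> \<le> 4 * ((a j)\<^sup>2 * (2 * (norm x * norm (V x)))) * \<bar>\<phi> x\<bar>"
      using cutoff_bounds(3) Cauchy_Schwarz_ineq2[of x "V x"]
      by (intro mult_mono) auto
    also have "\<dots> = 8 * a j * (a j * norm x) * (norm (V x) * \<bar>\<phi> x\<bar>)"
      by (simp add: power2_eq_square)
    also have "\<dots> \<le> 8 * a j * 2 * S"
      using nx Sx a[of j] by (intro mult_mono) auto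
    finally show ?thesis using True by simp
  qed
  define C where "C = 16 * S * unit_ball_vol (real CARD('n)) * 2 ^ CARD('n)"
  have E_small: "\<bar>integral\<^sup>L lborel (E j)\<bar> \<le> C / a j" for j
  proof -
    have aj: "0 < a j" using a[of j] by linarith
    have ball_int: "integrable lborel (indicat_real (cball (0 :: real ^ 'n) (2 / a j)))"
      by (rule integrable_real_indicator) (simp, rule emeasure_lborel_cball_finite)
    have "norm (integral\<^sup>L lborel (E j)) \<le> integral\<^sup>L lborel (\<lambda>x. norm (E j x))"
      by (rule integral_norm_bound)
    also have "\<dots> \<le> integral\<^sup>L lborel (\<lambda>x. 16 * a j * S * indicator (cball (0 :: real ^ 'n) (2 / a j)) x)"
    proof (rule Bochner_Integration.integral_mono)
      show "integrable lborel (\<lambda>x. norm (E j x))" by (rule integrable_norm[OF E_int])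
      show "integrable lborel (\<lambda>x. 16 * a j * S * indicator (cball (0 :: real ^ 'n) (2 / a j)) x)"
        using ball_int by simp
    qed (rule E_bound)
    also have "\<dots> = 16 * a j * S * measure lborel (cball (0 :: real ^ 'n) (2 / a j))"
      by simp
    also have "measure lborel (cball (0 :: real ^ 'n) (2 / a j)) = unit_ball_vol (real CARD('n)) * (2 / a j) ^ CARD('n)"
      using aj by (subst content_cball) auto
    also have "16 * a j * S * (unit_ball_vol (real CARD('n)) * (2 / a j) ^ CARD('n)) = C * (a j / a j ^ CARD('n))"
      by (simp add: C_def power_divide)
    also have "\<dots> \<le> C * (1 / a j)"
    proof (rule mult_left_mono)
      have "(a j)\<^sup>2 \<le> a j ^ CARD('n)" by (rule power_increasing[OF n a])
      thus "a j / a j ^ CARD('n) \<le> 1 / a j"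
        using aj by (simp add: field_simps power2_eq_square)
      show "0 \<le> C" using S0 by (simp add: C_def)
    qed
    finally show ?thesis by simp
  qed
  have a_top: "filterlim a at_top sequentially"
    unfolding a_def by (rule filterlim_compose[OF filterlim_real_sequentially filterlim_Suc])
  have E_lim: "(\<lambda>j. integral\<^sup>L lborel (E j)) \<longlonglongrightarrow> 0"
  proof (rule Lim_null_comparison)
    show "\<forall>\<^sub>F j in sequentially. norm (integral\<^sup>L lborel (E j)) \<le> C / a j" using E_small by simp
    show "(\<lambda>j. C / a j) \<longlonglongrightarrow> 0"
      by (intro real_tendsto_divide_at_top[OF tendsto_const] a_top)
  qed
  have "integral\<^sup>L lborel (\<lambda>x. \<eta> j x * F x) = - integral\<^sup>L lborel (E j)" for j
    using sum_0[of j] E_int[of j] \<eta>F_int[of j] by simp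
  hence "(\<lambda>j. integral\<^sup>L lborel (\<lambda>x. \<eta> j x * F x)) \<longlonglongrightarrow> 0"
    using tendsto_minus[OF E_lim] by simp
  moreover have "(\<lambda>j. integral\<^sup>L lborel (\<lambda>x. \<eta> j x * F x)) \<longlonglongrightarrow> integral\<^sup>L lborel F"
  proof (rule integral_dominated_convergence[where w = "\<lambda>x. \<bar>F x\<bar>"])
    show "F \<in> borel_measurable lborel" "(\<lambda>x. \<eta> j x * F x) \<in> borel_measurable lborel" for j
      using F_int \<eta>F_int[of j] by auto
    show "integrable lborel (\<lambda>x. \<bar>F x\<bar>)" using F_int by simp
    show "AE x in lborel. norm (\<eta> j x * F x) \<le> \<bar>F x\<bar>" for j
      using cutoff_bounds(1,2) by (auto simp: abs_mult \<eta>_def intro!: mult_left_le_one_le)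
    have "(\<lambda>j. \<eta> j x * F x) \<longlonglongrightarrow> F x" if "x \<noteq> 0" for x
    proof -
      have "filterlim (\<lambda>j. (a j)\<^sup>2 * (x \<bullet> x)) at_top sequentially"
        using that by (intro filterlim_at_top_mult_tendsto_pos[OF tendsto_const] filterlim_pow_at_top a_top) auto
      hence "\<forall>\<^sub>F j in sequentially. 2 \<le> (a j)\<^sup>2 * (x \<bullet> x)" by (simp add: filterlim_at_top)
      hence "\<forall>\<^sub>F j in sequentially. F x = \<eta> j x * F x"
        by eventually_elim (simp add: \<eta>_def cutoff_eq_1)
      thus ?thesis by (rule Lim_transform_eventually[OF tendsto_const])
    qed
    thus "AE x in lborel. (\<lambda>j. \<eta> j x * F x) \<longlonglongrightarrow> F x"
      using AE_lborel_singleton[of 0] by (auto elim!: eventually_mono)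
  qed
  ultimately have "integral\<^sup>L lborel F = 0" by (rule LIMSEQ_unique[symmetric])
  thus ?thesis using F_int by (simp add: has_bochner_integral_iff F_def)
qed

section \<open>Weak solutions\<close>

lemma test_functionD:
  fixes \<phi> :: "real ^ 'n \<Rightarrow> real"
  assumes "test_function \<phi>"
  shows "(\<phi> has_derivative frechet_derivative \<phi> (at x)) (at x)"
    and "continuous_on UNIV (\<lambda>x. frechet_derivative \<phi> (at x) (axis i 1))"
    and "compact (closure {x. \<phi> x \<noteq> 0})"
proof -
  have C: "C_on (Suc 0) \<phi> UNIV" using assms unfolding test_function_def by blast
  thus "(\<phi> has_derivative frechet_derivative \<phi> (at x)) (at x)"
    using frechet_derivative_works by (auto simp: differentiable_on_def)
  have "axis i 1 \<in> (Basis :: (real ^ 'n) set)" by (simp add: axis_in_Basis_iff)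
  thus "continuous_on UNIV (\<lambda>x. frechet_derivative \<phi> (at x) (axis i 1))" using C by simp
  show "compact (closure {x. \<phi> x \<noteq> 0})" using assms unfolding test_function_def by blast
qed

lemma tr_axis: "tr f = (\<Sum>i\<in>UNIV. f (axis i 1) $ i)" for f :: "real ^ 'n \<Rightarrow> real ^ 'n"
proof -
  have B: "Basis = range (\<lambda>i :: 'n. axis i (1 :: real))" by (auto simp: Basis_vec_def)
  have inj: "inj (\<lambda>i :: 'n. axis i (1 :: real))" by (auto simp: inj_def axis_eq_axis)
  show ?thesis unfolding tr_def B sum.reindex[OF inj] by (simp add: inner_axis)
qed

lemma Lp_loc_continuous:
  fixes f :: "real ^ 'n \<Rightarrow> 'b::euclidean_space"
  assumes "continuous_on UNIV f" "0 < r"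
  shows "Lp_loc r f"
  unfolding Lp_loc_def
proof (intro conjI allI impI)
  have "f \<in> borel_measurable borel" by (rule borel_measurable_continuous_onI[OF assms(1)])
  thus "f \<in> borel_measurable lebesgue" by (intro measurable_completion) simp
  fix K :: "(real ^ 'n) set" assume "compact K"
  have "continuous_on UNIV (\<lambda>x. norm (f x) powr r)"
    by (rule continuous_on_powr'[OF continuous_on_norm[OF assms(1)] continuous_on_const]) (use assms(2) in auto)
  hence "continuous_on K (\<lambda>x. norm (f x) powr r)" by (rule continuous_on_subset) simp
  hence "integrable lborel (\<lambda>x. indicator K x *\<^sub>R (norm (f x) powr r))"
    by (rule borel_integrable_compact[OF \<open>compact K\<close>])
  thus "set_integrable lebesgue K (\<lambda>x. norm (f x) powr r)"
    unfolding set_integrable_def by (subst integrable_completion) auto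
qed

lemma weak_gradient_C1:
  fixes u :: "real ^ 'n \<Rightarrow> real"
  assumes der: "\<And>x. (u has_derivative (\<lambda>h. G x \<bullet> h)) (at x)" and G: "continuous_on UNIV G"
  shows "weak_gradient u G"
  unfolding weak_gradient_def
proof (intro conjI allI impI)
  have u: "continuous_on UNIV u" using der by (intro has_derivative_continuous_on) auto
  show "Lp_loc 1 u" "Lp_loc 1 G" by (rule Lp_loc_continuous[OF u] Lp_loc_continuous[OF G]; simp)+
  fix \<phi> :: "real ^ 'n \<Rightarrow> real" and i assume "test_function \<phi>"
  note \<phi> = test_functionD[OF this]
  define K where "K = closure {x. \<phi> x \<noteq> 0}"
  have K: "compact K" unfolding K_def by (rule \<phi>(3))
  have K0: "\<phi> x = 0" if "x \<notin> K" for x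
    using that closure_subset[of "{x. \<phi> x \<noteq> 0}"] by (auto simp: K_def)
  have c\<phi>: "continuous_on UNIV \<phi>" using \<phi>(1) by (intro has_derivative_continuous_on) auto
  have Gi: "continuous_on UNIV (\<lambda>x. G x $ i)" by (intro continuous_intros G)
  define d where "d = (\<lambda>x. frechet_derivative \<phi> (at x) (axis i 1))"
  have d: "continuous_on UNIV d" unfolding d_def by (rule \<phi>(2))
  have d0: "d x = 0" if "x \<notin> K" for x
  proof -
    have "open (- K)" using K by (simp add: compact_imp_closed open_Compl)
    hence "(\<phi> has_derivative (\<lambda>_. 0)) (at x)"
      by (rule has_derivative_transform_within_open[OF has_derivative_const[of 0]]) (use K0 that in auto)
    from has_derivative_unique[OF \<phi>(1) this] show ?thesis by (simp add: d_def)
  qed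
  have "has_bochner_integral lborel
      (\<lambda>x. (\<lambda>x h. u x * frechet_derivative \<phi> (at x) h + (G x \<bullet> h) * \<phi> x) x (axis i 1)) 0"
  proof (rule integral_derivative_compact_support[where h = "\<lambda>x. u x * \<phi> x" and K = K])
    show "((\<lambda>x. u x * \<phi> x) has_derivative (\<lambda>h. u x * frechet_derivative \<phi> (at x) h + (G x \<bullet> h) * \<phi> x)) (at x)" for x
      by (rule has_derivative_mult[OF der \<phi>(1)])
    show "continuous_on UNIV (\<lambda>x. u x * frechet_derivative \<phi> (at x) (axis i 1) + (G x \<bullet> axis i 1) * \<phi> x)"
      by (intro continuous_intros u c\<phi> G \<phi>(2))
  qed (use K K0 in auto)
  hence sum0: "integral\<^sup>L lborel (\<lambda>x. u x * d x + G x $ i * \<phi> x) = 0"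
    by (simp add: has_bochner_integral_iff d_def inner_axis)
  have int1: "integrable lborel (\<lambda>x. u x * d x)"
    by (rule integrable_compact_support[OF continuous_on_mult[OF u d] K]) (simp add: d0)
  have int2: "integrable lborel (\<lambda>x. G x $ i * \<phi> x)"
    by (rule integrable_compact_support[OF continuous_on_mult[OF Gi c\<phi>] K]) (simp add: K0)
  have "integral\<^sup>L lborel (\<lambda>x. u x * d x) = - integral\<^sup>L lborel (\<lambda>x. G x $ i * \<phi> x)"
    using sum0 int1 int2 by simp
  moreover have "integral\<^sup>L lebesgue (\<lambda>x. u x * d x) = integral\<^sup>L lborel (\<lambda>x. u x * d x)"
    using int1 by (intro integral_completion) auto
  moreover have "integral\<^sup>L lebesgue (\<lambda>x. G x $ i * \<phi> x) = integral\<^sup>L lborel (\<lambda>x. G x $ i * \<phi> x)"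
    using int2 by (intro integral_completion) auto
  ultimately show "(LINT x|lebesgue. u x * grad \<phi> x $ i) = - (LINT x|lebesgue. G x $ i * \<phi> x)"
    by (simp add: grad_def d_def)
qed

lemma p_harmonicI:
  fixes u :: "real ^ 'n \<Rightarrow> real"
  assumes "2 \<le> CARD('n)" "1 < p"
    and der: "\<And>x. (u has_derivative (\<lambda>h. G x \<bullet> h)) (at x)" and G: "continuous_on UNIV G"
    and flux: "\<And>x. norm (G x) powr (p - 2) *\<^sub>R G x = V x" and V: "continuous_on UNIV V"
    and V_der: "\<And>x. x \<noteq> 0 \<Longrightarrow> (V has_derivative V' x) (at x)"
    and V': "\<And>h. continuous_on (- {0}) (\<lambda>x. V' x h)"
    and div: "\<And>x. x \<noteq> 0 \<Longrightarrow> tr (V' x) = 0"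
  shows "p_harmonic p u"
  unfolding p_harmonic_def
proof (intro exI[of _ G] conjI allI impI)
  have u: "continuous_on UNIV u" using der by (intro has_derivative_continuous_on) auto
  show "weak_gradient u G" by (rule weak_gradient_C1[OF der G])
  show "Lp_loc p u" "Lp_loc p G"
    using \<open>1 < p\<close> by (auto intro: Lp_loc_continuous u G)
  fix \<phi> :: "real ^ 'n \<Rightarrow> real" assume "test_function \<phi>"
  note \<phi> = test_functionD[OF this]
  have "has_bochner_integral lborel (\<lambda>x. \<Sum>i\<in>UNIV. V x $ i * frechet_derivative \<phi> (at x) (axis i 1)) 0"
  proof (rule weakly_divergence_free[OF assms(1) V V_der V' _ \<phi>(1) \<phi>(2) \<phi>(3)])
    show "(\<Sum>i\<in>UNIV. V' x (axis i 1) $ i) = 0" if "x \<noteq> 0" for x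
      using div[OF that] by (simp add: tr_axis)
    show "\<phi> x = 0" if "x \<notin> closure {x. \<phi> x \<noteq> 0}" for x
      using that closure_subset[of "{x. \<phi> x \<noteq> 0}"] by auto
  qed
  hence "has_bochner_integral lborel (\<lambda>x. (norm (G x) powr (p - 2) *\<^sub>R G x) \<bullet> grad \<phi> x) 0"
    unfolding flux by (simp add: inner_vec_def grad_def)
  thus "has_bochner_integral lebesgue (\<lambda>x. (norm (G x) powr (p - 2) *\<^sub>R G x) \<bullet> grad \<phi> x) 0"
    by (subst has_bochner_integral_lebesgue_iff) (auto simp: has_bochner_integral_iff)
qed

section \<open>Existence of quasi-radial solutions\<close>

theorem theorem1p1:
  fixes p :: real
  assumes "CARD('n::{finite,linorder}) \<ge> 2" and "1 < p"
  shows "\<exists>(k::real) (f::real \<Rightarrow> real). 1 < k \<and> C_on 2 f {0..pi} \<and> f 0 = 1 \<and>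
    (let u = (quasi_radial k f :: real ^ 'n::{finite,linorder} \<Rightarrow> real) in
       p_harmonic p u \<and> C_on 1 u UNIV \<and> C_on 2 u (- {0}) \<and>
       (\<forall>x. grad u x = 0 \<longleftrightarrow> x = 0)) \<and>
    (f has_real_derivative 0) (at 0 within {0..pi}) \<and>
    (f has_real_derivative 0) (at pi within {0..pi}) \<and>
    (\<forall>\<theta>\<in>{0..pi}. f (pi - \<theta>) = f \<theta>)"
proof -
  define N where "N = real CARD('n::{finite,linorder})"
  interpret profile_ode p N by unfold_locales (use assms in \<open>auto simp: N_def\<close>)
  obtain k g g1 g2 where prof: "profile p N k g g1 g2" using profile_exists by blast
  define e :: "real ^ 'n::{finite,linorder}" where "e = axis (Max UNIV) 1"
  interpret axial_solution p N k g g1 g2 e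
    by (intro axial_solution.intro prof axis_direction.intro axial_solution_axioms.intro)
       (auto simp: e_def N_def norm_axis_1)
  define f where "f = (\<lambda>t. g (cos t))"
  have qr: "quasi_radial k f = u"
  proof
    fix x
    have "x \<bullet> e = last_coord x" by (simp add: e_def inner_axis last_coord_def)
    hence "last_coord x / norm x = cs x" by (simp add: cs_def)
    moreover have "cos (arccos (cs x)) = cs x" using cs_bounds[of x] by simp
    ultimately show "quasi_radial k f x = u x" by (simp add: quasi_radial_def u_def f_def)
  qed
  have G_cont: "continuous_on UNIV G.fld" by (rule G.continuous_fld) (use k in simp)
  have harm: "p_harmonic p u"
    by (rule p_harmonicI[OF assms u_deriv G_cont flux_eq V.continuous_fld[OF exponent_pos]
          V.fld_deriv V.continuous_fld' tr_V])
  have C1: "C_on (Suc 0) u UNIV"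
    by (rule C_on_Suc_open[OF open_UNIV u_deriv]) (simp, intro continuous_intros G_cont)
  have C2: "C_on (Suc (Suc 0)) u (- {0})"
  proof (rule C_on_Suc_open[OF _ u_deriv])
    fix b :: "real ^ 'n::{finite,linorder}"
    show "C_on (Suc 0) (\<lambda>x. G.fld x \<bullet> b) (- {0})"
    proof (rule C_on_Suc_open[where f' = "\<lambda>x h. G.fld' x h \<bullet> b"])
      show "((\<lambda>x. G.fld x \<bullet> b) has_derivative (\<lambda>h. G.fld' x h \<bullet> b)) (at x)" if "x \<in> - {0}" for x
        by (rule bounded_linear.has_derivative[OF bounded_linear_inner_left G.fld_deriv]) (use that in simp)
      show "C_on 0 (\<lambda>x. G.fld' x c \<bullet> b) (- {0})" for c
        by (simp, intro continuous_intros G.continuous_fld')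
    qed (simp add: open_Compl)
  qed (simp add: open_Compl)
  have "grad u x = G.fld x" for x
    using frechet_derivative_at[OF u_deriv[of x]]
    by (simp add: grad_def vec_eq_iff inner_axis flip: \<open>_ = frechet_derivative u (at x)\<close>)
  hence crit: "grad u x = 0 \<longleftrightarrow> x = 0" for x by (simp add: G_eq_0_iff)
  have "(f has_real_derivative 0) (at 0 within {0..pi})" "(f has_real_derivative 0) (at pi within {0..pi})"
    using angular_deriv[of 0 "{0..pi}"] angular_deriv[of pi "{0..pi}"] by (simp_all add: f_def f1_def)
  moreover have "C_on 2 f {0..pi}" unfolding f_def by (rule angular_C2)
  moreover have "f 0 = 1" "\<forall>\<theta>\<in>{0..pi}. f (pi - \<theta>) = f \<theta>"
    by (simp_all add: f_def g_one g_even)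
  ultimately show ?thesis
    using k harm C1 C2 crit unfolding Let_def qr[symmetric]
    by (intro exI[of _ k] exI[of _ f]) (simp add: numeral_2_eq_2)
qed

end
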